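(* For every integer $n\ge1$, every $c>1$, every $\epsilon>0$ and every $\xi\ge0$ there are numbers $a(c,\epsilon,n,\xi)$ and $d(c,\epsilon,n,\xi)$ such that for every $c$-bounded Riemannian metric $g$ on $\mathbb{S}^n$ the metric $\mathcal{T}_{a,d}\,g$ is $(B_a,\epsilon)$-close to hyperbolic, with charts of excess $\xi$, whenever $$a>a(c,\epsilon,n,\xi)\qquad\text{and}\qquad d>d(c,\epsilon,n,\xi).$$
   Context: $B_r\subset\mathbb{R}^{n+1}$ is the ball of radius $r$ centered at the origin; $\mathbb{R}^{n+1}\setminus\{0\}$ is identified with $\mathbb{S}^n\times(0,\infty)$ by polar coordinates; $\sigma_{\mathbb{S}^n}$ is the canonical round metric. "Outside $B_r$" means on $\mathbb{R}^{n+1}\setminus B_r$. Two variable warping deformation: fix a smooth function $\rho:\mathbb{R}\to[0,1]$ with $\rho(t)=0$ for $t\le0$, $\rho(t)=1$ for $t\ge1$, $|\rho'|<3$ and $|\rho''|<12$. For $a,d>0$ put $\rho_{a,d}(t)=\rho\big(2\frac{t-a}{d}\big)$, $(g_{a,d})_t=\sigma_{\mathbb{S}^n}+\rho_{a,d}(t)(g-\sigma_{\mathbb{S}^n})$ and $$\mathcal{T}_{a,d}\,g=\sinh^2(t)\,(g_{a,d})_t+dt^2,$$ a Riemannian metric on $\mathbb{R}^{n+1}$. $c$-bounded ($c>1$): for each $n$ fix a finite atlas of $\mathbb{S}^n$ whose charts $\psi:U\to\mathbb{S}^n$, $U\subset\mathbb{R}^n$, extend to the compact closure of their domains and such that for every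 $p\in\mathbb{S}^n$ some chart satisfies $d_{\mathbb{R}^n}(\psi^{-1}(p),\mathbb{R}^n\setminus U)\ge1$. A metric $g$ on $\mathbb{S}^n$ is $c$-bounded if in every chart of this atlas its matrix satisfies $|g|_{C^2}<c$ and $|\det g|>1/c$ at every point. Here $|\cdot|_{C^2}$ is the uniform $C^2$ norm: the maximum of the sup norms of all partial derivatives of order $\le 2$ of the entries. Radially $\epsilon$-close to hyperbolic with charts of excess $\xi$: let $\mathbb{B}\subset\mathbb{R}^n$ be the unit ball and $\mathbb{T}_\xi=\mathbb{B}\times(-(1+\xi),1+\xi)$ with metric $\sigma=e^{2t}\sigma_{\mathbb{R}^n}+dt^2$, $\sigma_{\mathbb{R}^n}$ flat. A metric $h$ on $\mathbb{S}^n\times(0,\infty)$ of the form $\tilde g_t+dt^2$ is radially $\epsilon$-close to hyperbolic on a subset $S$, with charts of excess $\xi$, if for every $p\in S$ there is a chart (diffeomorphism onto an open subset) $\phi:\mathbb{T}_\xi\to\mathbb{S}^n\times(0,\infty)$ with $\phi(0,0)=p$, of the form $\phi(x,t)=(\phi_1(x),t+t_0)$ for some number $t_0$ and chart $\phi_1$ of $\mathbb{S}^n$, such that $|\phi^*h-\sigma|_{C^2}<\epsilon$. $(B_a,\epsilon)$-close to hyperbolic with charts of excess $\xi$: a metric $h$ on $\mathbb{R}^{n+1}$ such that (1) on $B_a\setminus\{0\}=\mathbb{S}^n\times(0,a)$ one has $h=\sinh^2(t)\sigma_{\mathbb{S}^n}+dt^2$ (so $h$ is hyperbolic on $B_a$),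 and (2) $h$ is radially $\epsilon$-close to hyperbolic outside $B_{a-1-\xi}$, with charts of excess $\xi$. *)

theory Defs
  imports "HOL-Analysis.Analysis"
begin

text \<open>
  Euclidean space of dimension n is \<^typ>\<open>real ^ 'n\<close>; Euclidean space of dimension n + 1 is
  \<^typ>\<open>(real ^ 'n) \<times> real\<close>, whose inner product is the standard one, and the n-sphere is
  \<^term>\<open>sphere 0 1\<close> in it.  A field of bilinear forms is a function taking the base point and two
  vectors; on the sphere, and on the cylinder (sphere times half-line) inside
  \<^typ>\<open>((real ^ 'n) \<times> real) \<times> real\<close>, only its values at base points of that manifold and on
  tangent vectors are meaningful.
\<close>

subsection \<open>Smooth maps and charts\<close>

text \<open>Used for open \<open>U\<close> and finite-dimensional domains only, where this is the usual class
  of k times continuously differentiable maps.\<close>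

fun C_k_on :: "nat \<Rightarrow> ('a::real_normed_vector) set \<Rightarrow> ('a \<Rightarrow> 'b::real_normed_vector) \<Rightarrow> bool" where
  "C_k_on 0 U f \<longleftrightarrow> continuous_on U f"
| "C_k_on (Suc k) U f \<longleftrightarrow>
     (\<forall>x\<in>U. f differentiable (at x)) \<and> (\<forall>v. C_k_on k U (\<lambda>x. frechet_derivative f (at x) v))"

definition smooth_on :: "('a::real_normed_vector) set \<Rightarrow> ('a \<Rightarrow> 'b::real_normed_vector) \<Rightarrow> bool" where
  "smooth_on U f \<longleftrightarrow> (\<forall>k. C_k_on k U f)"

text \<open>\<open>\<psi>\<close> is a diffeomorphism from the open set \<open>U\<close> onto an open subset of the embedded
  submanifold \<open>M\<close>; smoothness of the inverse means that it is the restriction of a smooth map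
  \<open>\<kappa>\<close> defined on an open subset \<open>W\<close> of the ambient space.\<close>

definition chart_of ::
  "('b::euclidean_space) set \<Rightarrow> ('a::euclidean_space) set \<Rightarrow> ('a \<Rightarrow> 'b) \<Rightarrow> bool" where
  "chart_of M U \<psi> \<longleftrightarrow>
     open U \<and> smooth_on U \<psi> \<and> openin (top_of_set M) (\<psi> ` U) \<and>
     (\<exists>W \<kappa>. open W \<and> \<psi> ` U \<subseteq> W \<and> smooth_on W \<kappa> \<and> (\<forall>x\<in>U. \<kappa> (\<psi> x) = x))"

definition pullback ::
  "('a::real_normed_vector \<Rightarrow> 'b::real_normed_vector) \<Rightarrow> ('b \<Rightarrow> 'b \<Rightarrow> 'b \<Rightarrow> real)
     \<Rightarrow> 'a \<Rightarrow> 'a \<Rightarrow> 'a \<Rightarrow> real" where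
  "pullback F h x u v = h (F x) (frechet_derivative F (at x) u) (frechet_derivative F (at x) v)"


subsection \<open>Riemannian metrics\<close>

definition inner_product_on :: "('a::real_vector) set \<Rightarrow> ('a \<Rightarrow> 'a \<Rightarrow> real) \<Rightarrow> bool" where
  "inner_product_on V B \<longleftrightarrow>
     (\<forall>u\<in>V. \<forall>v\<in>V. B u v = B v u) \<and>
     (\<forall>u\<in>V. \<forall>v\<in>V. \<forall>w\<in>V. \<forall>r. B (u + r *\<^sub>R v) w = B u w + r * B v w) \<and>
     (\<forall>u\<in>V. u \<noteq> 0 \<longrightarrow> B u u > 0)"

definition metric_on_open ::
  "('a::euclidean_space) set \<Rightarrow> ('a \<Rightarrow> 'a \<Rightarrow> 'a \<Rightarrow> real) \<Rightarrow> bool" where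
  "metric_on_open X h \<longleftrightarrow>
     (\<forall>x\<in>X. inner_product_on UNIV (h x)) \<and>
     (\<forall>b\<in>Basis. \<forall>c\<in>Basis. smooth_on X (\<lambda>x. h x b c))"

definition tangent_sphere :: "'a::euclidean_space \<Rightarrow> 'a set" where
  "tangent_sphere \<theta> = {u. u \<bullet> \<theta> = 0}"

definition metric_on_sphere ::
  "((real ^ 'n) \<times> real \<Rightarrow> (real ^ 'n) \<times> real \<Rightarrow> (real ^ 'n) \<times> real \<Rightarrow> real) \<Rightarrow> bool" where
  "metric_on_sphere g \<longleftrightarrow>
     (\<forall>\<theta>\<in>sphere 0 1. inner_product_on (tangent_sphere \<theta>) (g \<theta>)) \<and>
     (\<forall>(U :: (real ^ 'n) set) \<psi>. chart_of (sphere 0 1) U \<psi> \<longrightarrow>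
        (\<forall>b\<in>Basis. \<forall>c\<in>Basis. smooth_on U (\<lambda>x. pullback \<psi> g x b c)))"

text \<open>The round metric on the sphere is the restriction of the ambient inner product.\<close>

definition round_metric :: "'a::euclidean_space \<Rightarrow> 'a \<Rightarrow> 'a \<Rightarrow> real" where
  "round_metric \<theta> u v = u \<bullet> v"


subsection \<open>The uniform $C^2$ norm\<close>

definition partial :: "'a::euclidean_space \<Rightarrow> ('a \<Rightarrow> real) \<Rightarrow> 'a \<Rightarrow> real" where
  "partial b f x = frechet_derivative f (at x) b"

definition partials_upto_2 :: "('a::euclidean_space \<Rightarrow> real) \<Rightarrow> ('a \<Rightarrow> real) set" where
  "partials_upto_2 f =
     {f} \<union> {partial b f | b. b \<in> Basis} \<union> {partial b (partial c f) | b c. b \<in> Basis \<and> c \<in> Basis}"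

definition sup_norm :: "'a set \<Rightarrow> ('a \<Rightarrow> real) \<Rightarrow> ennreal" where
  "sup_norm U f = (SUP x\<in>U. ennreal \<bar>f x\<bar>)"

text \<open>Extended-valued, so that an unbounded derivative gives norm infinity.\<close>

definition C2_norm ::
  "('a::euclidean_space) set \<Rightarrow> ('a \<Rightarrow> 'a \<Rightarrow> 'a \<Rightarrow> real) \<Rightarrow> ennreal" where
  "C2_norm U h = Max {sup_norm U f | f b c. b \<in> Basis \<and> c \<in> Basis \<and> f \<in> partials_upto_2 (\<lambda>x. h x b c)}"


subsection \<open>Bounded metrics on the sphere\<close>

text \<open>That a chart extends to the compact closure of its domain means that it is the restriction of
  a chart defined on an open neighbourhood of this closure.\<close>

definition admissible_atlas ::
  "((real ^ 'n) set \<times> (real ^ 'n \<Rightarrow> (real ^ 'n) \<times> real)) set \<Rightarrow> bool" where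
  "admissible_atlas A \<longleftrightarrow>
     finite A \<and>
     (\<forall>(U, \<psi>)\<in>A. chart_of (sphere 0 1) U \<psi> \<and> compact (closure U) \<and>
        (\<exists>V \<psi>'. closure U \<subseteq> V \<and> chart_of (sphere 0 1) V \<psi>' \<and> (\<forall>x\<in>U. \<psi>' x = \<psi> x))) \<and>
     (\<forall>p\<in>sphere 0 1. \<exists>(U, \<psi>)\<in>A. \<exists>x\<in>U. \<psi> x = p \<and> infdist x (- U) \<ge> 1)"

definition metric_matrix ::
  "(real ^ 'n \<Rightarrow> real ^ 'n \<Rightarrow> real ^ 'n \<Rightarrow> real) \<Rightarrow> real ^ 'n \<Rightarrow> real ^ 'n ^ 'n" where
  "metric_matrix h x = (\<chi> i j. h x (axis i 1) (axis j 1))"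

definition c_bounded ::
  "((real ^ 'n) set \<times> (real ^ 'n \<Rightarrow> (real ^ 'n) \<times> real)) set \<Rightarrow> real
     \<Rightarrow> ((real ^ 'n) \<times> real \<Rightarrow> (real ^ 'n) \<times> real \<Rightarrow> (real ^ 'n) \<times> real \<Rightarrow> real) \<Rightarrow> bool" where
  "c_bounded A c g \<longleftrightarrow>
     (\<forall>(U, \<psi>)\<in>A. C2_norm U (pullback \<psi> g) < ennreal c \<and>
        (\<forall>x\<in>U. \<bar>det (metric_matrix (pullback \<psi> g) x)\<bar> > 1 / c))"


subsection \<open>Polar coordinates and the two variable warping deformation\<close>

definition polar :: "'a::real_normed_vector \<times> real \<Rightarrow> 'a" where
  "polar z = snd z *\<^sub>R fst z"

definition cylinder :: "('a::real_normed_vector \<times> real) set" where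
  "cylinder = sphere 0 1 \<times> {0<..}"

text \<open>The field on the ambient space which in polar coordinates is \<open>k\<^sub>t + dt\<^sup>2\<close> (lemma
  \<open>pullback_polar_from_polar\<close> below).  At the origin it is given the Euclidean inner product, which is
  the value there of \<open>sinh\<^sup>2(t) \<sigma> + dt\<^sup>2\<close>, where \<open>\<sigma>\<close> is the round metric.\<close>

definition from_polar ::
  "(real \<Rightarrow> 'a::euclidean_space \<Rightarrow> 'a \<Rightarrow> 'a \<Rightarrow> real) \<Rightarrow> 'a \<Rightarrow> 'a \<Rightarrow> 'a \<Rightarrow> real" where
  "from_polar k p v w =
     (if p = 0 then v \<bullet> w
      else let t = norm p; \<theta> = p /\<^sub>R t; \<tau> = (\<lambda>v. (v - (v \<bullet> \<theta>) *\<^sub>R \<theta>) /\<^sub>R t)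
           in k t \<theta> (\<tau> v) (\<tau> w) + (v \<bullet> \<theta>) * (w \<bullet> \<theta>))"

lemma frechet_derivative_polar:
  "frechet_derivative polar (at (\<theta>, t)) (u, r) = t *\<^sub>R u + r *\<^sub>R \<theta>"
proof -
  have "(polar has_derivative (\<lambda>h. snd (\<theta>, t) *\<^sub>R fst h + snd h *\<^sub>R fst (\<theta>, t))) (at (\<theta>, t))"
    unfolding polar_def by (auto intro!: derivative_eq_intros)
  then show ?thesis
    by (simp add: frechet_derivative_at[symmetric])
qed

lemma pullback_polar_from_polar:
  assumes "norm \<theta> = 1" "t > 0" "u \<in> tangent_sphere \<theta>" "v \<in> tangent_sphere \<theta>"
  shows "pullback polar (from_polar k) (\<theta>, t) (u, r) (v, s) = k t \<theta> u v + r * s"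
proof -
  have "\<theta> \<bullet> \<theta> = 1" and "\<theta> \<noteq> 0"
    using assms(1) by (auto simp: norm_eq_1)
  then show ?thesis
    using assms unfolding pullback_def frechet_derivative_polar from_polar_def
    by (simp add: polar_def tangent_sphere_def inner_add_left Let_def)
qed

definition cutoff :: "(real \<Rightarrow> real) \<Rightarrow> bool" where
  "cutoff \<rho> \<longleftrightarrow>
     smooth_on UNIV \<rho> \<and> (\<forall>t. \<rho> t \<in> {0..1}) \<and> (\<forall>t\<le>0. \<rho> t = 0) \<and> (\<forall>t\<ge>1. \<rho> t = 1) \<and>
     (\<forall>t. \<bar>deriv \<rho> t\<bar> < 3) \<and> (\<forall>t. \<bar>deriv (deriv \<rho>) t\<bar> < 12)"

definition interpolated_metric ::
  "(real \<Rightarrow> real) \<Rightarrow> real \<Rightarrow> real \<Rightarrow> ('a::euclidean_space \<Rightarrow> 'a \<Rightarrow> 'a \<Rightarrow> real)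
     \<Rightarrow> real \<Rightarrow> 'a \<Rightarrow> 'a \<Rightarrow> 'a \<Rightarrow> real" where
  "interpolated_metric \<rho> a d g t \<theta> u v =
     round_metric \<theta> u v + \<rho> (2 * ((t - a) / d)) * (g \<theta> u v - round_metric \<theta> u v)"

definition warping_deformation ::
  "(real \<Rightarrow> real) \<Rightarrow> real \<Rightarrow> real \<Rightarrow> ('a::euclidean_space \<Rightarrow> 'a \<Rightarrow> 'a \<Rightarrow> real)
     \<Rightarrow> 'a \<Rightarrow> 'a \<Rightarrow> 'a \<Rightarrow> real" where
  "warping_deformation \<rho> a d g =
     from_polar (\<lambda>t \<theta> u v. (sinh t)\<^sup>2 * interpolated_metric \<rho> a d g t \<theta> u v)"


subsection \<open>Closeness to hyperbolic metrics\<close>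

definition model_cylinder :: "real \<Rightarrow> ((real ^ 'n) \<times> real) set" where
  "model_cylinder \<xi> = ball 0 1 \<times> {- (1 + \<xi>)<..<1 + \<xi>}"

definition model_metric ::
  "(real ^ 'n) \<times> real \<Rightarrow> (real ^ 'n) \<times> real \<Rightarrow> (real ^ 'n) \<times> real \<Rightarrow> real" where
  "model_metric z u v = exp (2 * snd z) * (fst u \<bullet> fst v) + snd u * snd v"

text \<open>The field \<open>h\<close> lives on the ambient space minus the origin, identified with the cylinder by
  \<^const>\<open>polar\<close>, and \<open>S\<close> is a subset of that space.\<close>

definition radially_close ::
  "real \<Rightarrow> real \<Rightarrow> ((real ^ 'n) \<times> real) set
     \<Rightarrow> ((real ^ 'n) \<times> real \<Rightarrow> (real ^ 'n) \<times> real \<Rightarrow> (real ^ 'n) \<times> real \<Rightarrow> real) \<Rightarrow> bool" where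
  "radially_close \<epsilon> \<xi> S h \<longleftrightarrow>
     metric_on_open (- {0}) h \<and>
     (\<exists>k. (\<forall>t>0. metric_on_sphere (k t)) \<and>
        (\<forall>\<theta>\<in>sphere 0 1. \<forall>t>0. \<forall>u\<in>tangent_sphere \<theta>. \<forall>v\<in>tangent_sphere \<theta>. \<forall>r s.
           pullback polar h (\<theta>, t) (u, r) (v, s) = k t \<theta> u v + r * s)) \<and>
     (\<forall>p\<in>S. \<exists>(\<phi> :: (real ^ 'n) \<times> real \<Rightarrow> ((real ^ 'n) \<times> real) \<times> real) \<phi>\<^sub>1 t\<^sub>0.
        chart_of cylinder (model_cylinder \<xi>) \<phi> \<and> polar (\<phi> (0, 0)) = p \<and>
        chart_of (sphere 0 1) (ball 0 1) \<phi>\<^sub>1 \<and>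
        (\<forall>(x, t)\<in>model_cylinder \<xi>. \<phi> (x, t) = (\<phi>\<^sub>1 x, t + t\<^sub>0)) \<and>
        C2_norm (model_cylinder \<xi>)
          (\<lambda>z u v. pullback \<phi> (pullback polar h) z u v - model_metric z u v) < ennreal \<epsilon>)"

definition close_to_hyperbolic ::
  "real \<Rightarrow> real \<Rightarrow> real
     \<Rightarrow> ((real ^ 'n) \<times> real \<Rightarrow> (real ^ 'n) \<times> real \<Rightarrow> (real ^ 'n) \<times> real \<Rightarrow> real) \<Rightarrow> bool" where
  "close_to_hyperbolic a \<epsilon> \<xi> h \<longleftrightarrow>
     metric_on_open UNIV h \<and>
     (\<forall>\<theta>\<in>sphere 0 1. \<forall>t\<in>{0<..<a}. \<forall>u\<in>tangent_sphere \<theta>. \<forall>v\<in>tangent_sphere \<theta>. \<forall>r s.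
        pullback polar h (\<theta>, t) (u, r) (v, s) = (sinh t)\<^sup>2 * round_metric \<theta> u v + r * s) \<and>
     radially_close \<epsilon> \<xi> (- ball 0 (a - 1 - \<xi>) - {0}) h"

end

theory Submission
  imports Defs
begin

text \<open>
  At a point \<open>p\<close> at distance \<open>t\<^sub>0\<close> from the origin take an atlas chart \<open>\<psi>\<close> with \<open>\<psi>(x\<^sub>0) = p/t\<^sub>0\<close> and
  compose it with \<open>x \<mapsto> x\<^sub>0 + \<mu> L x\<close>, where \<open>\<mu> = 2 exp(-t\<^sub>0)\<close> and \<open>L\<close> is linear and orthonormalizes the
  interpolated metric at \<open>(x\<^sub>0, t\<^sub>0)\<close>.  In this chart the warping factor becomes
  \<open>\<mu>\<^sup>2 sinh\<^sup>2(t + t\<^sub>0) = exp(2t) + O(exp(-t\<^sub>0))\<close>, while the interpolated metric is Euclidean at the centre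
  and varies slowly: its \<open>x\<close>-derivatives pick up factors \<open>\<mu>\<close> and its \<open>t\<close>-derivatives, coming from the
  cutoff, factors \<open>1/d\<close>.  The norm of \<open>L\<close> is bounded uniformly because the symmetric positive
  semidefinite matrices with entries at most \<open>c\<close> and determinant at least \<open>1/c\<close> form a compact set of
  positive definite matrices.  Smoothness at the origin holds because there the metric is hyperbolic.
\<close>

subsection \<open>Calculus of smooth maps\<close>

text \<open>The difficulty is uniformity: one pair of thresholds must serve all metrics
  \<open>g\<close> and all base points. For this reason the metric is only ever seen through its
  coefficients in finitely many fixed charts, and these are reparametrized by affine maps alone. The
  unit ball around \<open>x\<^sub>0\<close> inside the chart domain, granted by the atlas, leaves
  room for the contracted ball. Since the metric interpolates between the round one and
  \<open>g\<close>, both need bounds on coefficients and on the smallest eigenvalue. For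
  \<open>g\<close> these come from \<open>c\<close>; for the round metric they come from the
  extension of each chart past the compact closure of its domain. Between the two metrics the cutoff
  may take any value: what counts is its variation across one chart, of order
  \<open>(1 + \<xi>) / d\<close>. The total error is at most
  \<open>C * (exp (- t\<^sub>0) + 1 / d)\<close> with \<open>C\<close> independent of
  \<open>g\<close> and of the point, and \<open>t\<^sub>0 \<ge> a - 1 - \<xi>\<close> turns this
  into thresholds for \<open>a\<close> and \<open>d\<close>.\<close>

lemma has_derivative_frechet:
  "f differentiable (at x) \<Longrightarrow> (f has_derivative frechet_derivative f (at x)) (at x)"
  by (simp add: frechet_derivative_works)

lemma frechet_derivative_cong_open:
  assumes "open U" "x \<in> U" "\<And>y. y \<in> U \<Longrightarrow> f y = g y"
  shows "frechet_derivative f (at x) = frechet_derivative g (at x)"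
proof -
  have "(f has_derivative D) (at x) \<longleftrightarrow> (g has_derivative D) (at x)" for D
    using has_derivative_transform_within_open[OF _ assms(1,2)] assms(3) by (intro iffI) auto
  then show ?thesis
    unfolding frechet_derivative_def by simp
qed

lemma differentiable_cong_open:
  assumes "open U" "x \<in> U" "\<And>y. y \<in> U \<Longrightarrow> f y = g y" "f differentiable (at x)"
  shows "g differentiable (at x)"
proof -
  obtain D where "(f has_derivative D) (at x)"
    using assms(4) unfolding differentiable_def by blast
  then have "(g has_derivative D) (at x)"
    by (rule has_derivative_transform_within_open[OF _ assms(1,2)]) (rule assms(3))
  then show ?thesis
    unfolding differentiable_def by blast
qed

lemma C_k_on_cong:
  assumes "open U" "\<And>y. y \<in> U \<Longrightarrow> f y = g y"
  shows "C_k_on k U f \<longleftrightarrow> C_k_on k U g"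
  using assms(2)
proof (induction k arbitrary: f g)
  case 0
  then show ?case by (simp cong: continuous_on_cong)
next
  case (Suc k)
  have "f differentiable (at x) \<longleftrightarrow> g differentiable (at x)" if "x \<in> U" for x
    using differentiable_cong_open[OF assms(1) that] Suc.prems by metis
  moreover have "C_k_on k U (\<lambda>x. frechet_derivative f (at x) v)
      \<longleftrightarrow> C_k_on k U (\<lambda>x. frechet_derivative g (at x) v)" for v
    by (rule Suc.IH) (simp add: frechet_derivative_cong_open[OF assms(1) _ Suc.prems])
  ultimately show ?case by simp
qed

lemma C_k_on_congI:
  "open U \<Longrightarrow> C_k_on k U g \<Longrightarrow> (\<And>y. y \<in> U \<Longrightarrow> f y = g y) \<Longrightarrow> C_k_on k U f"
  using C_k_on_cong by blast

lemma C_k_on_subset: "C_k_on k U f \<Longrightarrow> V \<subseteq> U \<Longrightarrow> C_k_on k V f"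
  by (induction k arbitrary: f) (auto intro: continuous_on_subset)

text \<open>Glues local statements: the deformed metric is smooth for different reasons near the
  origin and away from it, and on the sphere every point brings its own chart.\<close>

lemma C_k_on_local:
  assumes "\<And>x. x \<in> U \<Longrightarrow> \<exists>V. open V \<and> x \<in> V \<and> C_k_on k V f"
  shows "C_k_on k U f"
  using assms
proof (induction k arbitrary: f)
  case 0
  show ?case
    unfolding C_k_on.simps
  proof (rule continuous_at_imp_continuous_on, rule ballI)
    fix x assume "x \<in> U"
    then obtain V where "open V" "x \<in> V" "continuous_on V f"
      using 0 by auto
    then show "isCont f x"
      by (simp add: continuous_on_eq_continuous_at)
  qed
next
  case (Suc k)
  have "f differentiable (at x)" if "x \<in> U" for x
    using Suc.prems[OF that] by auto
  moreover have "C_k_on k U (\<lambda>x. frechet_derivative f (at x) v)" for v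
  proof (rule Suc.IH)
    fix x assume "x \<in> U"
    then obtain V where "open V" "x \<in> V" "C_k_on (Suc k) V f"
      using Suc.prems by blast
    then show "\<exists>V. open V \<and> x \<in> V \<and> C_k_on k V (\<lambda>x. frechet_derivative f (at x) v)"
      by auto
  qed
  ultimately show ?case by simp
qed

text \<open>\<open>C_k_on (Suc k)\<close> asks for differentiability and for class k of the
  derivatives, so the inclusion is not part of the definition; at level 0 it is the continuity of
  differentiable maps.\<close>

lemma C_k_on_Suc_imp: "C_k_on (Suc k) U f \<Longrightarrow> C_k_on k U f"
proof (induction k arbitrary: f)
  case 0
  then show ?case
    by (auto intro!: continuous_at_imp_continuous_on differentiable_imp_continuous_within)
qed auto

lemma C_k_on_const: "C_k_on k U (\<lambda>x. c)"
proof (induction k arbitrary: c)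
  case (Suc k)
  then show ?case by (simp add: frechet_derivative_at[OF has_derivative_const, symmetric])
qed simp

lemma C_k_on_linear:
  assumes "bounded_linear f"
  shows "C_k_on k U f"
proof (cases k)
  case 0
  then show ?thesis
    by (simp add: assms linear_continuous_on)
next
  case (Suc j)
  have "frechet_derivative f (at x) = f" for x
    by (simp flip: frechet_derivative_at[OF bounded_linear_imp_has_derivative[OF assms]])
  then show ?thesis
    using Suc bounded_linear_imp_differentiable[OF assms] by (simp add: C_k_on_const)
qed

lemma frechet_derivative_add':
  assumes "f differentiable (at x)" "g differentiable (at x)"
  shows "frechet_derivative (\<lambda>x. f x + g x) (at x) v
      = frechet_derivative f (at x) v + frechet_derivative g (at x) v"
  using has_derivative_add[OF assms[THEN has_derivative_frechet]]
  by (metis frechet_derivative_at)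

lemma C_k_on_add:
  assumes "open U" "C_k_on k U f" "C_k_on k U g"
  shows "C_k_on k U (\<lambda>x. f x + g x)"
  using assms(2,3)
proof (induction k arbitrary: f g)
  case 0
  then show ?case by (simp add: continuous_on_add)
next
  case (Suc k)
  have "C_k_on k U (\<lambda>x. frechet_derivative (\<lambda>x. f x + g x) (at x) v)" for v
    by (rule C_k_on_congI[OF assms(1) Suc.IH]) (use Suc.prems in \<open>auto simp: frechet_derivative_add'\<close>)
  then show ?case using Suc.prems by auto
qed

lemma C_k_on_sum:
  assumes "open U" "\<And>i. i \<in> I \<Longrightarrow> C_k_on k U (f i)"
  shows "C_k_on k U (\<lambda>x. \<Sum>i\<in>I. f i x)"
  using assms(2)
  by (induction I rule: infinite_finite_induct) (auto intro: C_k_on_const C_k_on_add assms(1))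

lemma (in bounded_bilinear) frechet_derivative_bilinear:
  assumes "f differentiable (at x)" "g differentiable (at x)"
  shows "frechet_derivative (\<lambda>x. prod (f x) (g x)) (at x) v
      = prod (f x) (frechet_derivative g (at x) v) + prod (frechet_derivative f (at x) v) (g x)"
  using FDERIV[OF assms[THEN has_derivative_frechet]]
  by (metis frechet_derivative_at)

text \<open>By the Leibniz rule the derivative is a sum of two products of the same kind, so one
  induction covers scaling, inner product and multiplication.\<close>

lemma (in bounded_bilinear) C_k_on_bilinear:
  assumes "open U" "C_k_on k U f" "C_k_on k U g"
  shows "C_k_on k U (\<lambda>x. prod (f x) (g x))"
  using assms(2,3)
proof (induction k arbitrary: f g)
  case 0
  then show ?case by (simp add: continuous_on)
next
  case (Suc k)
  have "C_k_on k U (\<lambda>x. prod (f x) (frechet_derivative g (at x) v)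
      + prod (frechet_derivative f (at x) v) (g x))" for v
    using Suc C_k_on_Suc_imp[OF Suc.prems(1)] C_k_on_Suc_imp[OF Suc.prems(2)]
    by (intro C_k_on_add assms(1) Suc.IH) auto
  then have "C_k_on k U (\<lambda>x. frechet_derivative (\<lambda>x. prod (f x) (g x)) (at x) v)" for v
    by (rule C_k_on_congI[OF assms(1)]) (use Suc.prems in \<open>auto simp: frechet_derivative_bilinear\<close>)
  moreover have "(\<lambda>x. prod (f x) (g x)) differentiable (at x)" if "x \<in> U" for x
    using FDERIV[OF has_derivative_frechet has_derivative_frechet, of f x g] Suc.prems that
    unfolding differentiable_def[of "\<lambda>x. prod (f x) (g x)"] by (metis C_k_on.simps(2))
  ultimately show ?case by simp
qed

lemma linear_frechet_expand:
  fixes f :: "'a::euclidean_space \<Rightarrow> 'b::real_normed_vector"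
  assumes "f differentiable (at x)"
  shows "frechet_derivative f (at x) v = (\<Sum>b\<in>Basis. (v \<bullet> b) *\<^sub>R frechet_derivative f (at x) b)"
proof -
  have l: "linear (frechet_derivative f (at x))"
    using assms by (rule linear_frechet_derivative)
  have "frechet_derivative f (at x) v = frechet_derivative f (at x) (\<Sum>b\<in>Basis. (v \<bullet> b) *\<^sub>R b)"
    by (simp add: euclidean_representation)
  also have "\<dots> = (\<Sum>b\<in>Basis. (v \<bullet> b) *\<^sub>R frechet_derivative f (at x) b)"
    by (simp add: linear_sum[OF l] linear_cmul[OF l])
  finally show ?thesis .
qed

lemma frechet_derivative_comp:
  assumes "g differentiable (at x)" "f differentiable (at (g x))"
  shows "frechet_derivative (\<lambda>x. f (g x)) (at x) v
    = frechet_derivative f (at (g x)) (frechet_derivative g (at x) v)"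
  using has_derivative_compose[OF assms[THEN has_derivative_frechet]]
  by (metis frechet_derivative_at)

text \<open>In the chain rule the direction in which \<open>f\<close> is differentiated varies with
  \<open>x\<close>, while \<open>C_k_on\<close> controls derivatives in fixed directions. Expanding
  that direction in the basis leaves derivatives of \<open>f\<close> along fixed basis vectors, to
  which the induction hypothesis applies.\<close>

lemma C_k_on_compose:
  fixes f :: "'b::euclidean_space \<Rightarrow> 'c::real_normed_vector" and g :: "'a::real_normed_vector \<Rightarrow> 'b"
  assumes "open U" "C_k_on k U g" "C_k_on k V f" "g ` U \<subseteq> V"
  shows "C_k_on k U (\<lambda>x. f (g x))"
  using assms(2,3)
proof (induction k arbitrary: f)
  case 0
  then show ?case using assms(4) by (auto intro: continuous_on_compose2)
next
  case (Suc k)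
  have d: "g differentiable (at x)" "f differentiable (at (g x))" if "x \<in> U" for x
    using Suc.prems assms(4) that by auto
  have "C_k_on k U (\<lambda>x. \<Sum>b\<in>Basis. (frechet_derivative g (at x) v \<bullet> b) *\<^sub>R frechet_derivative f (at (g x)) b)" for v
    using Suc.prems C_k_on_Suc_imp[OF Suc.prems(1)]
    by (intro C_k_on_sum bounded_bilinear.C_k_on_bilinear[OF bounded_bilinear_scaleR]
          bounded_bilinear.C_k_on_bilinear[OF bounded_bilinear_inner] assms(1) C_k_on_const Suc.IH) auto
  moreover have "frechet_derivative (\<lambda>x. f (g x)) (at x) v
      = (\<Sum>b\<in>Basis. (frechet_derivative g (at x) v \<bullet> b) *\<^sub>R frechet_derivative f (at (g x)) b)" if "x \<in> U" for x v
    using d[OF that] by (simp add: frechet_derivative_comp flip: linear_frechet_expand)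
  ultimately have "C_k_on k U (\<lambda>x. frechet_derivative (\<lambda>x. f (g x)) (at x) v)" for v
    by (rule C_k_on_congI[OF assms(1)])
  moreover have "(\<lambda>x. f (g x)) differentiable (at x)" if "x \<in> U" for x
    using differentiable_chain_at[OF d[OF that]] by (simp add: o_def)
  ultimately show ?case by simp
qed

section \<open>Closure properties of smooth maps\<close>

lemma smooth_on_cong:
  "open U \<Longrightarrow> (\<And>y. y \<in> U \<Longrightarrow> f y = g y) \<Longrightarrow> smooth_on U f \<longleftrightarrow> smooth_on U g"
  unfolding smooth_on_def using C_k_on_cong by blast

lemma smooth_on_subset: "smooth_on U f \<Longrightarrow> V \<subseteq> U \<Longrightarrow> smooth_on V f"
  unfolding smooth_on_def using C_k_on_subset by blast

lemma smooth_on_local: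
  "(\<And>x. x \<in> U \<Longrightarrow> \<exists>V. open V \<and> x \<in> V \<and> smooth_on V f) \<Longrightarrow> smooth_on U f"
  unfolding smooth_on_def by (meson C_k_on_local)

lemma smooth_on_differentiable: "smooth_on U f \<Longrightarrow> x \<in> U \<Longrightarrow> f differentiable (at x)"
  unfolding smooth_on_def by (metis C_k_on.simps(2))

lemma smooth_on_continuous: "smooth_on U f \<Longrightarrow> continuous_on U f"
  unfolding smooth_on_def by (metis C_k_on.simps(1))

lemma smooth_on_frechet: "smooth_on U f \<Longrightarrow> smooth_on U (\<lambda>x. frechet_derivative f (at x) v)"
  unfolding smooth_on_def by (metis C_k_on.simps(2))

lemma smooth_on_const: "smooth_on U (\<lambda>x. c)"
  unfolding smooth_on_def by (simp add: C_k_on_const)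

lemma smooth_on_linear: "bounded_linear f \<Longrightarrow> smooth_on U f"
  unfolding smooth_on_def by (simp add: C_k_on_linear)

lemma smooth_on_id: "smooth_on U (\<lambda>x. x)"
  by (rule smooth_on_linear) simp

lemma smooth_on_add:
  "open U \<Longrightarrow> smooth_on U f \<Longrightarrow> smooth_on U g \<Longrightarrow> smooth_on U (\<lambda>x. f x + g x)"
  unfolding smooth_on_def by (simp add: C_k_on_add)

lemma smooth_on_sum:
  "open U \<Longrightarrow> (\<And>i. i \<in> I \<Longrightarrow> smooth_on U (f i)) \<Longrightarrow> smooth_on U (\<lambda>x. \<Sum>i\<in>I. f i x)"
  unfolding smooth_on_def by (simp add: C_k_on_sum)

lemma smooth_on_scaleR:
  "open U \<Longrightarrow> smooth_on U f \<Longrightarrow> smooth_on U g \<Longrightarrow> smooth_on U (\<lambda>x. f x *\<^sub>R g x)"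
  unfolding smooth_on_def by (simp add: bounded_bilinear.C_k_on_bilinear[OF bounded_bilinear_scaleR])

lemma smooth_on_inner:
  "open U \<Longrightarrow> smooth_on U f \<Longrightarrow> smooth_on U g \<Longrightarrow> smooth_on U (\<lambda>x. f x \<bullet> g x)"
  unfolding smooth_on_def by (simp add: bounded_bilinear.C_k_on_bilinear[OF bounded_bilinear_inner])

lemma smooth_on_mult:
  fixes f g :: "'a::real_normed_vector \<Rightarrow> real"
  shows "open U \<Longrightarrow> smooth_on U f \<Longrightarrow> smooth_on U g \<Longrightarrow> smooth_on U (\<lambda>x. f x * g x)"
  unfolding smooth_on_def by (simp add: bounded_bilinear.C_k_on_bilinear[OF bounded_bilinear_mult])

lemma smooth_on_minus: "open U \<Longrightarrow> smooth_on U f \<Longrightarrow> smooth_on U (\<lambda>x. - f x)"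
  using smooth_on_scaleR[OF _ smooth_on_const[of U "-1::real"]] by simp

lemma smooth_on_diff:
  "open U \<Longrightarrow> smooth_on U f \<Longrightarrow> smooth_on U g \<Longrightarrow> smooth_on U (\<lambda>x. f x - g x)"
  using smooth_on_add[OF _ _ smooth_on_minus] by fastforce

lemma smooth_on_power:
  fixes f :: "'a::real_normed_vector \<Rightarrow> real"
  shows "open U \<Longrightarrow> smooth_on U f \<Longrightarrow> smooth_on U (\<lambda>x. f x ^ m)"
  by (induction m) (simp_all add: smooth_on_const smooth_on_mult)

lemma smooth_on_compose:
  fixes f :: "'b::euclidean_space \<Rightarrow> 'c::real_normed_vector" and g :: "'a::real_normed_vector \<Rightarrow> 'b"
  assumes "open U" "smooth_on U g" "smooth_on V f" "g ` U \<subseteq> V"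
  shows "smooth_on U (\<lambda>x. f (g x))"
  using assms(2,3) C_k_on_compose[OF assms(1) _ _ assms(4)] unfolding smooth_on_def by blast

lemma smooth_on_Pair:
  fixes f :: "'a::real_normed_vector \<Rightarrow> 'b::euclidean_space" and g :: "'a \<Rightarrow> 'c::euclidean_space"
  assumes "open U" "smooth_on U f" "smooth_on U g"
  shows "smooth_on U (\<lambda>x. (f x, g x))"
proof -
  have "smooth_on U (\<lambda>x. (f x, 0::'c))" "smooth_on U (\<lambda>x. (0::'b, g x))"
    using smooth_on_compose[OF assms(1,2) smooth_on_linear[of "\<lambda>y. (y, 0::'c)" UNIV]]
      smooth_on_compose[OF assms(1,3) smooth_on_linear[of "\<lambda>y. (0::'b, y)" UNIV]]
    by (simp_all add: bounded_linear_Pair)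
  from smooth_on_add[OF assms(1) this] show ?thesis by simp
qed

lemma smooth_on_fst: "smooth_on U fst" and smooth_on_snd: "smooth_on U snd"
  by (simp_all add: smooth_on_linear bounded_linear_fst bounded_linear_snd)

text \<open>Bootstrapping: the derivative is a polynomial in \<open>inverse\<close> itself, so class
  k yields class k + 1. The norm and the exponential below are treated in the same way.\<close>

lemma smooth_on_inverse_real: "smooth_on (- {0}) (inverse :: real \<Rightarrow> real)"
  unfolding smooth_on_def
proof
  fix k show "C_k_on k (- {0}) (inverse :: real \<Rightarrow> real)"
  proof (induction k)
    case 0
    then show ?case by (simp add: continuous_on_inverse)
  next
    case (Suc k)
    have d: "(inverse has_derivative (\<lambda>v. - (inverse x * v * inverse x))) (at x)" if "x \<noteq> 0" for x :: real
      using Deriv.has_derivative_inverse[OF that has_derivative_ident] by simp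
    have e: "frechet_derivative inverse (at x) v = (- v) * (inverse x * inverse x)" if "x \<in> - {0}" for x v :: real
      using that by (simp flip: frechet_derivative_at[OF d])
    have "C_k_on k (- {0}) (\<lambda>x::real. (- v) * (inverse x * inverse x))" for v
      by (intro bounded_bilinear.C_k_on_bilinear[OF bounded_bilinear_mult] C_k_on_const Suc) auto
    then have "C_k_on k (- {0}) (\<lambda>x::real. frechet_derivative inverse (at x) v)" for v
      by (rule C_k_on_congI[rotated]) (auto simp: e)
    moreover have "inverse differentiable (at x)" if "x \<noteq> 0" for x :: real
      using d[OF that] unfolding differentiable_def by blast
    ultimately show ?case by simp
  qed
qed

lemma smooth_on_inverse:
  fixes f :: "'a::real_normed_vector \<Rightarrow> real"
  assumes "open U" "smooth_on U f" "\<And>x. x \<in> U \<Longrightarrow> f x \<noteq> 0"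
  shows "smooth_on U (\<lambda>x. inverse (f x))"
  by (rule smooth_on_compose[OF assms(1,2) smooth_on_inverse_real]) (use assms(3) in auto)

lemma smooth_on_norm: "smooth_on (- {0}) (norm :: 'a::euclidean_space \<Rightarrow> real)"
  unfolding smooth_on_def
proof
  fix k show "C_k_on k (- {0}) (norm :: 'a \<Rightarrow> real)"
  proof (induction k)
    case 0
    then show ?case by (simp add: continuous_on_norm)
  next
    case (Suc k)
    have d: "(norm has_derivative (\<lambda>v. v \<bullet> sgn x)) (at x)" if "x \<noteq> 0" for x :: 'a
      using has_derivative_norm[OF that] by simp
    have e: "frechet_derivative norm (at x) v = (v \<bullet> x) * inverse (norm x)" if "x \<in> - {0}" for x v :: 'a
      using that by (simp add: sgn_div_norm divide_inverse_commute flip: frechet_derivative_at[OF d])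
    have "C_k_on k (- {0}) (\<lambda>x::'a. inverse (norm x))"
      by (rule C_k_on_compose[OF _ Suc, of "- {0}"])
        (use smooth_on_inverse_real in \<open>auto simp: smooth_on_def\<close>)
    then have "C_k_on k (- {0}) (\<lambda>x::'a. (v \<bullet> x) * inverse (norm x))" for v
      by (intro bounded_bilinear.C_k_on_bilinear[OF bounded_bilinear_mult _
            C_k_on_linear[OF bounded_linear_inner_right]]) auto
    then have "C_k_on k (- {0}) (\<lambda>x::'a. frechet_derivative norm (at x) v)" for v
      by (rule C_k_on_congI[rotated]) (auto simp: e)
    moreover have "norm differentiable (at x)" if "x \<noteq> 0" for x :: 'a
      using d[OF that] unfolding differentiable_def by blast
    ultimately show ?case by simp
  qed
qed

lemma smooth_on_exp_real: "smooth_on U (exp :: real \<Rightarrow> real)"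
  unfolding smooth_on_def
proof
  fix k show "C_k_on k U (exp :: real \<Rightarrow> real)"
  proof (rule C_k_on_subset[of _ UNIV], induction k)
    case (Suc k)
    have d: "(exp has_derivative (\<lambda>v. v * exp x)) (at x)" for x :: real
      using DERIV_exp[of x] by (simp add: has_field_derivative_def mult_commute_abs)
    have e: "frechet_derivative exp (at x) v = v * exp x" for x v :: real
      by (simp flip: frechet_derivative_at[OF d])
    have "C_k_on k UNIV (\<lambda>x::real. v * exp x)" for v
      by (intro bounded_bilinear.C_k_on_bilinear[OF bounded_bilinear_mult] C_k_on_const Suc) auto
    moreover have "exp differentiable (at x)" for x :: real
      using d unfolding differentiable_def by blast
    ultimately show ?case by (simp add: e)
  qed (auto intro: continuous_on_exp)
qed

lemma smooth_on_exp:
  fixes f :: "'a::real_normed_vector \<Rightarrow> real"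
  assumes "open U" "smooth_on U f"
  shows "smooth_on U (\<lambda>x. exp (f x))"
  using smooth_on_compose[OF assms smooth_on_exp_real[of UNIV]] by auto

lemma smooth_on_sinh:
  fixes f :: "'a::real_normed_vector \<Rightarrow> real"
  assumes "open U" "smooth_on U f"
  shows "smooth_on U (\<lambda>x. sinh (f x))"
  unfolding sinh_def using assms
  by (intro smooth_on_scaleR smooth_on_diff smooth_on_exp smooth_on_minus smooth_on_const)

text \<open>The derivative is the power series with coefficients \<open>diffs c\<close>, which again
  converges everywhere; hence the induction runs over all coefficient sequences.\<close>

lemma smooth_on_power_series:
  fixes c :: "nat \<Rightarrow> real"
  assumes "\<And>x. summable (\<lambda>m. c m * x ^ m)"
  shows "smooth_on UNIV (\<lambda>x. \<Sum>m. c m * x ^ m)"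
  unfolding smooth_on_def
proof
  fix k show "C_k_on k UNIV (\<lambda>x. \<Sum>m. c m * x ^ m)"
    using assms
  proof (induction k arbitrary: c)
    case 0
    have "isCont (\<lambda>x. \<Sum>m. c m * x ^ m) x" for x :: real
      using termdiffs_strong_converges_everywhere[OF 0] by (rule DERIV_isCont)
    then show ?case by (simp add: continuous_at_imp_continuous_on)
  next
    case (Suc k)
    have s: "summable (\<lambda>m. diffs c m * x ^ m)" for x :: real
      using termdiff_converges_all[OF Suc.prems] .
    have d: "((\<lambda>x. \<Sum>m. c m * x ^ m) has_derivative (\<lambda>v. v * (\<Sum>m. diffs c m * x ^ m))) (at x)" for x :: real
      using termdiffs_strong_converges_everywhere[OF Suc.prems, of x]
      by (simp add: has_field_derivative_def mult_commute_abs)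
    have e: "frechet_derivative (\<lambda>x. \<Sum>m. c m * x ^ m) (at x) v = v * (\<Sum>m. diffs c m * x ^ m)" for x v :: real
      by (simp flip: frechet_derivative_at[OF d])
    have "C_k_on k UNIV (\<lambda>x::real. v * (\<Sum>m. diffs c m * x ^ m))" for v
      by (intro bounded_bilinear.C_k_on_bilinear[OF bounded_bilinear_mult] C_k_on_const Suc.IH s) auto
    moreover have "(\<lambda>x. \<Sum>m. c m * x ^ m) differentiable (at x)" for x :: real
      using d unfolding differentiable_def by blast
    ultimately show ?case by (simp add: e)
  qed
qed

subsection \<open>Metrics in charts\<close>

lemma linear_real_expand:
  fixes f :: "'a::euclidean_space \<Rightarrow> real"
  assumes "linear f"
  shows "f u = (\<Sum>b\<in>Basis. (u \<bullet> b) * f b)"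
proof -
  have "f u = f (\<Sum>b\<in>Basis. (u \<bullet> b) *\<^sub>R b)"
    by (simp add: euclidean_representation)
  then show ?thesis
    by (simp add: linear_sum[OF assms] linear_cmul[OF assms])
qed

lemma inner_product_on_linear:
  assumes "inner_product_on UNIV B"
  shows "linear (\<lambda>u. B u v)" "linear (B u)"
proof -
  have l: "B (u + r *\<^sub>R v) w = B u w + r * B v w" and s: "B u v = B v u" for u v w r
    using assms unfolding inner_product_on_def by auto
  have z: "B 0 w = 0" for w
    using l[of 0 1 0 w] by simp
  show "linear (\<lambda>u. B u v)" for v
    using l[of _ 1] l[of 0] z by (intro linearI) auto
  then have "linear (\<lambda>v. B v u)" .
  also have "(\<lambda>v. B v u) = B u"
    using s by blast
  finally show "linear (B u)" .
qed

lemma inner_product_on_expand: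
  assumes "inner_product_on UNIV B"
  shows "B u v = (\<Sum>b\<in>Basis. \<Sum>c\<in>Basis. (u \<bullet> b) * (v \<bullet> c) * B b c)"
proof -
  have "B u v = (\<Sum>b\<in>Basis. (u \<bullet> b) * B b v)"
    by (rule linear_real_expand[OF inner_product_on_linear(1)[OF assms]])
  also have "\<dots> = (\<Sum>b\<in>Basis. (u \<bullet> b) * (\<Sum>c\<in>Basis. (v \<bullet> c) * B b c))"
    by (subst linear_real_expand[OF inner_product_on_linear(2)[OF assms], of _ v]) simp
  finally show ?thesis
    by (simp add: sum_distrib_left mult.assoc)
qed

lemma inner_product_on_pullback:
  assumes B: "inner_product_on V B" and F: "linear F" "\<And>u. F u \<in> V"
    and inj: "\<And>u. F u = 0 \<Longrightarrow> u = 0"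
  shows "inner_product_on UNIV (\<lambda>u v. B (F u) (F v))"
proof -
  have "B (F u) (F u) > 0" if "u \<noteq> 0" for u
  proof -
    have "F u \<noteq> 0" using inj that by blast
    then show ?thesis
      using B F(2)[of u] unfolding inner_product_on_def by simp
  qed
  then show ?thesis
    using B F(2) unfolding inner_product_on_def by (simp add: linear_add[OF F(1)] linear_cmul[OF F(1)])
qed

section \<open>Charts of the sphere and metrics pulled back by them\<close>

lemma chart_of_differentiable: "chart_of M U \<psi> \<Longrightarrow> x \<in> U \<Longrightarrow> \<psi> differentiable (at x)"
  unfolding chart_of_def using smooth_on_differentiable by blast

lemma chart_of_in: "chart_of M U \<psi> \<Longrightarrow> x \<in> U \<Longrightarrow> \<psi> x \<in> M"
  unfolding chart_of_def openin_subtopology by auto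

text \<open>The smooth ambient extension \<open>\<kappa>\<close> of the inverse can be
  differentiated: the chain rule for \<open>\<kappa> (\<psi> x) = x\<close> gives a left inverse of
  the derivative of \<open>\<psi>\<close>.\<close>

lemma chart_of_derivative_inj:
  assumes "chart_of M U \<psi>" "x \<in> U" "frechet_derivative \<psi> (at x) u = 0"
  shows "u = 0"
proof -
  obtain W \<kappa> where W: "open W" "\<psi> ` U \<subseteq> W" "smooth_on W \<kappa>" "\<And>x. x \<in> U \<Longrightarrow> \<kappa> (\<psi> x) = x" and "open U"
    using assms(1) unfolding chart_of_def by blast
  have d: "\<kappa> differentiable (at (\<psi> x))"
    using W assms(2) by (auto intro: smooth_on_differentiable)
  have "frechet_derivative (\<lambda>x. \<kappa> (\<psi> x)) (at x) u = frechet_derivative (\<lambda>x. x) (at x) u"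
    using frechet_derivative_cong_open[OF \<open>open U\<close> assms(2)] W(4) by metis
  moreover have "frechet_derivative (\<lambda>x. \<kappa> (\<psi> x)) (at x) u = 0"
    using linear_frechet_derivative[OF d]
    by (simp add: frechet_derivative_comp[OF chart_of_differentiable[OF assms(1,2)] d] assms(3) linear_0)
  ultimately show ?thesis
    by (simp flip: frechet_derivative_at[OF has_derivative_ident])
qed

text \<open>Obtained by differentiating the constant function
  \<open>\<psi> x \<bullet> \<psi> x = 1\<close>.\<close>

lemma chart_of_derivative_tangent:
  assumes "chart_of (sphere 0 1) U \<psi>" "x \<in> U"
  shows "frechet_derivative \<psi> (at x) u \<in> tangent_sphere (\<psi> x)"
proof -
  have "open U" using assms(1) unfolding chart_of_def by blast
  note d = chart_of_differentiable[OF assms]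
  have "\<psi> y \<bullet> \<psi> y = 1" if "y \<in> U" for y
    using chart_of_in[OF assms(1) that] by (simp add: dot_square_norm)
  then have "frechet_derivative (\<lambda>x. \<psi> x \<bullet> \<psi> x) (at x) u = frechet_derivative (\<lambda>x. 1) (at x) u"
    using frechet_derivative_cong_open[OF \<open>open U\<close> assms(2), of "\<lambda>x. \<psi> x \<bullet> \<psi> x" "\<lambda>x. 1"] by simp
  also have "\<dots> = 0"
    by (simp flip: frechet_derivative_at[OF has_derivative_const])
  finally show ?thesis
    by (simp add: bounded_bilinear.frechet_derivative_bilinear[OF bounded_bilinear_inner d d]
      tangent_sphere_def inner_commute)
qed

lemma chart_of_pullback_inner_product:
  assumes "chart_of (sphere 0 1) U \<psi>" "x \<in> U"
    and "\<And>\<theta>. \<theta> \<in> sphere 0 1 \<Longrightarrow> inner_product_on (tangent_sphere \<theta>) (g \<theta>)"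
  shows "inner_product_on UNIV (pullback \<psi> g x)"
proof -
  have "inner_product_on UNIV (\<lambda>u v. g (\<psi> x) (frechet_derivative \<psi> (at x) u) (frechet_derivative \<psi> (at x) v))"
    using assms(3)[OF chart_of_in[OF assms(1,2)]]
      linear_frechet_derivative[OF chart_of_differentiable[OF assms(1,2)]]
      chart_of_derivative_tangent[OF assms(1,2)] chart_of_derivative_inj[OF assms(1,2)]
    by (rule inner_product_on_pullback)
  then show ?thesis unfolding pullback_def .
qed

lemma metric_on_sphere_round: "metric_on_sphere round_metric"
  unfolding metric_on_sphere_def
proof (intro conjI ballI allI impI)
  fix \<theta> :: "(real ^ 'n) \<times> real"
  show "inner_product_on (tangent_sphere \<theta>) (round_metric \<theta>)"
    unfolding inner_product_on_def round_metric_def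
    by (simp add: inner_add_left inner_add_right inner_commute)
next
  fix U and \<psi> :: "real ^ 'n \<Rightarrow> (real ^ 'n) \<times> real" and b c :: "real ^ 'n"
  assume "chart_of (sphere 0 1) U \<psi>"
  then show "smooth_on U (\<lambda>x. pullback \<psi> round_metric x b c)"
    unfolding chart_of_def pullback_def round_metric_def
    by (intro smooth_on_inner smooth_on_frechet) auto
qed

text \<open>Inner products form a convex cone: the interpolation equals
  \<open>(1 - r) * B + r * B'\<close> up to the factor \<open>s\<close>.\<close>

lemma inner_product_on_interpolate:
  assumes "inner_product_on V B" "inner_product_on V B'" "s > 0" "0 \<le> r" "r \<le> 1"
  shows "inner_product_on V (\<lambda>u v. s * (B u v + r * (B' u v - B u v)))"
proof -
  have "B u u + r * (B' u u - B u u) > 0" if "u \<in> V" "u \<noteq> 0" for u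
  proof -
    have "B u u > 0" "B' u u > 0"
      using assms(1,2) that unfolding inner_product_on_def by auto
    moreover have "B u u + r * (B' u u - B u u) = (1 - r) * B u u + r * B' u u"
      by (simp add: algebra_simps)
    ultimately show ?thesis
      using assms(4,5) by (cases "r = 0") (auto intro!: add_nonneg_pos)
  qed
  then show ?thesis
    using assms(1-3) unfolding inner_product_on_def
    by (intro conjI ballI allI impI mult_pos_pos) (simp_all add: algebra_simps)
qed

lemma metric_on_sphere_interpolate:
  fixes g g' :: "(real ^ 'n) \<times> real \<Rightarrow> (real ^ 'n) \<times> real \<Rightarrow> (real ^ 'n) \<times> real \<Rightarrow> real"
  assumes "metric_on_sphere g" "metric_on_sphere g'" "s > 0" "0 \<le> r" "r \<le> 1"
  shows "metric_on_sphere (\<lambda>\<theta> u v. s * (g \<theta> u v + r * (g' \<theta> u v - g \<theta> u v)))"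
  unfolding metric_on_sphere_def
proof (intro conjI ballI allI impI)
  fix \<theta> :: "(real ^ 'n) \<times> real" assume "\<theta> \<in> sphere 0 1"
  then show "inner_product_on (tangent_sphere \<theta>) (\<lambda>u v. s * (g \<theta> u v + r * (g' \<theta> u v - g \<theta> u v)))"
    using assms unfolding metric_on_sphere_def by (intro inner_product_on_interpolate) auto
next
  fix U and \<psi> :: "real ^ 'n \<Rightarrow> (real ^ 'n) \<times> real" and b c :: "real ^ 'n"
  assume *: "chart_of (sphere 0 1) U \<psi>" "b \<in> Basis" "c \<in> Basis"
  then have "open U" unfolding chart_of_def by blast
  have "smooth_on U (\<lambda>x. pullback \<psi> g x b c)" "smooth_on U (\<lambda>x. pullback \<psi> g' x b c)"
    using assms(1,2) * unfolding metric_on_sphere_def by auto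
  then have "smooth_on U (\<lambda>x. s * (pullback \<psi> g x b c + r * (pullback \<psi> g' x b c - pullback \<psi> g x b c)))"
    using \<open>open U\<close> by (intro smooth_on_mult smooth_on_add smooth_on_diff smooth_on_const)
  then show "smooth_on U (\<lambda>x. pullback \<psi> (\<lambda>\<theta> u v. s * (g \<theta> u v + r * (g' \<theta> u v - g \<theta> u v))) x b c)"
    unfolding pullback_def .
qed

subsection \<open>Metrics in polar coordinates\<close>

definition radial_proj :: "'a::euclidean_space \<Rightarrow> 'a" where
  "radial_proj p = p /\<^sub>R norm p"

text \<open>For \<open>p \<noteq> 0\<close> this is the derivative of \<open>radial_proj\<close> at
  \<open>p\<close>: the orthogonal projection to the tangent space of the sphere, divided by the
  radius.\<close>

definition tangential :: "'a::euclidean_space \<Rightarrow> 'a \<Rightarrow> 'a" where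
  "tangential p v = (v - (v \<bullet> radial_proj p) *\<^sub>R radial_proj p) /\<^sub>R norm p"

lemma from_polar_eq:
  "p \<noteq> 0 \<Longrightarrow> from_polar k p v w = k (norm p) (radial_proj p) (tangential p v) (tangential p w)
     + (v \<bullet> radial_proj p) * (w \<bullet> radial_proj p)"
  by (simp add: from_polar_def radial_proj_def tangential_def Let_def)

lemma norm_radial_proj: "p \<noteq> 0 \<Longrightarrow> norm (radial_proj p) = 1"
  by (simp add: radial_proj_def)

lemma tangential_in_tangent_sphere: "p \<noteq> 0 \<Longrightarrow> tangential p v \<in> tangent_sphere (radial_proj p)"
  using norm_radial_proj[of p]
  by (simp add: tangential_def tangent_sphere_def inner_diff_left dot_square_norm)

lemma linear_tangential: "linear (tangential p)"
  unfolding tangential_def by (intro linearI) (simp_all add: algebra_simps inner_add_left)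

lemma has_derivative_radial_proj:
  assumes "p \<noteq> 0"
  shows "(radial_proj has_derivative tangential p) (at p)"
proof -
  have "((\<lambda>p. p /\<^sub>R norm p) has_derivative
      (\<lambda>v. inverse (norm p) *\<^sub>R v + (- (inverse (norm p) * (v \<bullet> sgn p) * inverse (norm p))) *\<^sub>R p)) (at p)"
    using assms
    by (intro has_derivative_scaleR has_derivative_ident Deriv.has_derivative_inverse has_derivative_norm) auto
  moreover have "inverse (norm p) *\<^sub>R v + (- (inverse (norm p) * (v \<bullet> sgn p) * inverse (norm p))) *\<^sub>R p
      = tangential p v" for v
    by (simp add: tangential_def radial_proj_def sgn_div_norm algebra_simps)
  ultimately show ?thesis
    unfolding radial_proj_def by simp
qed

lemma smooth_on_radial_proj: "smooth_on (- {0}) (radial_proj :: 'a::euclidean_space \<Rightarrow> 'a)"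
  unfolding radial_proj_def
  by (intro smooth_on_scaleR smooth_on_inverse smooth_on_norm smooth_on_id) auto

lemma inner_product_on_from_polar:
  assumes "\<And>\<theta> t. \<theta> \<in> sphere 0 1 \<Longrightarrow> t > 0 \<Longrightarrow> inner_product_on (tangent_sphere \<theta>) (k t \<theta>)"
  shows "inner_product_on UNIV (from_polar k p)"
proof (cases "p = 0")
  case True
  then show ?thesis
    by (simp add: inner_product_on_def from_polar_def inner_add_left inner_add_right inner_commute)
next
  case False
  define \<theta> where "\<theta> = radial_proj p"
  have ip: "inner_product_on (tangent_sphere \<theta>) (k (norm p) \<theta>)"
    using assms[of \<theta> "norm p"] False norm_radial_proj[of p] unfolding \<theta>_def by simp
  have T: "tangential p v \<in> tangent_sphere \<theta>" for v
    using False tangential_in_tangent_sphere unfolding \<theta>_def by blast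
  have sym: "k (norm p) \<theta> (tangential p u) (tangential p v) = k (norm p) \<theta> (tangential p v) (tangential p u)" for u v
    using ip T unfolding inner_product_on_def by blast
  have lin: "k (norm p) \<theta> (tangential p (u + r *\<^sub>R v)) (tangential p w)
      = k (norm p) \<theta> (tangential p u) (tangential p w) + r * k (norm p) \<theta> (tangential p v) (tangential p w)" for u v w r
    using ip T unfolding inner_product_on_def
    by (simp add: linear_add[OF linear_tangential] linear_cmul[OF linear_tangential])
  have pos: "k (norm p) \<theta> (tangential p u) (tangential p u) + (u \<bullet> \<theta>) * (u \<bullet> \<theta>) > 0" if "u \<noteq> 0" for u
  \<comment> \<open>A vector without tangential part is radial, and then the second summand is
    positive; otherwise the form \<open>k\<close> already is.\<close>
  proof (cases "tangential p u = 0")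
    case True
    then have "u = (u \<bullet> \<theta>) *\<^sub>R \<theta>"
      using False unfolding tangential_def \<theta>_def by simp
    then have "u \<bullet> \<theta> \<noteq> 0"
      using that by auto
    then have "(u \<bullet> \<theta>) * (u \<bullet> \<theta>) > 0"
      by (meson not_real_square_gt_zero)
    moreover have "k (norm p) \<theta> (tangential p u) (tangential p u) = 0"
      using lin[of 0 1 0 u] linear_0[OF linear_tangential, of p] True by simp
    ultimately show ?thesis by simp
  next
    case False
    then show ?thesis
      using ip T unfolding inner_product_on_def by (smt (verit) zero_le_square)
  qed
  show ?thesis
    unfolding inner_product_on_def from_polar_eq[OF False] \<theta>_def[symmetric]
    using sym lin pos by (auto simp: inner_add_left algebra_simps)
qed

text \<open>\<open>metric_on_sphere\<close> speaks of coefficients in charts, so near each point the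
  radial projection is factored as \<open>\<psi> (y p)\<close> with \<open>y\<close> smooth. The
  derivative of \<open>\<psi>\<close> then carries that of \<open>y\<close> to
  \<open>tangential p\<close>, and the function becomes a finite sum of products of derivatives of
  \<open>y\<close> with chart coefficients.\<close>

lemma smooth_on_sphere_metric:
  fixes g :: "(real ^ 'n) \<times> real \<Rightarrow> (real ^ 'n) \<times> real \<Rightarrow> (real ^ 'n) \<times> real \<Rightarrow> real"
  assumes A: "admissible_atlas (A :: ((real ^ 'n) set \<times> (real ^ 'n \<Rightarrow> (real ^ 'n) \<times> real)) set)"
    and g: "metric_on_sphere g"
  shows "smooth_on (- {0}) (\<lambda>p. g (radial_proj p) (tangential p v) (tangential p w))"
proof (rule smooth_on_local)
  fix p\<^sub>0 :: "(real ^ 'n) \<times> real" assume "p\<^sub>0 \<in> - {0}"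
  then have p0: "p\<^sub>0 \<noteq> 0" by simp
  then have "radial_proj p\<^sub>0 \<in> sphere 0 1" by (simp add: norm_radial_proj)
  then have "\<exists>(U, \<psi>)\<in>A. \<exists>x\<in>U. \<psi> x = radial_proj p\<^sub>0 \<and> infdist x (- U) \<ge> 1"
    using A unfolding admissible_atlas_def by (elim conjE bspec)
  then obtain U \<psi> x where U: "(U, \<psi>) \<in> A" and x: "x \<in> U" "\<psi> x = radial_proj p\<^sub>0"
    by auto
  have p0U: "radial_proj p\<^sub>0 \<in> \<psi> ` U"
    using x(1) unfolding x(2)[symmetric] by (rule imageI)
  have \<psi>: "chart_of (sphere 0 1) U \<psi>"
    using A U unfolding admissible_atlas_def by blast
  then obtain W \<kappa> where W: "open W" "\<psi> ` U \<subseteq> W" "smooth_on W \<kappa>" "\<And>x. x \<in> U \<Longrightarrow> \<kappa> (\<psi> x) = x"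
    unfolding chart_of_def by blast
  obtain T where T: "open T" "\<psi> ` U = sphere 0 1 \<inter> T"
    using \<psi> unfolding chart_of_def openin_open by blast
  \<comment> \<open>\<open>T\<close> cuts the image of the chart out of the sphere and
    \<open>W\<close> carries the smooth inverse, so on \<open>V\<close> the coordinate
    \<open>y\<close> is both defined and smooth.\<close>
  define V where "V = {p \<in> - {0}. radial_proj p \<in> T \<inter> W}"
  define y where "y p = \<kappa> (radial_proj p)" for p
  have "V = (- {0}) \<inter> radial_proj -` (T \<inter> W)"
    unfolding V_def by auto
  moreover have "open ((- {0}) \<inter> radial_proj -` (T \<inter> W))"
    using smooth_on_continuous[OF smooth_on_radial_proj] T(1) W(1)
    by (intro continuous_open_preimage) auto
  ultimately have "open V" by simp
  have "p\<^sub>0 \<in> V"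
    using p0 p0U T W unfolding V_def by blast
  have V0: "p \<noteq> 0" if "p \<in> V" for p using that V_def by auto
  have y: "y p \<in> U" "\<psi> (y p) = radial_proj p" if "p \<in> V" for p
  proof -
    have "radial_proj p \<in> \<psi> ` U"
      unfolding T(2) using that norm_radial_proj[of p] by (auto simp: V_def)
    then show "y p \<in> U" "\<psi> (y p) = radial_proj p"
      using W(4) unfolding y_def by auto
  qed
  have ys: "smooth_on V y"
    unfolding y_def
    by (rule smooth_on_compose[OF \<open>open V\<close> smooth_on_subset[OF smooth_on_radial_proj] W(3)]) (auto simp: V_def)
  have dy: "frechet_derivative \<psi> (at (y p)) (frechet_derivative y (at p) v) = tangential p v" if "p \<in> V" for p v
  proof -
    have "frechet_derivative \<psi> (at (y p)) (frechet_derivative y (at p) v) = frechet_derivative (\<lambda>p. \<psi> (y p)) (at p) v"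
      using smooth_on_differentiable[OF ys that] chart_of_differentiable[OF \<psi> y(1)[OF that]]
      by (simp add: frechet_derivative_comp)
    also have "\<dots> = frechet_derivative radial_proj (at p) v"
      using frechet_derivative_cong_open[OF \<open>open V\<close> that, of "\<lambda>p. \<psi> (y p)" radial_proj] y(2) by simp
    also have "\<dots> = tangential p v"
      by (simp flip: frechet_derivative_at[OF has_derivative_radial_proj[OF V0[OF that]]])
    finally show ?thesis .
  qed
  have e: "g (radial_proj p) (tangential p v) (tangential p w)
      = (\<Sum>b\<in>Basis. \<Sum>c\<in>Basis. (frechet_derivative y (at p) v \<bullet> b) * (frechet_derivative y (at p) w \<bullet> c)
          * pullback \<psi> g (y p) b c)" if "p \<in> V" for p
  proof -
    have "g (radial_proj p) (tangential p v) (tangential p w)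
        = pullback \<psi> g (y p) (frechet_derivative y (at p) v) (frechet_derivative y (at p) w)"
      unfolding pullback_def y(2)[OF that] dy[OF that] ..
    moreover have "inner_product_on UNIV (pullback \<psi> g (y p))"
      using chart_of_pullback_inner_product[OF \<psi> y(1)[OF that]] g unfolding metric_on_sphere_def by blast
    ultimately show ?thesis
      by (simp only: inner_product_on_expand[of _ "frechet_derivative y (at p) v" "frechet_derivative y (at p) w"])
  qed
  have gs: "smooth_on V (\<lambda>p. pullback \<psi> g (y p) b c)" if "b \<in> Basis" "c \<in> Basis" for b c
    by (rule smooth_on_compose[OF \<open>open V\<close> ys, of U "\<lambda>x. pullback \<psi> g x b c"])
      (use g \<psi> y that in \<open>auto simp: metric_on_sphere_def\<close>)
  have "smooth_on V (\<lambda>p. \<Sum>b\<in>Basis. \<Sum>c\<in>Basis. (frechet_derivative y (at p) v \<bullet> b)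
      * (frechet_derivative y (at p) w \<bullet> c) * pullback \<psi> g (y p) b c)"
    by (intro smooth_on_sum smooth_on_mult smooth_on_inner smooth_on_const smooth_on_frechet ys gs \<open>open V\<close>)
  then have "smooth_on V (\<lambda>p. g (radial_proj p) (tangential p v) (tangential p w))"
    by (subst smooth_on_cong[OF \<open>open V\<close> e])
  then show "\<exists>V. open V \<and> p\<^sub>0 \<in> V \<and> smooth_on V (\<lambda>p. g (radial_proj p) (tangential p v) (tangential p w))"
    using \<open>open V\<close> \<open>p\<^sub>0 \<in> V\<close> by blast
qed

text \<open>Near the origin the metric has the coefficients \<open>(sinh t / t)\<^sup>2\<close> and
  \<open>(1 - (sinh t / t)\<^sup>2) / t\<^sup>2\<close>, which are entire functions of \<open>t\<^sup>2\<close>; \<open>sinhc_series 1\<close> is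
  \<open>sinh t / t\<close> as a function of \<open>t\<^sup>2\<close>, and \<open>sinhc_series 3\<close> its difference quotient at 0.\<close>

definition sinhc_series :: "nat \<Rightarrow> real \<Rightarrow> real" where
  "sinhc_series j x = (\<Sum>m. inverse (fact (2 * m + j)) * x ^ m)"

lemma summable_sinhc: "summable (\<lambda>m. inverse (fact (2 * m + j)) * x ^ m)" for x :: real
proof (rule summable_comparison_test'[OF summable_exp[of "\<bar>x\<bar>"]])
  fix m :: nat
  have "inverse (fact (2 * m + j) :: real) \<le> inverse (fact m)"
    by (intro le_imp_inverse_le fact_mono) auto
  then show "norm (inverse (fact (2 * m + j)) * x ^ m) \<le> inverse (fact m) * \<bar>x\<bar> ^ m"
    by (simp add: abs_mult power_abs mult_right_mono)
qed

lemma smooth_on_sinhc_series: "smooth_on UNIV (sinhc_series j)"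
  unfolding sinhc_series_def[abs_def] by (rule smooth_on_power_series) (rule summable_sinhc)

text \<open>The constant term is 1, and shifting the index turns \<open>2 * m + 1\<close> into
  \<open>2 * m + 3\<close>. This exhibits the factor \<open>x\<close> that cancels a denominator at
  the origin.\<close>

lemma sinhc_series_1_3: "sinhc_series 1 x = 1 + x * sinhc_series 3 x"
proof -
  let ?f = "\<lambda>m. inverse (fact (2 * m + 1)) * x ^ m"
  have "sinhc_series 1 x = ?f 0 + (\<Sum>m. ?f (Suc m))"
    unfolding sinhc_series_def using suminf_split_head[OF summable_sinhc[of 1 x]] by simp
  moreover have "(\<Sum>m. ?f (Suc m)) = (\<Sum>m. x * (inverse (fact (2 * m + 3)) * x ^ m))"
    by (intro suminf_cong) (simp add: numeral_3_eq_3 algebra_simps)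
  moreover have "\<dots> = x * sinhc_series 3 x"
    unfolding sinhc_series_def by (rule suminf_mult[OF summable_sinhc])
  ultimately show ?thesis by simp
qed

lemma sinh_eq_sinhc_series: "sinh t = t * sinhc_series 1 (t\<^sup>2)"
proof -
  have "strict_mono (\<lambda>m::nat. 2 * m + 1)"
    by (simp add: strict_mono_def)
  then have "(\<lambda>m. (\<lambda>n. if even n then 0 else t ^ n /\<^sub>R fact n) (2 * m + 1)) sums sinh t"
    using sinh_converges[of t] by (subst sums_mono_reindex) (auto elim!: oddE)
  moreover have "(\<lambda>n. if even n then 0 else t ^ n /\<^sub>R fact n) (2 * m + 1)
      = t * (inverse (fact (2 * m + 1)) * (t\<^sup>2) ^ m)" for m
    by (simp add: divide_inverse mult_ac del: fact_Suc flip: power_mult)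
  ultimately have "(\<lambda>m. t * (inverse (fact (2 * m + 1)) * (t\<^sup>2) ^ m)) sums sinh t"
    by (simp only:)
  moreover have "(\<lambda>m. t * (inverse (fact (2 * m + 1)) * (t\<^sup>2) ^ m)) sums (t * sinhc_series 1 (t\<^sup>2))"
    unfolding sinhc_series_def using summable_sinhc[of 1 "t\<^sup>2"] by (intro sums_mult summable_sums)
  ultimately show ?thesis
    by (rule sums_unique2)
qed

text \<open>With \<open>q = sinh t / t\<close> and \<open>t = norm p\<close>, the hyperbolic metric
  is \<open>q\<^sup>2 * (v \<bullet> w) + (1 - q\<^sup>2) / t\<^sup>2 * (v \<bullet> p) * (w
  \<bullet> p)\<close>. Writing \<open>q = 1 + t\<^sup>2 * S\<close> turns
  \<open>(1 - q\<^sup>2) / t\<^sup>2\<close> into \<open>- (2 * S + t\<^sup>2 * S\<^sup>2)\<close>,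
  so no denominator is left.\<close>

lemma warping_deformation_near_origin:
  assumes "\<And>t. t \<le> 0 \<Longrightarrow> \<rho> t = 0" "d > 0" "norm p < a"
  shows "warping_deformation \<rho> a d g p v w =
    (sinhc_series 1 (p \<bullet> p))\<^sup>2 * (v \<bullet> w)
    - (v \<bullet> p) * (w \<bullet> p) * (2 * sinhc_series 3 (p \<bullet> p) + (p \<bullet> p) * (sinhc_series 3 (p \<bullet> p))\<^sup>2)"
proof (cases "p = 0")
  case True
  then show ?thesis
    by (simp add: warping_deformation_def from_polar_def sinhc_series_1_3 del: One_nat_def)
next
  case False
  define t where "t = norm p"
  define S where "S = sinhc_series 3 (t\<^sup>2)"
  have t: "t > 0" "p \<bullet> p = t\<^sup>2"
    using False by (simp_all add: t_def dot_square_norm)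
  have \<rho>: "\<rho> (2 * ((t - a) / d)) = 0"
    using assms unfolding t_def by (intro assms(1)) (simp add: divide_le_0_iff)
  have \<theta>\<theta>: "radial_proj p \<bullet> radial_proj p = 1"
    using norm_radial_proj[OF False] by (simp add: dot_square_norm)
  have \<theta>: "v \<bullet> radial_proj p = (v \<bullet> p) / t" for v
    by (simp add: radial_proj_def t_def divide_inverse mult.commute)
  have "tangential p v \<bullet> tangential p w = ((v \<bullet> w) - (v \<bullet> radial_proj p) * (w \<bullet> radial_proj p)) / t\<^sup>2"
    using \<theta>\<theta> unfolding tangential_def t_def[symmetric]
    by (simp add: inner_diff_left inner_diff_right inner_commute power2_eq_square divide_inverse)
  then have "warping_deformation \<rho> a d g p v w
      = (t * (1 + t\<^sup>2 * S))\<^sup>2 * (((v \<bullet> w) - (v \<bullet> p) / t * ((w \<bullet> p) / t)) / t\<^sup>2) + (v \<bullet> p) / t * ((w \<bullet> p) / t)"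
    unfolding warping_deformation_def from_polar_eq[OF False] interpolated_metric_def round_metric_def
      t_def[symmetric] \<rho> \<theta> sinh_eq_sinhc_series sinhc_series_1_3 S_def by simp
  also have "\<dots> = (1 + t\<^sup>2 * S)\<^sup>2 * (v \<bullet> w) - (v \<bullet> p) * (w \<bullet> p) * (2 * S + t\<^sup>2 * S\<^sup>2)"
    using t(1) by (simp add: field_simps) (simp add: power2_eq_square power4_eq_xxxx algebra_simps)
  finally show ?thesis
    unfolding t(2) S_def sinhc_series_1_3 .
qed

text \<open>Two open sets cover the space: the complement of the origin, where the polar expression
  is smooth, and the ball of radius \<open>a\<close>, where the cutoff vanishes and the
  denominator-free formula applies.\<close>

lemma metric_on_open_warping_deformation:
  fixes g :: "(real ^ 'n) \<times> real \<Rightarrow> (real ^ 'n) \<times> real \<Rightarrow> (real ^ 'n) \<times> real \<Rightarrow> real"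
  assumes A: "admissible_atlas (A :: ((real ^ 'n) set \<times> (real ^ 'n \<Rightarrow> (real ^ 'n) \<times> real)) set)"
    and \<rho>: "cutoff \<rho>" and g: "metric_on_sphere g" and "a > 0" "d > 0"
  shows "metric_on_open UNIV (warping_deformation \<rho> a d g)"
  unfolding metric_on_open_def
proof (intro conjI ballI)
  fix p :: "(real ^ 'n) \<times> real"
  show "inner_product_on UNIV (warping_deformation \<rho> a d g p)"
    unfolding warping_deformation_def interpolated_metric_def
  proof (rule inner_product_on_from_polar)
    fix \<theta> :: "(real ^ 'n) \<times> real" and t :: real assume "\<theta> \<in> sphere 0 1" "t > 0"
    then show "inner_product_on (tangent_sphere \<theta>) (\<lambda>u v. (sinh t)\<^sup>2 *
        (round_metric \<theta> u v + \<rho> (2 * ((t - a) / d)) * (g \<theta> u v - round_metric \<theta> u v)))"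
      using g metric_on_sphere_round \<rho> unfolding metric_on_sphere_def cutoff_def
      by (intro inner_product_on_interpolate) auto
  qed
next
  fix v w :: "(real ^ 'n) \<times> real"
  let ?h = "\<lambda>p. warping_deformation \<rho> a d g p v w"
  have "smooth_on UNIV \<rho>" using \<rho> unfolding cutoff_def by blast
  have o: "open (- {0 :: (real ^ 'n) \<times> real})" by auto
  have "smooth_on (- {0}) (\<lambda>p::(real ^ 'n) \<times> real. (2 / d) * (norm p - a))"
    by (intro smooth_on_mult smooth_on_diff smooth_on_norm smooth_on_const o)
  then have r: "smooth_on (- {0}) (\<lambda>p::(real ^ 'n) \<times> real. \<rho> ((2 / d) * (norm p - a)))"
    by (rule smooth_on_compose[OF o _ \<open>smooth_on UNIV \<rho>\<close>]) simp
  have "smooth_on (- {0}) (\<lambda>p. (sinh (norm p))\<^sup>2 *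
      (round_metric (radial_proj p) (tangential p v) (tangential p w) + \<rho> ((2 / d) * (norm p - a)) *
        (g (radial_proj p) (tangential p v) (tangential p w)
         - round_metric (radial_proj p) (tangential p v) (tangential p w)))
      + (v \<bullet> radial_proj p) * (w \<bullet> radial_proj p))"
    by (intro smooth_on_add smooth_on_mult smooth_on_diff smooth_on_power smooth_on_sinh smooth_on_norm r
        smooth_on_sphere_metric[OF A] g metric_on_sphere_round smooth_on_inner smooth_on_radial_proj smooth_on_const o)
  then have 1: "smooth_on (- {0}) ?h"
    by (subst smooth_on_cong[OF o])
      (auto simp: warping_deformation_def from_polar_eq interpolated_metric_def)
  have s: "smooth_on (ball 0 a) (\<lambda>p::(real ^ 'n) \<times> real. sinhc_series j (p \<bullet> p))" for j
    by (rule smooth_on_compose[OF _ _ smooth_on_sinhc_series]) (auto intro: smooth_on_inner smooth_on_id)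
  have e: "?h p = (sinhc_series 1 (p \<bullet> p))\<^sup>2 * (v \<bullet> w)
    - (v \<bullet> p) * (w \<bullet> p) * (2 * sinhc_series 3 (p \<bullet> p) + (p \<bullet> p) * (sinhc_series 3 (p \<bullet> p))\<^sup>2)"
    if "p \<in> ball 0 a" for p
    using that \<rho> \<open>d > 0\<close> by (intro warping_deformation_near_origin) (auto simp: cutoff_def)
  have "smooth_on (ball 0 a) (\<lambda>p. (sinhc_series 1 (p \<bullet> p))\<^sup>2 * (v \<bullet> w)
    - (v \<bullet> p) * (w \<bullet> p) * (2 * sinhc_series 3 (p \<bullet> p) + (p \<bullet> p) * (sinhc_series 3 (p \<bullet> p))\<^sup>2))"
    by (intro smooth_on_add smooth_on_mult smooth_on_diff smooth_on_power s smooth_on_inner smooth_on_id smooth_on_const open_ball)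
  then have 2: "smooth_on (ball 0 a) ?h"
    by (subst smooth_on_cong[OF open_ball e])
  show "smooth_on UNIV ?h"
  proof (rule smooth_on_local)
    fix p :: "(real ^ 'n) \<times> real"
    show "\<exists>V. open V \<and> p \<in> V \<and> smooth_on V ?h"
      using 1 2 o \<open>a > 0\<close> by (cases "p = 0") (auto intro: exI[of _ "ball 0 a"] exI[of _ "- {0}"])
  qed
qed

subsection \<open>Functions with small derivatives up to order two\<close>

text \<open>A real-valued counterpart of \<open>C2_norm\<close> for a single coefficient. Smoothness
  is included so that sums, products and compositions can be differentiated without further side
  conditions.\<close>

definition C2_le :: "'a::euclidean_space set \<Rightarrow> real \<Rightarrow> ('a \<Rightarrow> real) \<Rightarrow> bool" where
  "C2_le X K f \<longleftrightarrow> smooth_on X f \<and> (\<forall>h\<in>partials_upto_2 f. \<forall>x\<in>X. \<bar>h x\<bar> \<le> K)"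

lemma C2_leI:
  assumes "smooth_on X f" "\<And>x. x \<in> X \<Longrightarrow> \<bar>f x\<bar> \<le> K"
    and "\<And>x b. x \<in> X \<Longrightarrow> b \<in> Basis \<Longrightarrow> \<bar>partial b f x\<bar> \<le> K"
    and "\<And>x b c. x \<in> X \<Longrightarrow> b \<in> Basis \<Longrightarrow> c \<in> Basis \<Longrightarrow> \<bar>partial b (partial c f) x\<bar> \<le> K"
  shows "C2_le X K f"
  using assms unfolding C2_le_def partials_upto_2_def by auto

lemma C2_leD:
  assumes "C2_le X K f"
  shows "smooth_on X f" "x \<in> X \<Longrightarrow> \<bar>f x\<bar> \<le> K"
    and "x \<in> X \<Longrightarrow> b \<in> Basis \<Longrightarrow> \<bar>partial b f x\<bar> \<le> K"
    and "x \<in> X \<Longrightarrow> b \<in> Basis \<Longrightarrow> c \<in> Basis \<Longrightarrow> \<bar>partial b (partial c f) x\<bar> \<le> K"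
  using assms unfolding C2_le_def partials_upto_2_def by auto

lemma C2_le_mono: "C2_le X K f \<Longrightarrow> K \<le> L \<Longrightarrow> C2_le X L f"
  unfolding C2_le_def by force

lemma smooth_on_partial: "smooth_on X f \<Longrightarrow> smooth_on X (partial b f)"
  unfolding partial_def[abs_def] by (rule smooth_on_frechet)

lemma partial_cong_open:
  "open X \<Longrightarrow> x \<in> X \<Longrightarrow> (\<And>y. y \<in> X \<Longrightarrow> f y = g y) \<Longrightarrow> partial b f x = partial b g x"
  unfolding partial_def using frechet_derivative_cong_open by metis

lemma C2_le_cong:
  assumes "open X" "\<And>x. x \<in> X \<Longrightarrow> f x = g x" "C2_le X K g"
  shows "C2_le X K f"
proof (rule C2_leI)
  show "smooth_on X f"
    using smooth_on_cong[OF assms(1,2)] C2_leD(1)[OF assms(3)] by simp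
  have p: "partial b f x = partial b g x" if "x \<in> X" for b x
    using partial_cong_open[OF assms(1) that assms(2)] .
  show "\<bar>f x\<bar> \<le> K" if "x \<in> X" for x
    using C2_leD(2)[OF assms(3) that] assms(2)[OF that] by simp
  show "\<bar>partial b f x\<bar> \<le> K" if "x \<in> X" "b \<in> Basis" for b x
    using C2_leD(3)[OF assms(3) that] p[OF that(1)] by simp
  show "\<bar>partial b (partial c f) x\<bar> \<le> K" if "x \<in> X" "b \<in> Basis" "c \<in> Basis" for b c x
    using C2_leD(4)[OF assms(3) that] partial_cong_open[OF assms(1) that(1) p] by simp
qed

lemma partial_const: "partial b (\<lambda>x. k) = (\<lambda>x. 0)"
  by (simp add: partial_def fun_eq_iff flip: frechet_derivative_at[OF has_derivative_const])

lemma C2_le_const: "\<bar>k\<bar> \<le> K \<Longrightarrow> C2_le X K (\<lambda>x. k)"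
  by (rule C2_leI) (auto simp: partial_const smooth_on_const)

lemma partial_add:
  assumes "f differentiable (at x)" "g differentiable (at x)"
  shows "partial b (\<lambda>x. f x + g x) x = partial b f x + partial b g x"
  unfolding partial_def using frechet_derivative_add'[OF assms] .

lemma C2_le_add:
  assumes "open X" "C2_le X K f" "C2_le X L g"
  shows "C2_le X (K + L) (\<lambda>x. f x + g x)"
proof (rule C2_leI)
  note f = C2_leD[OF assms(2)] and g = C2_leD[OF assms(3)]
  show "smooth_on X (\<lambda>x. f x + g x)"
    using assms f g by (intro smooth_on_add)
  have p: "partial b (\<lambda>x. f x + g x) x = partial b f x + partial b g x" if "x \<in> X" for b x
    using that smooth_on_differentiable f(1) g(1) by (intro partial_add) auto
  have pp: "partial b (partial c (\<lambda>x. f x + g x)) x = partial b (partial c f) x + partial b (partial c g) x"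
    if "x \<in> X" for b c x
    using partial_cong_open[OF assms(1) that p[where b = c], where b = b]
      partial_add[OF smooth_on_differentiable[OF smooth_on_partial[OF f(1)] that]
        smooth_on_differentiable[OF smooth_on_partial[OF g(1)] that]] by simp
  show "\<bar>f x + g x\<bar> \<le> K + L" if "x \<in> X" for x
    using f(2) g(2) that by (meson abs_triangle_ineq add_mono order_trans)
  show "\<bar>partial b (\<lambda>x. f x + g x) x\<bar> \<le> K + L" if "x \<in> X" "b \<in> Basis" for x b
    using f(3)[OF that] g(3)[OF that] p[OF that(1), of b] by linarith
  show "\<bar>partial b (partial c (\<lambda>x. f x + g x)) x\<bar> \<le> K + L" if "x \<in> X" "b \<in> Basis" "c \<in> Basis" for x b c
    using f(4)[OF that] g(4)[OF that] pp[OF that(1), of b c] by linarith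
qed

lemma C2_le_sum:
  assumes "open X" "finite I" "\<And>i. i \<in> I \<Longrightarrow> C2_le X K (f i)"
  shows "C2_le X (of_nat (card I) * K) (\<lambda>x. \<Sum>i\<in>I. f i x)"
  using assms(2,3)
proof (induction I rule: finite_induct)
  case empty
  then show ?case by (simp add: C2_le_const)
next
  case (insert i I)
  then have "C2_le X (K + of_nat (card I) * K) (\<lambda>x. f i x + (\<Sum>i\<in>I. f i x))"
    by (intro C2_le_add assms(1)) auto
  then show ?case
    using insert by (simp add: algebra_simps)
qed

lemma partial_mult:
  assumes "f differentiable (at x)" "g differentiable (at x)"
  shows "partial b (\<lambda>x. f x * g x) x = f x * partial b g x + partial b f x * g x"
  unfolding partial_def
  using bounded_bilinear.frechet_derivative_bilinear[OF bounded_bilinear_mult assms] .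

text \<open>The factor 4 counts the terms in the second derivative of a product, each of which is at
  most \<open>K * L\<close>.\<close>

lemma C2_le_mult:
  assumes "open X" "C2_le X K f" "C2_le X L g"
  shows "C2_le X (4 * K * L) (\<lambda>x. f x * g x)"
proof (rule C2_leI)
  note f = C2_leD[OF assms(2)] and g = C2_leD[OF assms(3)]
  show "smooth_on X (\<lambda>x. f x * g x)"
    using assms f g by (intro smooth_on_mult)
  note d = smooth_on_differentiable
  note s = smooth_on_partial[OF f(1)] smooth_on_partial[OF g(1)]
  have p: "partial b (\<lambda>x. f x * g x) x = f x * partial b g x + partial b f x * g x" if "x \<in> X" for b x
    using that d f(1) g(1) by (intro partial_mult) auto
  have pp: "partial b (partial c (\<lambda>x. f x * g x)) x
      = f x * partial b (partial c g) x + partial b f x * partial c g x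
        + (partial c f x * partial b g x + partial b (partial c f) x * g x)"
    if "x \<in> X" for b c x
  proof -
    have "smooth_on X (\<lambda>x. f x * partial c g x)" "smooth_on X (\<lambda>x. partial c f x * g x)"
      using assms(1) f(1) g(1) s by (intro smooth_on_mult; simp)+
    then have "(\<lambda>x. f x * partial c g x) differentiable (at x)" "(\<lambda>x. partial c f x * g x) differentiable (at x)"
      using d that by blast+
    moreover have "f differentiable (at x)" "g differentiable (at x)"
        "partial c f differentiable (at x)" "partial c g differentiable (at x)"
      using d[OF f(1) that] d[OF g(1) that] d[OF s(1) that] d[OF s(2) that] by auto
    ultimately show ?thesis
      using partial_cong_open[OF assms(1) that p[where b = c], where b = b] by (simp add: partial_add partial_mult)
  qed
  have m: "\<bar>a * b\<bar> \<le> K * L" if "\<bar>a\<bar> \<le> K" "\<bar>b\<bar> \<le> L" for a b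
    using that by (simp add: abs_mult mult_mono')
  \<comment> \<open>The existence of a point in \<open>X\<close> makes \<open>K * L\<close>
    nonnegative, which allows one or two such terms to be enlarged to four.\<close>
  have nn: "0 \<le> K * L" if "x \<in> X" for x
    using m[OF f(2)[OF that] g(2)[OF that]] by (meson abs_ge_zero order_trans)
  show "\<bar>f x * g x\<bar> \<le> 4 * K * L" if "x \<in> X" for x
    using m[OF f(2)[OF that] g(2)[OF that]] nn[OF that] by linarith
  show "\<bar>partial b (\<lambda>x. f x * g x) x\<bar> \<le> 4 * K * L" if "x \<in> X" "b \<in> Basis" for x b
    using m[OF f(2)[OF that(1)] g(3)[OF that]] m[OF f(3)[OF that] g(2)[OF that(1)]] nn[OF that(1)]
    unfolding p[OF that(1)] by linarith
  show "\<bar>partial b (partial c (\<lambda>x. f x * g x)) x\<bar> \<le> 4 * K * L" if "x \<in> X" "b \<in> Basis" "c \<in> Basis" for x b c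
    using m[OF f(2)[OF that(1)] g(4)[OF that]] m[OF f(4)[OF that] g(2)[OF that(1)]]
      m[OF f(3)[OF that(1,2)] g(3)[OF that(1,3)]] m[OF f(3)[OF that(1,3)] g(3)[OF that(1,2)]]
    unfolding pp[OF that(1)] by linarith
qed

lemma C2_le_cmult:
  assumes "open X" "C2_le X K f" "\<bar>k\<bar> \<le> k'"
  shows "C2_le X (4 * k' * K) (\<lambda>x. k * f x)"
  using C2_le_mult[OF assms(1) C2_le_const[OF assms(3)] assms(2)] by simp

lemma partial_affine:
  fixes B :: "'c::euclidean_space \<Rightarrow> 'a::euclidean_space"
  assumes "bounded_linear B" "f differentiable (at (x\<^sub>0 + B z))"
  shows "partial b (\<lambda>z. f (x\<^sub>0 + B z)) z = (\<Sum>i\<in>Basis. (B b \<bullet> i) * partial i f (x\<^sub>0 + B z))"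
proof -
  have d: "((\<lambda>z. x\<^sub>0 + B z) has_derivative B) (at z)"
    using bounded_linear_imp_has_derivative[OF assms(1)] by (auto intro!: derivative_eq_intros)
  have "((\<lambda>z. f (x\<^sub>0 + B z)) has_derivative (\<lambda>b. frechet_derivative f (at (x\<^sub>0 + B z)) (B b))) (at z)"
    using has_derivative_compose[OF d has_derivative_frechet[OF assms(2)]] .
  then have "partial b (\<lambda>z. f (x\<^sub>0 + B z)) z = frechet_derivative f (at (x\<^sub>0 + B z)) (B b)"
    unfolding partial_def by (simp flip: frechet_derivative_at)
  also have "\<dots> = (\<Sum>i\<in>Basis. (B b \<bullet> i) * partial i f (x\<^sub>0 + B z))"
    unfolding partial_def
    using linear_real_expand[OF linear_frechet_derivative[OF assms(2)]] .
  finally show ?thesis .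
qed

text \<open>Derivatives of the composition with a contraction are small; its value is not, and has to be
  estimated separately.\<close>

lemma C2_le_affine:
  fixes B :: "'c::euclidean_space \<Rightarrow> 'a::euclidean_space"
  assumes X: "open X" and B: "bounded_linear B" "\<And>b i. b \<in> Basis \<Longrightarrow> i \<in> Basis \<Longrightarrow> \<bar>B b \<bullet> i\<bar> \<le> \<beta>"
    and f: "C2_le Y K f" and XY: "\<And>z. z \<in> X \<Longrightarrow> x\<^sub>0 + B z \<in> Y"
    and v: "\<And>z. z \<in> X \<Longrightarrow> \<bar>f (x\<^sub>0 + B z) - k\<bar> \<le> L"
    and L: "real DIM('a) * \<beta> * K \<le> L" "(real DIM('a) * \<beta>)\<^sup>2 * K \<le> L"
  shows "C2_le X L (\<lambda>z. f (x\<^sub>0 + B z) - k)"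
proof (rule C2_leI)
  note ff = C2_leD[OF f]
  have "smooth_on X (\<lambda>z. x\<^sub>0 + B z)"
    by (intro smooth_on_add X smooth_on_const smooth_on_linear B(1))
  then have s: "smooth_on X (\<lambda>z. h (x\<^sub>0 + B z))" if "smooth_on Y h" for h :: "'a \<Rightarrow> real"
    by (rule smooth_on_compose[OF X _ that]) (use XY in auto)
  show "smooth_on X (\<lambda>z. f (x\<^sub>0 + B z) - k)"
    by (intro smooth_on_diff X s ff(1) smooth_on_const)
  show "\<bar>f (x\<^sub>0 + B z) - k\<bar> \<le> L" if "z \<in> X" for z by (rule v[OF that])
  have \<beta>: "\<beta> \<ge> 0"
    using B(2)[OF SOME_Basis SOME_Basis] by linarith
  have p: "partial b (\<lambda>z. f (x\<^sub>0 + B z) - k) z = (\<Sum>i\<in>Basis. (B b \<bullet> i) * partial i f (x\<^sub>0 + B z))"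
    if "z \<in> X" for b z
  proof -
    have d: "f differentiable (at (x\<^sub>0 + B z))" "(\<lambda>z. f (x\<^sub>0 + B z)) differentiable (at z)"
      using smooth_on_differentiable[OF s[OF ff(1)] that] smooth_on_differentiable[OF ff(1) XY[OF that]] by auto
    have "partial b (\<lambda>z. f (x\<^sub>0 + B z) + (- k)) z = partial b (\<lambda>z. f (x\<^sub>0 + B z)) z + partial b (\<lambda>z. - k) z"
      using d by (intro partial_add) auto
    also have "partial b (\<lambda>z. - k) z = 0"
      by (simp add: partial_const)
    finally show ?thesis
      using partial_affine[OF B(1) d(1)] by simp
  qed
  have pp: "partial b (partial c (\<lambda>z. f (x\<^sub>0 + B z) - k)) z
      = (\<Sum>i\<in>Basis. (B c \<bullet> i) * (\<Sum>j\<in>Basis. (B b \<bullet> j) * partial j (partial i f) (x\<^sub>0 + B z)))"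
    if "z \<in> X" for b c z
  proof -
    have "((\<lambda>z. \<Sum>i\<in>Basis. (B c \<bullet> i) * partial i f (x\<^sub>0 + B z)) has_derivative
        (\<lambda>u. \<Sum>i\<in>Basis. (B c \<bullet> i) * frechet_derivative (\<lambda>z. partial i f (x\<^sub>0 + B z)) (at z) u)) (at z)"
      using smooth_on_differentiable[OF s[OF smooth_on_partial[OF ff(1)]] that]
      by (intro has_derivative_sum has_derivative_mult_right has_derivative_frechet)
    then have "partial b (partial c (\<lambda>z. f (x\<^sub>0 + B z) - k)) z
        = (\<Sum>i\<in>Basis. (B c \<bullet> i) * partial b (\<lambda>z. partial i f (x\<^sub>0 + B z)) z)"
      using partial_cong_open[OF X that p[where b = c], where b = b] unfolding partial_def
      by (simp flip: frechet_derivative_at)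
    also have "\<dots> = (\<Sum>i\<in>Basis. (B c \<bullet> i) * (\<Sum>j\<in>Basis. (B b \<bullet> j) * partial j (partial i f) (x\<^sub>0 + B z)))"
      using partial_affine[OF B(1) smooth_on_differentiable[OF smooth_on_partial[OF ff(1)] XY[OF that]]]
      by simp
    finally show ?thesis .
  qed
  \<comment> \<open>Each differentiation costs one factor \<open>real DIM('a) * \<beta>\<close>: the
    bound is used once for first derivatives and twice, nested, for second derivatives.\<close>
  have bound: "\<bar>\<Sum>i\<in>Basis. (B b \<bullet> i) * q i\<bar> \<le> real DIM('a) * \<beta> * Q"
    if "b \<in> Basis" "\<And>i. i \<in> Basis \<Longrightarrow> \<bar>q i\<bar> \<le> Q" for b q Q
  proof -
    have "\<bar>\<Sum>i\<in>Basis. (B b \<bullet> i) * q i\<bar> \<le> (\<Sum>i\<in>(Basis::'a set). \<beta> * Q)"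
      using B(2)[OF that(1)] that(2) \<beta>
      by (intro order_trans[OF sum_abs] sum_mono) (simp add: abs_mult mult_mono')
    then show ?thesis by simp
  qed
  show "\<bar>partial b (\<lambda>z. f (x\<^sub>0 + B z) - k) z\<bar> \<le> L" if "z \<in> X" "b \<in> Basis" for z b
    using bound[OF that(2) ff(3)[OF XY[OF that(1)]]] L(1) unfolding p[OF that(1)] by fastforce
  show "\<bar>partial b (partial c (\<lambda>z. f (x\<^sub>0 + B z) - k)) z\<bar> \<le> L"
    if "z \<in> X" "b \<in> Basis" "c \<in> Basis" for z b c
  proof -
    have inner: "\<bar>\<Sum>j\<in>Basis. (B b \<bullet> j) * partial j (partial i f) (x\<^sub>0 + B z)\<bar> \<le> real DIM('a) * \<beta> * K"
      if "i \<in> Basis" for i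
      using bound[OF \<open>b \<in> Basis\<close> ff(4)[OF XY[OF \<open>z \<in> X\<close>] _ that]] .
    have "\<bar>partial b (partial c (\<lambda>z. f (x\<^sub>0 + B z) - k)) z\<bar> \<le> real DIM('a) * \<beta> * (real DIM('a) * \<beta> * K)"
      unfolding pp[OF that(1)] by (rule bound[OF that(3)]) (rule inner)
    then show ?thesis
      using L(2) by (simp add: power2_eq_square mult_ac)
  qed
qed

text \<open>The mean value inequality on a convex set, with the operator norm of the derivative
  bounded crudely by the sum over the coordinates. It supplies the estimate of values that
  \<open>C2_le_affine\<close> takes as a hypothesis.\<close>

lemma C2_le_lipschitz:
  fixes f :: "'a::euclidean_space \<Rightarrow> real"
  assumes "C2_le Y K f" "convex Y" "x \<in> Y" "y \<in> Y"
  shows "\<bar>f y - f x\<bar> \<le> real DIM('a) * K * norm (y - x)"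
proof -
  note f = C2_leD[OF assms(1)]
  have d: "(f has_derivative frechet_derivative f (at z)) (at z)" if "z \<in> Y" for z
    using smooth_on_differentiable[OF f(1) that] by (rule has_derivative_frechet)
  have "onorm (frechet_derivative f (at z)) \<le> real DIM('a) * K" if "z \<in> Y" for z
  proof (rule onorm_le)
    fix u
    have "norm (frechet_derivative f (at z) u) = \<bar>\<Sum>i\<in>Basis. (u \<bullet> i) * partial i f z\<bar>"
      using linear_real_expand[OF has_derivative_linear[OF d[OF that]], of u] unfolding partial_def by simp
    also have "\<dots> \<le> (\<Sum>i\<in>(Basis::'a set). norm u * K)"
    proof (rule order_trans[OF sum_abs], rule sum_mono)
      fix i :: 'a assume i: "i \<in> Basis"
      show "\<bar>(u \<bullet> i) * partial i f z\<bar> \<le> norm u * K"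
        unfolding abs_mult by (rule mult_mono'[OF Basis_le_norm[OF i] f(3)[OF that i]]) auto
    qed
    finally show "norm (frechet_derivative f (at z) u) \<le> real DIM('a) * K * norm u"
      by (simp add: mult_ac)
  qed
  then have "norm (f y - f x) \<le> real DIM('a) * K * norm (y - x)"
    using d by (intro differentiable_bound[OF assms(2) _ _ assms(4,3)]) (auto intro: has_derivative_at_withinI)
  then show ?thesis by simp
qed

text \<open>The only basis vector of the reals is 1, so \<open>partial\<close> is the ordinary
  derivative; the explicit functions of \<open>t\<close> can thus be handled by one-variable
  calculus.\<close>

lemma C2_le_real:
  fixes r :: "real \<Rightarrow> real"
  assumes "open X" "smooth_on X r" "\<And>t. t \<in> X \<Longrightarrow> \<bar>r t\<bar> \<le> K"
    and "\<And>t. t \<in> X \<Longrightarrow> (r has_real_derivative r' t) (at t)" "\<And>t. t \<in> X \<Longrightarrow> \<bar>r' t\<bar> \<le> K"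
    and "\<And>t. t \<in> X \<Longrightarrow> (r' has_real_derivative r'' t) (at t)" "\<And>t. t \<in> X \<Longrightarrow> \<bar>r'' t\<bar> \<le> K"
  shows "C2_le X K r"
proof (rule C2_leI)
  have p: "partial b f t = D" if "(f has_real_derivative D) (at t)" "b \<in> Basis" for b f t D
    using that unfolding partial_def has_field_derivative_def
    by (simp flip: frechet_derivative_at)
  have p1: "partial b r t = r' t" if "b \<in> Basis" "t \<in> X" for b t
    using assms(4)[OF that(2)] that(1) by (rule p)
  show "\<bar>partial b r t\<bar> \<le> K" if "t \<in> X" "b \<in> Basis" for b t
    using p1 assms(5) that by simp
  show "\<bar>partial b (partial c r) t\<bar> \<le> K" if "t \<in> X" "b \<in> Basis" "c \<in> Basis" for b c t
    using partial_cong_open[OF assms(1) that(1) p1[OF that(3)], where b = b] p[OF assms(6)] assms(7) that by simp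
qed (use assms in auto)

lemma C2_le_snd:
  fixes r :: "real \<Rightarrow> real"
  assumes "open X" "C2_le Y K r" "\<And>z. z \<in> X \<Longrightarrow> snd z \<in> Y"
  shows "C2_le (X :: ('a::euclidean_space \<times> real) set) K (\<lambda>z. r (snd z))"
proof (cases "X = {}")
  case True
  then show ?thesis
    by (auto simp: C2_le_def smooth_on_def intro: C_k_on_local)
next
  case False
  have "C2_le X K (\<lambda>z. r (0 + snd z) - 0)"
    using assms C2_leD(2)[OF assms(2)]
    by (intro C2_le_affine[where \<beta> = 1, OF assms(1) bounded_linear_snd _ assms(2)])
      (auto simp: Basis_prod_def)
  then show ?thesis by simp
qed

section \<open>Passage between pointwise bounds and the extended-valued norm\<close>

lemma sup_norm_le_iff: "K \<ge> 0 \<Longrightarrow> sup_norm X f \<le> ennreal K \<longleftrightarrow> (\<forall>x\<in>X. \<bar>f x\<bar> \<le> K)"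
  unfolding sup_norm_def by (simp add: SUP_le_iff ennreal_le_iff)

text \<open>\<open>C2_norm\<close> is a \<open>Max\<close>, whose comparison rules require a finite
  set.\<close>

lemma finite_C2_norm_set:
  "finite {sup_norm U f | f b c. b \<in> Basis \<and> c \<in> Basis \<and> f \<in> partials_upto_2 (\<lambda>x. h x b c)}"
proof -
  have "{sup_norm U f | f b c. b \<in> Basis \<and> c \<in> Basis \<and> f \<in> partials_upto_2 (\<lambda>x. h x b c)}
    = (\<Union>b\<in>Basis. \<Union>c\<in>Basis. sup_norm U ` partials_upto_2 (\<lambda>x. h x b c))"
    by blast
  moreover have "finite (partials_upto_2 f)" for f :: "'a \<Rightarrow> real"
    unfolding partials_upto_2_def by (simp add: finite_image_set2)
  ultimately show ?thesis by simp
qed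

lemma C2_norm_leI:
  assumes "K \<ge> 0" "\<And>b c. b \<in> Basis \<Longrightarrow> c \<in> Basis \<Longrightarrow> C2_le X K (\<lambda>x. h x b c)"
  shows "C2_norm X h \<le> ennreal K"
proof -
  let ?S = "{sup_norm X f | f b c. b \<in> Basis \<and> c \<in> Basis \<and> f \<in> partials_upto_2 (\<lambda>x. h x b c)}"
  have "?S \<noteq> {}"
    using SOME_Basis unfolding partials_upto_2_def by blast
  moreover have "s \<le> ennreal K" if "s \<in> ?S" for s
  proof -
    from that obtain f b c where *: "s = sup_norm X f" "b \<in> Basis" "c \<in> Basis" "f \<in> partials_upto_2 (\<lambda>x. h x b c)"
      by blast
    then show ?thesis
      using assms(2)[OF *(2,3)] by (simp add: sup_norm_le_iff[OF assms(1)] C2_le_def)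
  qed
  ultimately show ?thesis
    unfolding C2_norm_def using finite_C2_norm_set by (subst Max_le_iff) auto
qed

lemma C2_norm_lessD:
  assumes "C2_norm X h < ennreal K" "b \<in> Basis" "c \<in> Basis" "smooth_on X (\<lambda>x. h x b c)" "K \<ge> 0"
  shows "C2_le X K (\<lambda>x. h x b c)"
  unfolding C2_le_def
proof (intro conjI assms(4) ballI)
  fix f x assume f: "f \<in> partials_upto_2 (\<lambda>x. h x b c)" and x: "x \<in> X"
  have "sup_norm X f \<le> C2_norm X h"
    unfolding C2_norm_def using finite_C2_norm_set f assms(2,3) by (intro Max_ge) auto
  then have "sup_norm X f \<le> ennreal K"
    using assms(1) by simp
  then show "\<bar>f x\<bar> \<le> K"
    using x sup_norm_le_iff[OF assms(5)] by blast
qed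

subsection \<open>Uniform positivity\<close>

lemma finite_uniform_bound:
  assumes "finite I" "\<And>i. i \<in> I \<Longrightarrow> \<exists>K::real. P i K"
    and "\<And>i K L. i \<in> I \<Longrightarrow> P i K \<Longrightarrow> K \<le> L \<Longrightarrow> P i L"
  shows "\<exists>K\<ge>1. \<forall>i\<in>I. P i K"
proof -
  obtain k where k: "\<And>i. i \<in> I \<Longrightarrow> P i (k i)"
    using assms(2) by metis
  \<comment> \<open>Inserting 1 makes the maximum meaningful for empty \<open>I\<close> and
    normalizes the bound to \<open>K \<ge> 1\<close>, so that later a power of \<open>K\<close> can
    be enlarged to a higher one.\<close>
  define K where "K = Max (insert 1 (k ` I))"
  have "K \<ge> 1" "\<And>i. i \<in> I \<Longrightarrow> k i \<le> K"
    using assms(1) by (simp_all add: K_def)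
  then show ?thesis
    using k assms(3) by blast
qed

text \<open>The quadratic form is continuous in the matrix and the vector together, hence attains a
  positive minimum over \<open>S\<close> times the unit sphere. \<open>Q\<close> is its reciprocal,
  and homogeneity passes from unit vectors to all vectors.\<close>

lemma compact_pos_def_lower_bound:
  fixes S :: "(real ^ 'n ^ 'n) set"
  assumes "compact S" "\<And>M v. M \<in> S \<Longrightarrow> v \<noteq> 0 \<Longrightarrow> v \<bullet> (M *v v) > 0"
  shows "\<exists>Q. \<forall>M\<in>S. \<forall>v. v \<bullet> v \<le> Q * (v \<bullet> (M *v v))"
proof (cases "S = {}")
  case False
  define q :: "(real ^ 'n ^ 'n) \<times> (real ^ 'n) \<Rightarrow> real" where
    "q = (\<lambda>z. \<Sum>i\<in>UNIV. snd z $ i * (\<Sum>j\<in>UNIV. fst z $ i $ j * snd z $ j))"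
  have q: "v \<bullet> (M *v v) = q (M, v)" for M v
    by (simp add: q_def inner_vec_def matrix_vector_mult_def)
  have "continuous_on (S \<times> sphere 0 1) q"
    unfolding q_def by (intro continuous_intros)
  moreover have "compact (S \<times> sphere (0 :: real ^ 'n) 1)" "S \<times> sphere (0 :: real ^ 'n) 1 \<noteq> {}"
    using assms(1) False by (auto intro: compact_Times)
  ultimately obtain z where z: "z \<in> S \<times> sphere 0 1" "\<And>y. y \<in> S \<times> sphere 0 1 \<Longrightarrow> q z \<le> q y"
    using continuous_attains_inf by metis
  have "fst z \<in> S" "snd z \<noteq> 0"
    using z(1) by (auto simp: mem_Times_iff)
  then have pos: "q z > 0"
    using assms(2)[of "fst z" "snd z"] q[of "snd z" "fst z"] by simp
  have "v \<bullet> v \<le> inverse (q z) * (v \<bullet> (M *v v))" if "M \<in> S" for M v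
  proof (cases "v = 0")
    case False
    define u where "u = v /\<^sub>R norm v"
    have u: "u \<in> sphere 0 1" and v: "v = norm v *\<^sub>R u"
      using False by (simp_all add: u_def)
    have "q z \<le> u \<bullet> (M *v u)"
      using z(2)[of "(M, u)"] u that by (simp add: q)
    then have "(norm v)\<^sup>2 * q z \<le> (norm v)\<^sup>2 * (u \<bullet> (M *v u))"
      by (simp add: mult_left_mono)
    also have "\<dots> = v \<bullet> (M *v v)"
      by (subst (2 3) v) (simp add: matrix_vector_mult_scaleR power2_eq_square)
    finally show ?thesis
      using pos by (simp add: power2_norm_eq_inner field_simps)
  qed simp
  then show ?thesis by blast
qed simp

text \<open>If the form vanished at \<open>v\<close>, then with \<open>w = M *v v\<close>, which is
  nonzero by invertibility, its value at \<open>v + t *\<^sub>R w\<close> would be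
  \<open>2 * t * (w \<bullet> w) + t\<^sup>2 * s\<close>, negative for small negative
  \<open>t\<close>.\<close>

lemma psd_invertible_imp_pos_def:
  fixes M :: "real ^ 'n ^ 'n"
  assumes sym: "transpose M = M" and psd: "\<And>v. v \<bullet> (M *v v) \<ge> 0" and "det M \<noteq> 0" "v \<noteq> 0"
  shows "v \<bullet> (M *v v) > 0"
proof (rule ccontr)
  assume "\<not> ?thesis"
  then have v0: "v \<bullet> (M *v v) = 0"
    using psd[of v] by linarith
  define w where "w = M *v v"
  have "w \<noteq> 0"
    using assms(3,4) unfolding w_def
    by (metis invertible_det_nz invertible_left_inverse matrix_left_invertible_ker)
  then have ww: "w \<bullet> w > 0" by simp
  have vw: "v \<bullet> (M *v w) = w \<bullet> w"
    using dot_lmul_matrix[of v M w] sym unfolding w_def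
    by (simp add: inner_commute flip: matrix_vector_mul_assoc vector_transpose_matrix)
  define s where "s = w \<bullet> (M *v w)"
  have "(v + t *\<^sub>R w) \<bullet> (M *v (v + t *\<^sub>R w)) = 2 * t * (w \<bullet> w) + t\<^sup>2 * s" for t
    using v0 vw
    by (simp add: s_def w_def[symmetric] algebra_simps inner_add_left inner_add_right matrix_vector_right_distrib
        matrix_vector_mult_scaleR power2_eq_square)
  then have *: "0 \<le> 2 * t * (w \<bullet> w) + t\<^sup>2 * s" for t
    using psd by metis
  have "s \<ge> 0"
    using psd unfolding s_def .
  \<comment> \<open>The denominator \<open>s + 1\<close> rather than \<open>s\<close> covers
    \<open>s = 0\<close>; this \<open>t\<close> gives \<open>t * s \<ge> - (w \<bullet> w)\<close>,
    so the linear term wins.\<close>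
  define t where "t = - (w \<bullet> w) / (s + 1)"
  have "t < 0"
    using ww \<open>s \<ge> 0\<close> by (simp add: t_def divide_neg_pos)
  have "t * s \<ge> t * (s + 1)"
    using \<open>t < 0\<close> by (simp add: algebra_simps)
  also have "t * (s + 1) = - (w \<bullet> w)"
    using \<open>s \<ge> 0\<close> by (simp add: t_def)
  finally have "2 * (w \<bullet> w) + t * s > 0"
    using ww by linarith
  then have "t * (2 * (w \<bullet> w) + t * s) < 0"
    using \<open>t < 0\<close> by (simp add: mult_neg_pos)
  moreover have "t * (2 * (w \<bullet> w) + t * s) = 2 * t * (w \<bullet> w) + t\<^sup>2 * s"
    by (simp add: algebra_simps power2_eq_square)
  ultimately show False
    using *[of t] by linarith
qed

lemma bounded_det_lower_bound:
  assumes "c > 0"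
  shows "\<exists>Q. \<forall>M :: real ^ 'n ^ 'n. transpose M = M \<longrightarrow> (\<forall>v. v \<bullet> (M *v v) \<ge> 0) \<longrightarrow>
    (\<forall>i j. \<bar>M $ i $ j\<bar> \<le> c) \<longrightarrow> \<bar>det M\<bar> \<ge> 1 / c \<longrightarrow> (\<forall>v. v \<bullet> v \<le> Q * (v \<bullet> (M *v v)))"
proof -
  \<comment> \<open>All conditions are weak, so that \<open>S\<close> is closed: definiteness is
    relaxed to semidefiniteness and recovered from the determinant, and the determinant bound is not
    strict.\<close>
  define S :: "(real ^ 'n ^ 'n) set" where
    "S = {M. (\<forall>i j. M $ j $ i = M $ i $ j) \<and> (\<forall>v. v \<bullet> (M *v v) \<ge> 0) \<and>
      (\<forall>i j. \<bar>M $ i $ j\<bar> \<le> c) \<and> \<bar>det M\<bar> \<ge> 1 / c}"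
  have "closed S"
    unfolding S_def det_def inner_vec_def matrix_vector_mult_def
    by (intro closed_Collect_conj closed_Collect_all closed_Collect_le closed_Collect_eq continuous_intros)
  moreover have "bounded S"
  proof (rule boundedI)
    fix M assume "M \<in> S"
    then have "\<bar>M $ i $ j\<bar> \<le> c" for i j unfolding S_def by blast
    then have "norm (M $ i) \<le> (\<Sum>j\<in>(UNIV::'n set). c)" for i
      using norm_le_l1_cart by (intro order_trans[OF norm_le_l1_cart] sum_mono)
    then have "(\<Sum>i\<in>UNIV. norm (M $ i)) \<le> (\<Sum>i\<in>(UNIV::'n set). \<Sum>j\<in>(UNIV::'n set). c)"
      by (intro sum_mono)
    moreover have "norm M \<le> (\<Sum>i\<in>UNIV. norm (M $ i))"
      unfolding norm_vec_def by (rule L2_set_le_sum) simp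
    ultimately show "norm M \<le> (\<Sum>i\<in>(UNIV::'n set). \<Sum>j\<in>(UNIV::'n set). c)"
      by linarith
  qed
  ultimately have "compact S"
    by (simp add: compact_eq_bounded_closed)
  moreover have "v \<bullet> (M *v v) > 0" if "M \<in> S" "v \<noteq> 0" for M v
  proof -
    have M: "\<And>i j. M $ j $ i = M $ i $ j" "\<And>v. v \<bullet> (M *v v) \<ge> 0" "\<bar>det M\<bar> \<ge> 1 / c"
      using \<open>M \<in> S\<close> unfolding S_def by blast+
    have "transpose M = M"
      by (simp add: vec_eq_iff transpose_def M(1))
    moreover have "det M \<noteq> 0"
      using M(3) assms by (auto simp: divide_le_0_iff)
    ultimately show ?thesis
      using M(2) that(2) by (intro psd_invertible_imp_pos_def)
  qed
  ultimately obtain Q where Q: "\<forall>M\<in>S. \<forall>v. v \<bullet> v \<le> Q * (v \<bullet> (M *v v))"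
    using compact_pos_def_lower_bound by metis
  have "M \<in> S" if "transpose M = M" "\<forall>v. v \<bullet> (M *v v) \<ge> 0" "\<forall>i j. \<bar>M $ i $ j\<bar> \<le> c" "\<bar>det M\<bar> \<ge> 1 / c" for M
  proof -
    have "M $ j $ i = M $ i $ j" for i j
      using arg_cong[OF that(1), of "\<lambda>M. M $ i $ j"] by (simp add: transpose_def)
    then show ?thesis unfolding S_def using that by simp
  qed
  then show ?thesis using Q by blast
qed

section \<open>Coordinate bounds for metrics on the sphere\<close>

lemma sum_Basis_vec: "(\<Sum>b\<in>(Basis :: (real ^ 'n) set). f b) = (\<Sum>i\<in>UNIV. f (axis i 1))"
proof -
  have "(Basis :: (real ^ 'n) set) = range (\<lambda>i. axis i 1)"
    by (auto simp: Basis_vec_def)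
  moreover have "inj (\<lambda>i::'n. axis i (1::real))"
    by (auto simp: inj_on_def axis_eq_axis)
  ultimately show ?thesis
    using sum.reindex[of "\<lambda>i::'n. axis i (1::real)" UNIV f] by (simp only: o_def)
qed

text \<open>Carries the lower bounds proved for matrices over to the bilinear forms of a metric in a
  chart.\<close>

lemma metric_matrix_quadratic:
  assumes "inner_product_on UNIV (h x)"
  shows "v \<bullet> (metric_matrix h x *v v) = h x v v"
proof -
  have "v \<bullet> (metric_matrix h x *v v) = (\<Sum>i\<in>UNIV. v $ i * (\<Sum>j\<in>UNIV. metric_matrix h x $ i $ j * v $ j))"
    by (simp add: inner_vec_def matrix_vector_mult_def)
  also have "\<dots> = h x v v"
    unfolding inner_product_on_expand[OF assms, of v v] sum_Basis_vec
    by (simp add: metric_matrix_def sum_distrib_left inner_axis mult_ac)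
  finally show ?thesis .
qed

lemma inner_product_on_nonneg: "inner_product_on UNIV B \<Longrightarrow> B v v \<ge> 0"
  using linear_0[OF inner_product_on_linear(1), of B v]
  unfolding inner_product_on_def by (cases "v = 0") (auto simp: less_imp_le)

lemma metric_on_sphere_pullback:
  "metric_on_sphere g \<Longrightarrow> chart_of (sphere 0 1) U \<psi> \<Longrightarrow> x \<in> U \<Longrightarrow> inner_product_on UNIV (pullback \<psi> g x)"
  using chart_of_pullback_inner_product unfolding metric_on_sphere_def by blast

text \<open>The constant \<open>K\<close> of a chart bounds the coefficients of the metric together with their
  derivatives from above, and the smallest eigenvalue from below.\<close>

definition chart_bounded ::
  "(real ^ 'n) set \<Rightarrow> (real ^ 'n \<Rightarrow> (real ^ 'n) \<times> real)
     \<Rightarrow> ((real ^ 'n) \<times> real \<Rightarrow> (real ^ 'n) \<times> real \<Rightarrow> (real ^ 'n) \<times> real \<Rightarrow> real) \<Rightarrow> real \<Rightarrow> bool" where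
  "chart_bounded U \<psi> g K \<longleftrightarrow>
     (\<forall>b\<in>Basis. \<forall>c\<in>Basis. C2_le U K (\<lambda>x. pullback \<psi> g x b c)) \<and>
     (\<forall>x\<in>U. \<forall>v. v \<bullet> v \<le> K * pullback \<psi> g x v v)"

lemma chart_bounded_mono:
  assumes "chart_bounded U \<psi> g K" "K \<le> L" "chart_of (sphere 0 1) U \<psi>" "metric_on_sphere g"
  shows "chart_bounded U \<psi> g L"
  unfolding chart_bounded_def
proof (intro conjI ballI allI)
  show "C2_le U L (\<lambda>x. pullback \<psi> g x b c)" if "b \<in> Basis" "c \<in> Basis" for b c
    using assms(1,2) that C2_le_mono unfolding chart_bounded_def by blast
  show "v \<bullet> v \<le> L * pullback \<psi> g x v v" if "x \<in> U" for x v
  proof -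
    have "pullback \<psi> g x v v \<ge> 0"
      using inner_product_on_nonneg[OF metric_on_sphere_pullback[OF assms(4,3) that]] .
    then have "K * pullback \<psi> g x v v \<le> L * pullback \<psi> g x v v"
      by (rule mult_right_mono[OF assms(2)])
    moreover have "v \<bullet> v \<le> K * pullback \<psi> g x v v"
      using assms(1) that unfolding chart_bounded_def by blast
    ultimately show ?thesis by linarith
  qed
qed

text \<open>The order of quantifiers is the point: \<open>Q\<close> depends only on \<open>c\<close>
  and the dimension and is fixed before \<open>g\<close> appears. Semidefiniteness and symmetry of
  the coefficient matrix come from \<open>g\<close> being a metric, the other two conditions from
  \<open>c_bounded\<close>.\<close>

lemma c_bounded_imp_chart_bounded:
  assumes "c > 1" "admissible_atlas A"
  shows "\<exists>K\<ge>1. \<forall>g. metric_on_sphere g \<and> c_bounded A c g \<longrightarrow>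
    (\<forall>(U, \<psi> :: real ^ 'n \<Rightarrow> (real ^ 'n) \<times> real)\<in>A. chart_bounded U \<psi> g K)"
proof -
  have "c > 0" using assms(1) by simp
  from bounded_det_lower_bound[OF this, where 'n = 'n] obtain Q where
    Q: "\<forall>M :: real ^ 'n ^ 'n. transpose M = M \<longrightarrow> (\<forall>v. v \<bullet> (M *v v) \<ge> 0) \<longrightarrow>
      (\<forall>i j. \<bar>M $ i $ j\<bar> \<le> c) \<longrightarrow> \<bar>det M\<bar> \<ge> 1 / c \<longrightarrow> (\<forall>v. v \<bullet> v \<le> Q * (v \<bullet> (M *v v)))" ..
  have "chart_bounded U \<psi> g (max c Q)"
    if g: "metric_on_sphere g" "c_bounded A c g" and U: "(U, \<psi>) \<in> A"
    for g U and \<psi> :: "real ^ 'n \<Rightarrow> (real ^ 'n) \<times> real"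
  proof -
    have \<psi>: "chart_of (sphere 0 1) U \<psi>"
      using assms(2) U unfolding admissible_atlas_def by blast
    have bd: "C2_norm U (pullback \<psi> g) < ennreal c" "\<And>x. x \<in> U \<Longrightarrow> \<bar>det (metric_matrix (pullback \<psi> g) x)\<bar> > 1 / c"
      using g(2) U unfolding c_bounded_def by auto
    have C2: "C2_le U c (\<lambda>x. pullback \<psi> g x b e)" if "b \<in> Basis" "e \<in> Basis" for b e
      using bd(1) that g(1) \<psi> assms(1) unfolding metric_on_sphere_def
      by (intro C2_norm_lessD[where h = "pullback \<psi> g"]) auto
    have low: "v \<bullet> v \<le> Q * pullback \<psi> g x v v" if x: "x \<in> U" for x v
    proof -
      note ip = metric_on_sphere_pullback[OF g(1) \<psi> x]
      note q = metric_matrix_quadratic[where h = "pullback \<psi> g" and x = x, OF ip]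
      have "pullback \<psi> g x v v \<ge> 0" for v
        using inner_product_on_nonneg[OF ip] .
      moreover have "transpose (metric_matrix (pullback \<psi> g) x) = metric_matrix (pullback \<psi> g) x"
        using ip by (simp add: inner_product_on_def transpose_def metric_matrix_def vec_eq_iff)
      moreover have "\<bar>metric_matrix (pullback \<psi> g) x $ i $ j\<bar> \<le> c" for i j
        using C2_leD(2)[OF C2 x, of "axis i 1" "axis j 1"] by (simp add: metric_matrix_def axis_in_Basis_iff)
      ultimately show ?thesis
        using Q[rule_format, of "metric_matrix (pullback \<psi> g) x" v] bd(2)[OF x] by (simp add: q)
    qed
    show ?thesis
      unfolding chart_bounded_def
    proof (intro conjI ballI allI)
      show "C2_le U (max c Q) (\<lambda>x. pullback \<psi> g x b e)" if "b \<in> Basis" "e \<in> Basis" for b e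
        using C2_le_mono[OF C2[OF that]] by simp
      show "v \<bullet> v \<le> max c Q * pullback \<psi> g x v v" if "x \<in> U" for x v
        using low[OF that, of v]
          mult_right_mono[OF max.cobounded2 inner_product_on_nonneg[OF metric_on_sphere_pullback[OF g(1) \<psi> that], of v], of Q c]
        by linarith
    qed
  qed
  then show ?thesis
    using assms(1) by (intro exI[of _ "max c Q"]) auto
qed

lemma smooth_imp_C2_le:
  assumes "compact C" "C \<subseteq> V" "smooth_on V f" "U \<subseteq> C"
  shows "\<exists>K. C2_le U K f"
proof -
  have s: "smooth_on V h" if "h \<in> partials_upto_2 f" for h
    using that assms(3) smooth_on_partial unfolding partials_upto_2_def by blast
  have "\<exists>K\<ge>1. \<forall>h\<in>partials_upto_2 f. \<forall>x\<in>C. \<bar>h x\<bar> \<le> K"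
  proof (rule finite_uniform_bound)
    show "finite (partials_upto_2 f)"
      unfolding partials_upto_2_def by (simp add: finite_image_set2)
    show "\<exists>K. \<forall>x\<in>C. \<bar>h x\<bar> \<le> K" if "h \<in> partials_upto_2 f" for h
    proof -
      have "compact (h ` C)"
        using s[OF that] assms(1,2)
        by (intro compact_continuous_image continuous_on_subset[OF smooth_on_continuous]) auto
      then have "bounded (h ` C)"
        by (rule compact_imp_bounded)
      then show ?thesis
        unfolding bounded_real by auto
    qed
  qed (meson order_trans)
  moreover have "smooth_on U f"
    using assms by (intro smooth_on_subset[OF assms(3)]) auto
  ultimately show ?thesis
    using assms(4) unfolding C2_le_def by blast
qed

text \<open>The extended chart \<open>\<psi>'\<close> gives coefficients that are smooth near the
  compact closure of \<open>U\<close> and positive definite on it, so continuity bounds them with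
  their derivatives and compactness bounds the form from below. On \<open>U\<close> both charts
  agree, hence so do their derivatives.\<close>

lemma round_chart_bounded:
  fixes \<psi> :: "real ^ 'n \<Rightarrow> (real ^ 'n) \<times> real"
  assumes \<psi>: "chart_of (sphere 0 1) U \<psi>" and C: "compact (closure U)" "closure U \<subseteq> V"
    and \<psi>': "chart_of (sphere 0 1) V \<psi>'" "\<forall>x\<in>U. \<psi>' x = \<psi> x"
  shows "\<exists>K. chart_bounded U \<psi> round_metric K"
proof -
  have U: "open U" using \<psi> unfolding chart_of_def by blast
  have UC: "U \<subseteq> closure U" by (rule closure_subset)
  have eq: "pullback \<psi>' round_metric x = pullback \<psi> round_metric x" if "x \<in> U" for x
    using frechet_derivative_cong_open[OF U that, of \<psi>' \<psi>] \<psi>'(2) that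
    unfolding pullback_def[abs_def] round_metric_def by simp
  have s: "smooth_on V (\<lambda>x. pullback \<psi>' round_metric x b c)" if "b \<in> Basis" "c \<in> Basis" for b c
    using metric_on_sphere_round \<psi>'(1) that unfolding metric_on_sphere_def by blast
  have mono: "C2_le U L f" if "C2_le U K f" "K \<le> L" for f and K L :: real
    using C2_le_mono that .
  have "\<exists>K\<ge>1. \<forall>c\<in>Basis. C2_le U K (\<lambda>x. pullback \<psi>' round_metric x b c)" if "b \<in> Basis" for b
    using smooth_imp_C2_le[OF C s[OF that] UC] mono by (intro finite_uniform_bound) auto
  then have "\<exists>K\<ge>1. \<forall>b\<in>Basis. \<forall>c\<in>Basis. C2_le U K (\<lambda>x. pullback \<psi>' round_metric x b c)"
    using mono by (intro finite_uniform_bound) (auto, blast)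
  then obtain K\<^sub>1 where K1: "\<And>b c. b \<in> Basis \<Longrightarrow> c \<in> Basis \<Longrightarrow> C2_le U K\<^sub>1 (\<lambda>x. pullback \<psi>' round_metric x b c)"
    by blast
  have K1': "C2_le U K\<^sub>1 (\<lambda>x. pullback \<psi> round_metric x b c)" if "b \<in> Basis" "c \<in> Basis" for b c
    by (rule C2_le_cong[OF U _ K1[OF that]]) (simp add: eq)
  have ip: "inner_product_on UNIV (pullback \<psi>' round_metric x)" if "x \<in> closure U" for x
    using metric_on_sphere_pullback[OF metric_on_sphere_round \<psi>'(1)] that C(2) by blast
  have quad: "v \<bullet> (metric_matrix (pullback \<psi>' round_metric) x *v v) = pullback \<psi>' round_metric x v v"
    if "x \<in> closure U" for x v
    using metric_matrix_quadratic[where h = "pullback \<psi>' round_metric" and x = x, OF ip[OF that]] .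
  let ?S = "metric_matrix (pullback \<psi>' round_metric) ` closure U"
  have "continuous_on (closure U) (metric_matrix (pullback \<psi>' round_metric))"
    unfolding metric_matrix_def[abs_def]
    by (intro continuous_on_vec_lambda continuous_on_subset[OF smooth_on_continuous[OF s] C(2)]) auto
  then have "compact ?S"
    using C(1) by (rule compact_continuous_image)
  moreover have "v \<bullet> (M *v v) > 0" if "M \<in> ?S" "v \<noteq> 0" for M v
  proof -
    obtain x where x: "x \<in> closure U" "M = metric_matrix (pullback \<psi>' round_metric) x"
      using \<open>M \<in> ?S\<close> by blast
    show ?thesis
      using ip[OF x(1)] that(2) unfolding x(2) quad[OF x(1)] inner_product_on_def by blast
  qed
  ultimately obtain K\<^sub>2 where K2: "\<forall>M\<in>?S. \<forall>v. v \<bullet> v \<le> K\<^sub>2 * (v \<bullet> (M *v v))"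
    using compact_pos_def_lower_bound by metis
  have low: "v \<bullet> v \<le> K\<^sub>2 * pullback \<psi> round_metric x v v" if "x \<in> U" for x v
  proof -
    have x: "x \<in> closure U" using that UC by blast
    show ?thesis
      using K2[rule_format, OF imageI[OF x], of v] unfolding quad[OF x] eq[OF that] .
  qed
  have "chart_bounded U \<psi> round_metric (max K\<^sub>1 K\<^sub>2)"
    unfolding chart_bounded_def
  proof (intro conjI ballI allI)
    show "C2_le U (max K\<^sub>1 K\<^sub>2) (\<lambda>x. pullback \<psi> round_metric x b e)" if "b \<in> Basis" "e \<in> Basis" for b e
      using C2_le_mono[OF K1'[OF that]] by simp
    show "v \<bullet> v \<le> max K\<^sub>1 K\<^sub>2 * pullback \<psi> round_metric x v v" if "x \<in> U" for x v
      using low[OF that, of v]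
        mult_right_mono[OF max.cobounded2 inner_product_on_nonneg[OF
          metric_on_sphere_pullback[OF metric_on_sphere_round \<psi> that], of v], of K\<^sub>2 K\<^sub>1]
      by linarith
  qed
  then show ?thesis by blast
qed

lemma admissible_atlas_round_chart_bounded:
  fixes A :: "((real ^ 'n) set \<times> (real ^ 'n \<Rightarrow> (real ^ 'n) \<times> real)) set"
  assumes "admissible_atlas A"
  shows "\<exists>K\<ge>1. \<forall>z\<in>A. chart_bounded (fst z) (snd z) round_metric K"
proof (rule finite_uniform_bound)
  show "finite A"
    using assms unfolding admissible_atlas_def by blast
  have A: "chart_of (sphere 0 1) (fst z) (snd z) \<and> compact (closure (fst z)) \<and>
      (\<exists>V \<psi>'. closure (fst z) \<subseteq> V \<and> chart_of (sphere 0 1) V \<psi>' \<and> (\<forall>x\<in>fst z. \<psi>' x = snd z x))" if "z \<in> A" for z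
    using assms that unfolding admissible_atlas_def by (cases z) auto
  show "\<exists>K. chart_bounded (fst z) (snd z) round_metric K" if "z \<in> A" for z
    using A[OF that] round_chart_bounded by metis
  show "chart_bounded (fst z) (snd z) round_metric L"
    if "z \<in> A" "chart_bounded (fst z) (snd z) round_metric K" "K \<le> L" for z K L
    using chart_bounded_mono[OF that(2,3) _ metric_on_sphere_round] A[OF that(1)] by blast
qed

subsection \<open>Orthonormalization\<close>

text \<open>Gram-Schmidt, by induction over a set of basis vectors. Keeping the family inside
  \<open>span S\<close> ensures that the next basis vector is independent of it, so that the residue
  \<open>w\<close> is nonzero and can be normalized.\<close>

lemma orthonormal_family:
  fixes B :: "'a::euclidean_space \<Rightarrow> 'a \<Rightarrow> real"
  assumes ip: "inner_product_on UNIV B" and "S \<subseteq> Basis"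
  shows "\<exists>f. (\<forall>i\<in>S. f i \<in> span S) \<and> (\<forall>i\<in>S. \<forall>j\<in>S. B (f i) (f j) = (if i = j then 1 else 0))"
proof -
  have "finite S"
    using assms(2) finite_Basis finite_subset by blast
  then show ?thesis
    using assms(2)
  proof (induction S rule: finite_induct)
    case empty
    then show ?case by simp
  next
    case (insert i S)
    have "S \<subseteq> Basis" using insert.prems by blast
    from insert.IH[OF this] obtain f where "\<forall>j\<in>S. f j \<in> span S"
      and "\<forall>j\<in>S. \<forall>k\<in>S. B (f j) (f k) = (if j = k then 1 else 0)"
      by (elim exE conjE)
    then have f: "\<And>j. j \<in> S \<Longrightarrow> f j \<in> span S"
      and on: "\<And>j k. j \<in> S \<Longrightarrow> k \<in> S \<Longrightarrow> B (f j) (f k) = (if j = k then 1 else 0)"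
      by simp_all
    note lin = inner_product_on_linear[OF ip]
    have sym: "B u v = B v u" for u v
      using ip unfolding inner_product_on_def by blast
    define w where "w = i - (\<Sum>j\<in>S. B i (f j) *\<^sub>R f j)"
    define e where "e = w /\<^sub>R sqrt (B w w)"
    have sp: "(\<Sum>j\<in>S. B i (f j) *\<^sub>R f j) \<in> span S"
      using f by (intro span_sum span_scale)
    have "i \<notin> span (Basis - {i})"
      using independent_Basis insert.prems unfolding dependent_def by blast
    then have "i \<notin> span S"
      using span_mono[of S "Basis - {i}"] insert.hyps insert.prems by blast
    then have "w \<noteq> 0"
      using sp unfolding w_def by auto
    then have ww: "B w w > 0"
      using ip unfolding inner_product_on_def by blast
    have wf: "B w (f k) = 0" if "k \<in> S" for k
    proof -
      have "B w (f k) = B i (f k) - (\<Sum>j\<in>S. B i (f j) * B (f j) (f k))"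
        unfolding w_def by (simp add: linear_diff[OF lin(1)] linear_sum[OF lin(1)] linear_cmul[OF lin(1)])
      also have "(\<Sum>j\<in>S. B i (f j) * B (f j) (f k)) = (\<Sum>j\<in>S. if j = k then B i (f k) else 0)"
        using on[OF _ that] by (intro sum.cong) auto
      finally show ?thesis
        using that insert.hyps(1) by simp
    qed
    have ee: "B e e = 1"
      using ww unfolding e_def
      by (simp add: linear_cmul[OF lin(1)] linear_cmul[OF lin(2)] field_simps)
    have ef: "B e (f k) = 0" if "k \<in> S" for k
      using wf[OF that] unfolding e_def by (simp add: linear_cmul[OF lin(1)])
    have "w \<in> span (insert i S)"
      unfolding w_def using sp span_mono[of S "insert i S"]
      by (intro span_diff) (auto intro: span_base)
    then have es: "e \<in> span (insert i S)"
      unfolding e_def by (rule span_scale)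
    show ?case
    proof (intro exI[of _ "f(i := e)"] conjI ballI)
      show "(f(i := e)) j \<in> span (insert i S)" if "j \<in> insert i S" for j
      proof (cases "j = i")
        case False
        then have "f j \<in> span S" using that f by blast
        then show ?thesis
          using False span_mono[of S "insert i S"] by auto
      qed (simp add: es)
      show "B ((f(i := e)) j) ((f(i := e)) k) = (if j = k then 1 else 0)"
        if "j \<in> insert i S" "k \<in> insert i S" for j k
      proof -
        have "B (f j) e = 0" if "j \<in> S" for j
          using ef[OF that] by (simp add: sym[of _ e])
        then show ?thesis
          using that on ee ef insert.hyps(2) by (cases "j = i"; cases "k = i") simp_all
      qed
    qed
  qed
qed

lemma orthonormalizing_map:
  fixes B :: "'a::euclidean_space \<Rightarrow> 'a \<Rightarrow> real"
  assumes ip: "inner_product_on UNIV B"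
  shows "\<exists>L :: 'a \<Rightarrow> 'a. linear L \<and> (\<forall>u v. B (L u) (L v) = u \<bullet> v)"
proof -
  obtain f :: "'a \<Rightarrow> 'a" where on: "\<And>j k. j \<in> Basis \<Longrightarrow> k \<in> Basis \<Longrightarrow> B (f j) (f k) = (if j = k then 1 else 0)"
    using orthonormal_family[OF ip order_refl] by blast
  define L where "L u = (\<Sum>b\<in>Basis. (u \<bullet> b) *\<^sub>R f b)" for u
  have L: "linear L"
    unfolding L_def
    by (intro linearI) (simp_all add: inner_add_left scaleR_add_left sum.distrib scaleR_sum_right)
  have Lb: "L b = f b" if "b \<in> Basis" for b
  proof -
    have "L b = (\<Sum>b'\<in>Basis. if b' = b then f b else 0)"
      unfolding L_def using that by (intro sum.cong) (auto simp: inner_Basis)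
    then show ?thesis using that by simp
  qed
  have BL: "B (L u) (L v) = u \<bullet> v" for u v
  proof -
    have ipL: "B (L u) (L v) = (\<Sum>b\<in>Basis. (u \<bullet> b) * B (L b) (L v))"
      by (rule linear_real_expand) (rule linear_compose[OF L inner_product_on_linear(1)[OF ip], unfolded o_def])
    also have "\<dots> = (\<Sum>b\<in>Basis. (u \<bullet> b) * (v \<bullet> b))"
    proof (rule sum.cong)
      fix b :: 'a assume b: "b \<in> Basis"
      have "B (L b) (L v) = (\<Sum>c\<in>Basis. (v \<bullet> c) * B (L b) (L c))"
        by (rule linear_real_expand) (rule linear_compose[OF L inner_product_on_linear(2)[OF ip], unfolded o_def])
      also have "\<dots> = (\<Sum>c\<in>Basis. if c = b then v \<bullet> b else 0)"
        using b by (intro sum.cong) (auto simp: Lb on)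
      finally show "(u \<bullet> b) * B (L b) (L v) = (u \<bullet> b) * (v \<bullet> b)"
        using b by simp
    qed simp
    finally show ?thesis
      by (simp add: euclidean_inner[of u v])
  qed
  show ?thesis
    by (rule exI[of _ L]) (simp add: L BL)
qed

subsection \<open>Rescaled charts\<close>

text \<open>The new image consists of those points of the old one that \<open>\<kappa>\<close> sends
  into the image of \<open>y\<close>; continuity of \<open>\<kappa>\<close> makes it relatively
  open. Composing \<open>\<kappa>\<close> with \<open>z\<close> extends the new inverse
  smoothly.\<close>

lemma chart_of_reparametrize:
  fixes \<psi> :: "'a::euclidean_space \<Rightarrow> 'b::euclidean_space" and y :: "'c::euclidean_space \<Rightarrow> 'a"
  assumes \<psi>: "chart_of M U \<psi>" and V: "open V" "open (y ` V)" "y ` V \<subseteq> U"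
    and y: "smooth_on V y" and z: "smooth_on UNIV z" "\<And>x. z (y x) = x"
  shows "chart_of M V (\<lambda>x. \<psi> (y x))"
proof -
  obtain W \<kappa> where U: "open U" "smooth_on U \<psi>" "openin (top_of_set M) (\<psi> ` U)"
    and W: "open W" "\<psi> ` U \<subseteq> W" "smooth_on W \<kappa>" "\<And>x. x \<in> U \<Longrightarrow> \<kappa> (\<psi> x) = x"
    using \<psi> unfolding chart_of_def by blast
  have "smooth_on V (\<lambda>x. \<psi> (y x))"
    using smooth_on_compose[OF V(1) y U(2) V(3)] .
  moreover have "openin (top_of_set M) ((\<lambda>x. \<psi> (y x)) ` V)"
  proof -
    have "open (W \<inter> \<kappa> -` (y ` V))"
      using continuous_open_preimage[OF smooth_on_continuous[OF W(3)] W(1) V(2)] .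
    moreover have "(\<lambda>x. \<psi> (y x)) ` V = \<psi> ` U \<inter> (W \<inter> \<kappa> -` (y ` V))"
    proof (intro equalityI subsetI)
      fix p assume "p \<in> (\<lambda>x. \<psi> (y x)) ` V"
      then obtain x where x: "x \<in> V" "p = \<psi> (y x)" by blast
      then have "y x \<in> U" using V(3) by blast
      then show "p \<in> \<psi> ` U \<inter> (W \<inter> \<kappa> -` (y ` V))"
        using x W by auto
    next
      fix p assume "p \<in> \<psi> ` U \<inter> (W \<inter> \<kappa> -` (y ` V))"
      then obtain u x where "u \<in> U" "p = \<psi> u" "x \<in> V" "\<kappa> p = y x" by blast
      then have "p = \<psi> (y x)" using W(4) by simp
      then show "p \<in> (\<lambda>x. \<psi> (y x)) ` V" using \<open>x \<in> V\<close> by blast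
    qed
    ultimately show ?thesis
      using U(3) openin_Int_open by metis
  qed
  moreover have "smooth_on W (\<lambda>p. z (\<kappa> p))"
    using smooth_on_compose[OF W(1,3) z(1)] by simp
  moreover have "(\<lambda>x. \<psi> (y x)) ` V \<subseteq> W" "\<forall>x\<in>V. z (\<kappa> (\<psi> (y x))) = x"
    using V(3) W(2,4) z(2) by auto
  ultimately show ?thesis
    unfolding chart_of_def using V(1) W(1) by blast
qed

text \<open>The condition on \<open>t\<^sub>0\<close> keeps all heights
  \<open>snd z + t\<^sub>0\<close> positive, so that the image stays inside the cylinder.\<close>

lemma chart_of_cylinder:
  fixes \<phi>\<^sub>1 :: "real ^ 'n \<Rightarrow> (real ^ 'n) \<times> real"
  assumes \<phi>1: "chart_of (sphere 0 1) (ball 0 1) \<phi>\<^sub>1" and t0: "t\<^sub>0 \<ge> 1 + \<xi>"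
  shows "chart_of cylinder (model_cylinder \<xi>) (\<lambda>z. (\<phi>\<^sub>1 (fst z), snd z + t\<^sub>0))"
proof -
  let ?\<phi> = "\<lambda>z. (\<phi>\<^sub>1 (fst z), snd z + t\<^sub>0)" and ?X = "model_cylinder \<xi> :: ((real ^ 'n) \<times> real) set"
  obtain W \<kappa> where s: "smooth_on (ball 0 1) \<phi>\<^sub>1" and o: "openin (top_of_set (sphere 0 1)) (\<phi>\<^sub>1 ` ball 0 1)"
    and W: "open W" "\<phi>\<^sub>1 ` ball 0 1 \<subseteq> W" "smooth_on W \<kappa>" "\<And>x. x \<in> ball 0 1 \<Longrightarrow> \<kappa> (\<phi>\<^sub>1 x) = x"
    using \<phi>1 unfolding chart_of_def by blast
  have X: "open ?X"
    unfolding model_cylinder_def by (intro open_Times) auto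
  have "smooth_on ?X (\<lambda>z. \<phi>\<^sub>1 (fst z))"
    by (rule smooth_on_compose[OF X smooth_on_fst s]) (auto simp: model_cylinder_def)
  then have "smooth_on ?X ?\<phi>"
    by (intro smooth_on_Pair smooth_on_add smooth_on_snd smooth_on_const X)
  moreover have "openin (top_of_set cylinder) (?\<phi> ` ?X)"
  proof -
    obtain T where T: "open T" "\<phi>\<^sub>1 ` ball 0 1 = sphere 0 1 \<inter> T"
      using o unfolding openin_open by blast
    have "?\<phi> ` ?X = \<phi>\<^sub>1 ` ball 0 1 \<times> (\<lambda>t. t + t\<^sub>0) ` {- (1 + \<xi>)<..<1 + \<xi>}"
      unfolding model_cylinder_def by force
    also have "(\<lambda>t. t + t\<^sub>0) ` {- (1 + \<xi>)<..<1 + \<xi>} = {t\<^sub>0 - (1 + \<xi>)<..<t\<^sub>0 + (1 + \<xi>)}"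
    proof (intro equalityI subsetI)
      fix t assume "t \<in> {t\<^sub>0 - (1 + \<xi>)<..<t\<^sub>0 + (1 + \<xi>)}"
      then show "t \<in> (\<lambda>t. t + t\<^sub>0) ` {- (1 + \<xi>)<..<1 + \<xi>}"
        by (intro image_eqI[of _ _ "t - t\<^sub>0"]) auto
    qed auto
    also have "\<phi>\<^sub>1 ` ball 0 1 \<times> {t\<^sub>0 - (1 + \<xi>)<..<t\<^sub>0 + (1 + \<xi>)}
        = cylinder \<inter> (T \<times> {t\<^sub>0 - (1 + \<xi>)<..<t\<^sub>0 + (1 + \<xi>)})"
      unfolding T(2) cylinder_def using t0 by auto
    finally show ?thesis
      unfolding openin_open using open_Times[OF T(1) open_greaterThanLessThan] by blast
  qed
  moreover have "smooth_on (W \<times> UNIV) (\<lambda>z. (\<kappa> (fst z), snd z - t\<^sub>0))"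
  proof -
    have oW: "open (W \<times> (UNIV :: real set))"
      using W(1) by (intro open_Times) auto
    have "smooth_on (W \<times> (UNIV :: real set)) (\<lambda>z. \<kappa> (fst z))"
      by (rule smooth_on_compose[OF oW smooth_on_fst W(3)]) auto
    then show ?thesis
      by (intro smooth_on_Pair smooth_on_diff smooth_on_snd smooth_on_const oW)
  qed
  moreover have "open (W \<times> (UNIV :: real set))" "?\<phi> ` ?X \<subseteq> W \<times> UNIV"
    using W by (auto intro: open_Times simp: model_cylinder_def)
  moreover have "\<forall>z\<in>?X. (\<kappa> (fst (?\<phi> z)), snd (?\<phi> z) - t\<^sub>0) = z"
    using W(4) by (auto simp: model_cylinder_def)
  ultimately show ?thesis
    unfolding chart_of_def using X
    by (intro conjI exI[of _ "W \<times> UNIV"] exI[of _ "\<lambda>z. (\<kappa> (fst z), snd z - t\<^sub>0)"])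
qed

section \<open>Estimates for the factors depending on the radial variable\<close>

lemma cutoff_derivatives:
  assumes "cutoff \<rho>"
  shows "(\<rho> has_real_derivative deriv \<rho> t) (at t)" "(deriv \<rho> has_real_derivative deriv (deriv \<rho>) t) (at t)"
proof -
  have s: "smooth_on UNIV \<rho>"
    using assms unfolding cutoff_def by blast
  have d: "\<rho> differentiable (at t)" for t
    using smooth_on_differentiable[OF s] by simp
  then have D: "(\<rho> has_real_derivative deriv \<rho> t) (at t)" for t
    by (simp add: DERIV_deriv_iff_real_differentiable)
  then show "(\<rho> has_real_derivative deriv \<rho> t) (at t)" .
  have "deriv \<rho> = (\<lambda>t. frechet_derivative \<rho> (at t) 1)"
    by (simp add: fun_eq_iff flip: frechet_derivative_at[OF D[unfolded has_field_derivative_def]])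
  then have "deriv \<rho> differentiable (at t)"
    using smooth_on_differentiable[OF smooth_on_frechet[OF s, of 1]] by simp
  then show "(deriv \<rho> has_real_derivative deriv (deriv \<rho>) t) (at t)"
    by (simp add: DERIV_deriv_iff_real_differentiable)
qed

text \<open>The inner slope \<open>2 / d\<close> gives \<open>\<bar>r' t\<bar> \<le> 6 / d\<close>
  and, as \<open>d \<ge> 1\<close>,
  \<open>\<bar>r'' t\<bar> \<le> 12 * (2 / d)\<^sup>2 \<le> 48 / d\<close>. The value of
  \<open>r\<close> is only bounded, but its deviation from \<open>r 0\<close> is small by the mean
  value theorem on an interval of half-length \<open>1 + \<xi>\<close>.\<close>

lemma C2_le_cutoff:
  fixes t\<^sub>0 a d \<xi> :: real
  assumes \<rho>: "cutoff \<rho>" and d: "d \<ge> 1" and \<xi>: "\<xi> \<ge> 0"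
  defines "I \<equiv> {- (1 + \<xi>)<..<1 + \<xi>}" and "r \<equiv> \<lambda>t. \<rho> (2 * ((t + t\<^sub>0 - a) / d))"
  shows "C2_le I 48 r" "C2_le I 48 (\<lambda>t. 1 - r t)" "C2_le I (48 * (1 + \<xi>) / d) (\<lambda>t. r t - r 0)"
proof -
  have I: "open I" unfolding I_def by simp
  have sr: "smooth_on I r"
  proof -
    have "smooth_on I (\<lambda>t. 2 * ((t + t\<^sub>0 - a) * inverse d))"
      by (intro smooth_on_mult smooth_on_add smooth_on_diff smooth_on_const smooth_on_id I)
    then have "smooth_on I (\<lambda>t. 2 * ((t + t\<^sub>0 - a) / d))"
      by (simp only: divide_inverse)
    moreover have "smooth_on UNIV \<rho>"
      using \<rho> unfolding cutoff_def by blast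
    ultimately show ?thesis
      unfolding r_def by (rule smooth_on_compose[OF I]) simp
  qed
  define r' r'' where "r' t = (2 / d) * deriv \<rho> (2 * ((t + t\<^sub>0 - a) / d))"
    and "r'' t = (2 / d)\<^sup>2 * deriv (deriv \<rho>) (2 * ((t + t\<^sub>0 - a) / d))" for t
  have lin: "((\<lambda>t. 2 * ((t + t\<^sub>0 - a) / d)) has_real_derivative 2 / d) (at t)" for t
    using d by (auto intro!: derivative_eq_intros)
  have D1: "(r has_real_derivative r' t) (at t)" for t
    using DERIV_chain2[OF cutoff_derivatives(1)[OF \<rho>] lin] unfolding r_def r'_def by (simp add: mult.commute)
  have D2: "(r' has_real_derivative r'' t) (at t)" for t
    using DERIV_cmult[OF DERIV_chain2[OF cutoff_derivatives(2)[OF \<rho>] lin], of "2 / d"]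
    unfolding r'_def r''_def by (simp add: power2_eq_square mult_ac)
  have b: "\<bar>deriv \<rho> t\<bar> \<le> 3" "\<bar>deriv (deriv \<rho>) t\<bar> \<le> 12" "0 \<le> \<rho> t" "\<rho> t \<le> 1" for t
    using \<rho> unfolding cutoff_def by (auto simp: less_imp_le)
  have b1: "\<bar>r' t\<bar> \<le> 6 / d" for t
    using d b(1)[of "2 * ((t + t\<^sub>0 - a) / d)"] unfolding r'_def by (simp add: abs_mult divide_right_mono)
  have "(2 / d)\<^sup>2 \<le> 4 / d"
    using d by (simp add: power2_eq_square field_simps)
  then have b2: "\<bar>r'' t\<bar> \<le> 48 / d" for t
    using mult_mono[OF _ b(2)[of "2 * ((t + t\<^sub>0 - a) / d)"], of "(2 / d)\<^sup>2" "4 / d"] d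
    unfolding r''_def by (simp add: abs_mult)
  have d1: "6 / d \<le> 48 / d" "48 / d \<le> 48" "48 / d \<le> 48 * (1 + \<xi>) / d"
    using d \<xi> by (auto simp: field_simps)
  have b1': "\<bar>r' t\<bar> \<le> 48" "\<bar>r' t\<bar> \<le> 48 * (1 + \<xi>) / d" and b2': "\<bar>r'' t\<bar> \<le> 48" "\<bar>r'' t\<bar> \<le> 48 * (1 + \<xi>) / d" for t
    using b1[of t] b2[of t] d1 by linarith+
  have b0: "0 \<le> r t" "r t \<le> 1" for t
    using b(3,4) unfolding r_def by auto
  show "C2_le I 48 r"
  proof (rule C2_le_real[OF I sr, of _ r' r''])
    show "\<bar>r t\<bar> \<le> 48" for t
      using b0[of t] by linarith
  qed (use D1 D2 b1' b2' in blast)+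
  show "C2_le I 48 (\<lambda>t. 1 - r t)"
  proof (rule C2_le_real[OF I, of _ _ "\<lambda>t. - r' t" "\<lambda>t. - r'' t"])
    show "smooth_on I (\<lambda>t. 1 - r t)"
      by (intro smooth_on_diff smooth_on_const sr I)
    show "\<bar>1 - r t\<bar> \<le> 48" "\<bar>- r' t\<bar> \<le> 48" "\<bar>- r'' t\<bar> \<le> 48" for t
      using b0[of t] b1'[of t] b2'[of t] by linarith+
    show "((\<lambda>t. 1 - r t) has_real_derivative - r' t) (at t)"
      "((\<lambda>t. - r' t) has_real_derivative - r'' t) (at t)" for t
      using DERIV_diff[OF DERIV_const[of 1] D1] DERIV_minus[OF D2] by simp_all
  qed
  show "C2_le I (48 * (1 + \<xi>) / d) (\<lambda>t. r t - r 0)"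
  proof (rule C2_le_real[OF I, of _ _ r' r''])
    show "smooth_on I (\<lambda>t. r t - r 0)"
      by (intro smooth_on_diff smooth_on_const sr I)
    show "\<bar>r t - r 0\<bar> \<le> 48 * (1 + \<xi>) / d" if "t \<in> I" for t
    proof -
      have "norm (r t - r 0) \<le> (6 / d) * norm (t - 0)"
        using D1 b1 by (intro field_differentiable_bound[OF convex_UNIV, of _ r']) auto
      also have "\<dots> \<le> (48 / d) * (1 + \<xi>)"
        using that d \<xi> unfolding I_def by (intro mult_mono) (auto simp: divide_right_mono)
      finally show ?thesis by simp
    qed
    show "\<bar>r' t\<bar> \<le> 48 * (1 + \<xi>) / d" "\<bar>r'' t\<bar> \<le> 48 * (1 + \<xi>) / d" for t
      using b1' b2' by auto
    show "((\<lambda>t. r t - r 0) has_real_derivative r' t) (at t)" for t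
      using DERIV_diff[OF D1 DERIV_const[of "r 0"]] by simp
  qed (rule D2)
qed

text \<open>The factor \<open>sinh\<^sup>2(t + t\<^sub>0)\<close> is compared with \<open>exp(2t)\<close> after dividing by its
  leading coefficient \<open>exp(2t\<^sub>0) / 4\<close>, which the rescaling of the chart by \<open>2 exp(-t\<^sub>0)\<close> absorbs.\<close>

lemma C2_le_warping_factor:
  fixes t\<^sub>0 \<xi> :: real
  assumes "t\<^sub>0 \<ge> 0" "\<xi> \<ge> 0"
  defines "I \<equiv> {- (1 + \<xi>)<..<1 + \<xi>}" and "s \<equiv> \<lambda>t. (2 * exp (- t\<^sub>0))\<^sup>2 * (sinh (t + t\<^sub>0))\<^sup>2"
    and "E \<equiv> exp (2 * (1 + \<xi>))"
  shows "C2_le I (8 * E) s" "C2_le I (6 * E * exp (- t\<^sub>0)) (\<lambda>t. s t - exp (2 * t))"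
proof -
  have I: "open I" unfolding I_def by simp
  \<comment> \<open>With these, \<open>s t\<close> is the square of
    \<open>exp t - exp (- t) * p\<close>, and \<open>q = p\<^sup>2\<close>. Expanding gives
    \<open>exp (2 * t)\<close> and two error terms, both controlled by
    \<open>exp (- t\<^sub>0)\<close>.\<close>
  define p q where "p = exp (- 2 * t\<^sub>0)" and "q = exp (- 4 * t\<^sub>0)"
  have "p \<le> exp (- t\<^sub>0)" "q \<le> exp (- t\<^sub>0)"
    using assms(1) unfolding p_def q_def by simp_all
  moreover have "exp (- t\<^sub>0) \<le> 1" using assms(1) by simp
  moreover have "0 < p" "0 < q" unfolding p_def q_def by simp_all
  ultimately have pq: "0 < p" "0 < q" "p \<le> exp (- t\<^sub>0)" "q \<le> exp (- t\<^sub>0)" "p \<le> 1" "q \<le> 1"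
    by linarith+
  have E: "E \<ge> 1" using assms(2) unfolding E_def by simp
  have s: "s t = exp (2 * t) - 2 * p + exp (- 2 * t) * q" for t
  proof -
    have "2 * exp (- t\<^sub>0) * sinh (t + t\<^sub>0) = exp t - exp (- t) * p"
      by (simp add: sinh_def p_def algebra_simps flip: exp_add)
    then have "s t = (exp t - exp (- t) * p)\<^sup>2"
      unfolding s_def power_mult_distrib[symmetric] by simp
    also have "\<dots> = (exp t)\<^sup>2 - 2 * (exp t * exp (- t)) * p + (exp (- t))\<^sup>2 * p\<^sup>2"
      by (simp add: power2_eq_square algebra_simps)
    also have "exp t * exp (- t) = 1" by (simp flip: exp_add)
    also have "(exp t)\<^sup>2 = exp (2 * t)" by (simp flip: exp_double)
    also have "(exp (- t))\<^sup>2 = exp (- 2 * t)" by (simp flip: exp_double)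
    also have "p\<^sup>2 = q" by (simp add: p_def q_def flip: exp_double)
    finally show ?thesis by simp
  qed
  have e: "0 < exp (2 * t)" "exp (2 * t) \<le> E" "0 < exp (- 2 * t)" "exp (- 2 * t) \<le> E" if "t \<in> I" for t
    using that unfolding I_def E_def by auto
  have eq: "0 < exp (- 2 * t) * q" "exp (- 2 * t) * q \<le> E * exp (- t\<^sub>0)" "exp (- 2 * t) * q \<le> E" if "t \<in> I" for t
    using e[OF that] pq E mult_mono[OF e(4)[OF that] pq(4)] mult_mono[OF e(4)[OF that] pq(6)] by auto
  have pE: "p \<le> E * exp (- t\<^sub>0)"
  proof -
    have "1 * exp (- t\<^sub>0) \<le> E * exp (- t\<^sub>0)"
      by (intro mult_right_mono E) simp
    then show ?thesis using pq(3) by linarith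
  qed
  have pE': "p \<le> E" using pq E by linarith
  have sm: "smooth_on I (\<lambda>t. exp (2 * t) - 2 * p + exp (- 2 * t) * q)" "smooth_on I (\<lambda>t. exp (- 2 * t) * q - 2 * p)"
    by (intro smooth_on_add smooth_on_diff smooth_on_mult smooth_on_exp smooth_on_const smooth_on_id I)+
  \<comment> \<open>\<open>E\<close> bounds \<open>exp (2 * t)\<close> and
    \<open>exp (- 2 * t)\<close> on the interval. The second derivative, with two coefficients 4,
    dictates the constant 8.\<close>
  have "C2_le I (8 * E) (\<lambda>t. exp (2 * t) - 2 * p + exp (- 2 * t) * q)"
  proof (rule C2_le_real[OF I sm(1), of _ "\<lambda>t. 2 * exp (2 * t) - 2 * (exp (- 2 * t) * q)"
        "\<lambda>t. 4 * exp (2 * t) + 4 * (exp (- 2 * t) * q)"])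
    fix t assume "t \<in> I"
    note b = e[OF this] eq[OF this] pE' pq E
    show "\<bar>exp (2 * t) - 2 * p + exp (- 2 * t) * q\<bar> \<le> 8 * E"
      "\<bar>2 * exp (2 * t) - 2 * (exp (- 2 * t) * q)\<bar> \<le> 8 * E"
      "\<bar>4 * exp (2 * t) + 4 * (exp (- 2 * t) * q)\<bar> \<le> 8 * E"
      by (rule abs_leI; use b in linarith)+
  qed (auto intro!: derivative_eq_intros)
  then show "C2_le I (8 * E) s" unfolding s[abs_def] .
  have "C2_le I (6 * E * exp (- t\<^sub>0)) (\<lambda>t. exp (- 2 * t) * q - 2 * p)"
  proof (rule C2_le_real[OF I sm(2), of _ "\<lambda>t. - 2 * (exp (- 2 * t) * q)" "\<lambda>t. 4 * (exp (- 2 * t) * q)"])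
    fix t assume "t \<in> I"
    note b = eq[OF this] pE pq
    show "\<bar>exp (- 2 * t) * q - 2 * p\<bar> \<le> 6 * E * exp (- t\<^sub>0)"
      "\<bar>- 2 * (exp (- 2 * t) * q)\<bar> \<le> 6 * E * exp (- t\<^sub>0)"
      "\<bar>4 * (exp (- 2 * t) * q)\<bar> \<le> 6 * E * exp (- t\<^sub>0)"
      by (rule abs_leI; use b in linarith)+
  qed (auto intro!: derivative_eq_intros)
  then show "C2_le I (6 * E * exp (- t\<^sub>0)) (\<lambda>t. s t - exp (2 * t))"
    unfolding s by (simp add: algebra_simps)
qed

subsection \<open>Closeness to the hyperbolic model\<close>

lemma metric_on_sphere_interpolated:
  assumes "cutoff \<rho>" "metric_on_sphere g"
  shows "metric_on_sphere (interpolated_metric \<rho> a d g t)"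
    and "\<sigma> > 0 \<Longrightarrow> metric_on_sphere (\<lambda>\<theta> u v. \<sigma> * interpolated_metric \<rho> a d g t \<theta> u v)"
proof -
  have "0 \<le> \<rho> s" "\<rho> s \<le> 1" for s
    using assms(1) unfolding cutoff_def by auto
  note * = metric_on_sphere_interpolate[OF metric_on_sphere_round assms(2) _ this]
  show "metric_on_sphere (interpolated_metric \<rho> a d g t)"
    using *[of 1 "2 * ((t - a) / d)"] unfolding interpolated_metric_def[abs_def] by simp
  show "metric_on_sphere (\<lambda>\<theta> u v. \<sigma> * interpolated_metric \<rho> a d g t \<theta> u v)" if "\<sigma> > 0"
    using *[of \<sigma> "2 * ((t - a) / d)", OF that] unfolding interpolated_metric_def[abs_def] .
qed

text \<open>The derivative of the product chart acts on the two components separately and its first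
  part is tangent to the sphere, so the polar form of the metric applies and no mixed terms
  arise.\<close>

lemma pullback_warping_deformation:
  fixes \<phi>\<^sub>1 :: "real ^ 'n \<Rightarrow> (real ^ 'n) \<times> real"
  assumes \<phi>1: "chart_of (sphere 0 1) (ball 0 1) \<phi>\<^sub>1" and z: "z \<in> model_cylinder \<xi>" and t0: "t\<^sub>0 \<ge> 1 + \<xi>"
  shows "pullback (\<lambda>z. (\<phi>\<^sub>1 (fst z), snd z + t\<^sub>0)) (pullback polar (warping_deformation \<rho> a d g)) z u v
    = (sinh (snd z + t\<^sub>0))\<^sup>2 * pullback \<phi>\<^sub>1 (interpolated_metric \<rho> a d g (snd z + t\<^sub>0)) (fst z) (fst u) (fst v)
      + snd u * snd v"
proof -
  have x: "fst z \<in> ball 0 1" and t: "snd z + t\<^sub>0 > 0"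
    using z t0 unfolding model_cylinder_def by auto
  have "(\<phi>\<^sub>1 has_derivative frechet_derivative \<phi>\<^sub>1 (at (fst z))) (at (fst z))"
    using chart_of_differentiable[OF \<phi>1 x] by (rule has_derivative_frechet)
  then have "((\<lambda>z. \<phi>\<^sub>1 (fst z)) has_derivative (\<lambda>u. frechet_derivative \<phi>\<^sub>1 (at (fst z)) (fst u))) (at z)"
    using has_derivative_compose[OF has_derivative_fst[OF has_derivative_ident]] by blast
  then have "((\<lambda>z. (\<phi>\<^sub>1 (fst z), snd z + t\<^sub>0)) has_derivative
      (\<lambda>u. (frechet_derivative \<phi>\<^sub>1 (at (fst z)) (fst u), snd u))) (at z)"
    by (intro has_derivative_Pair) (auto intro!: derivative_eq_intros)
  then have d: "frechet_derivative (\<lambda>z. (\<phi>\<^sub>1 (fst z), snd z + t\<^sub>0)) (at z)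
      = (\<lambda>u. (frechet_derivative \<phi>\<^sub>1 (at (fst z)) (fst u), snd u))"
    by (simp flip: frechet_derivative_at)
  have "norm (\<phi>\<^sub>1 (fst z)) = 1"
    using chart_of_in[OF \<phi>1 x] by simp
  from pullback_polar_from_polar[OF this t chart_of_derivative_tangent[OF \<phi>1 x] chart_of_derivative_tangent[OF \<phi>1 x]]
  show ?thesis
    unfolding warping_deformation_def
    by (simp add: pullback_def[of "\<lambda>z. (\<phi>\<^sub>1 (fst z), snd z + t\<^sub>0)"] d) (simp add: pullback_def)
qed

text \<open>The hypothesis on \<open>exp (- t\<^sub>0)\<close> says
  \<open>\<mu> * (N * K) \<le> 1\<close> for the scale \<open>\<mu> = 2 * exp (- t\<^sub>0)\<close>.
  As \<open>L\<close> has norm at most \<open>K\<close>, the affine map then sends the unit ball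
  into \<open>ball x\<^sub>0 1\<close>, and \<open>\<mu>\<^sup>2\<close> can be replaced by \<mu>.
  The constant \<open>C\<close> involves only \<open>K\<close>, \<xi> and the dimension, which makes
  the bound uniform in \<open>g\<close> and the chart.\<close>

lemma rescaled_chart_estimate:
  fixes \<psi> :: "real ^ 'n \<Rightarrow> (real ^ 'n) \<times> real" and K \<xi> d a t\<^sub>0 :: real
  assumes \<rho>: "cutoff \<rho>" and \<psi>: "chart_of (sphere 0 1) U \<psi>" and g: "metric_on_sphere g"
    and bounded: "chart_bounded U \<psi> round_metric K" "chart_bounded U \<psi> g K" and K: "K \<ge> 1"
    and ball: "ball x\<^sub>0 1 \<subseteq> U" and d: "d \<ge> 1" and \<xi>: "\<xi> \<ge> 0"
  defines "N \<equiv> real DIM(real ^ 'n)"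
  assumes t0: "2 * N * K * exp (- t\<^sub>0) \<le> 1"
  defines "E \<equiv> exp (2 * (1 + \<xi>))"
  defines "C \<equiv> 128 * E * N\<^sup>2 * K\<^sup>2 * (768 * N\<^sup>2 * K ^ 3 + 384 * (1 + \<xi>) * K) + 24 * E"
  shows "\<exists>\<phi>\<^sub>1 :: real ^ 'n \<Rightarrow> (real ^ 'n) \<times> real. chart_of (sphere 0 1) (ball 0 1) \<phi>\<^sub>1 \<and> \<phi>\<^sub>1 0 = \<psi> x\<^sub>0 \<and>
    (\<forall>b\<in>(Basis :: ((real ^ 'n) \<times> real) set). \<forall>c\<in>(Basis :: ((real ^ 'n) \<times> real) set).
      C2_le (model_cylinder \<xi>) (C * (exp (- t\<^sub>0) + 1 / d))
      (\<lambda>z. (sinh (snd z + t\<^sub>0))\<^sup>2 * pullback \<phi>\<^sub>1 (interpolated_metric \<rho> a d g (snd z + t\<^sub>0)) (fst z) (fst b) (fst c)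
        - exp (2 * snd z) * (fst b \<bullet> fst c)))"
proof -
  let ?X = "model_cylinder \<xi> :: ((real ^ 'n) \<times> real) set"
  define Y where "Y = ball x\<^sub>0 1"
  define \<mu> where "\<mu> = 2 * exp (- t\<^sub>0)"
  define r where "r t = \<rho> (2 * ((t + t\<^sub>0 - a) / d))" for t
  define S G where "S i j p = pullback \<psi> round_metric p i j" and "G i j p = pullback \<psi> g p i j" for i j p
  have X: "open ?X"
    unfolding model_cylinder_def by (intro open_Times) auto
  have N: "N \<ge> 1"
    unfolding N_def using DIM_positive[where 'a = "real ^ 'n"] by linarith
  have NK: "N * K \<ge> 1" using mult_mono[OF N K] N by simp
  have \<mu>: "\<mu> > 0" "\<mu> * (N * K) \<le> 1"
    using t0 by (simp_all add: \<mu>_def mult_ac)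
  have "\<mu> * K \<le> \<mu> * (N * K)" "\<mu> \<le> \<mu> * (N * K)"
    using \<mu>(1) N K NK by (auto intro!: mult_left_mono simp: mult_left_le)
  then have \<mu>': "\<mu> * K \<le> 1" "\<mu> \<le> 1"
    using \<mu>(2) by linarith+
  have t0': "t\<^sub>0 \<ge> 0"
  proof -
    have "exp (- t\<^sub>0) \<le> 1"
      using \<mu>'(2) exp_gt_zero[of "- t\<^sub>0"] unfolding \<mu>_def by linarith
    then show ?thesis by simp
  qed
  have x0: "x\<^sub>0 \<in> U" using ball by auto
  define B where "B = pullback \<psi> (interpolated_metric \<rho> a d g t\<^sub>0) x\<^sub>0"
  have ip: "inner_product_on UNIV B"
    unfolding B_def
    by (rule metric_on_sphere_pullback[OF metric_on_sphere_interpolated(1)[OF \<rho> g] \<psi> x0])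
  obtain L :: "real ^ 'n \<Rightarrow> real ^ 'n" where L: "linear L" and BL: "\<And>u v. B (L u) (L v) = u \<bullet> v"
    using orthonormalizing_map[OF ip] by blast
  have r01: "0 \<le> r t" "r t \<le> 1" for t
    using \<rho> unfolding cutoff_def r_def by auto
  have Bexp: "B u v = pullback \<psi> round_metric x\<^sub>0 u v + r 0 * (pullback \<psi> g x\<^sub>0 u v - pullback \<psi> round_metric x\<^sub>0 u v)" for u v
    unfolding B_def r_def pullback_def interpolated_metric_def by simp
  \<comment> \<open>A convex combination of forms bounded below by the same multiple of the
    Euclidean one inherits the bound.\<close>
  have Blow: "v \<bullet> v \<le> K * B v v" for v
  proof -
    have "v \<bullet> v = (1 - r 0) * (v \<bullet> v) + r 0 * (v \<bullet> v)"
      by (simp add: algebra_simps)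
    also have "\<dots> \<le> (1 - r 0) * (K * pullback \<psi> round_metric x\<^sub>0 v v) + r 0 * (K * pullback \<psi> g x\<^sub>0 v v)"
      using bounded x0 r01[of 0] unfolding chart_bounded_def
      by (intro add_mono mult_left_mono) auto
    also have "\<dots> = K * B v v"
      unfolding Bexp by (simp add: algebra_simps)
    finally show ?thesis .
  qed
  \<comment> \<open>Evaluating the lower bound at \<open>L u\<close>, where \<open>B\<close> equals
    \<open>u \<bullet> u\<close>, gives the factor \<open>sqrt K\<close>; \<open>K \<ge> 1\<close>
    allows the simpler \<open>K\<close>.\<close>
  have Lb: "norm (L u) \<le> K * norm u" for u
  proof (rule power2_le_imp_le)
    have "(norm (L u))\<^sup>2 \<le> K * (norm u)\<^sup>2"
      using Blow[of "L u"] by (simp add: BL power2_norm_eq_inner)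
    also have "\<dots> \<le> K\<^sup>2 * (norm u)\<^sup>2"
      using K by (intro mult_right_mono) (auto simp: power2_eq_square)
    finally show "(norm (L u))\<^sup>2 \<le> (K * norm u)\<^sup>2"
      by (simp add: power_mult_distrib)
  qed (use K in simp)
  have "inj L"
  proof (rule linear_injective_0[OF L, THEN iffD2], intro allI impI)
    fix u assume "L u = 0"
    then have "u \<bullet> u = 0"
      using BL[of u u] linear_0[OF inner_product_on_linear(2)[OF ip, of 0]] by simp
    then show "u = 0" by simp
  qed
  then obtain L' where L': "linear L'" "\<And>x. L' (L x) = x" "\<And>x. L (L' x) = x"
    using linear_injective_isomorphism[OF L _ refl] by blast
  define y where "y x = x\<^sub>0 + \<mu> *\<^sub>R L x" for x
  define y' where "y' p = L' ((1 / \<mu>) *\<^sub>R (p - x\<^sub>0))" for p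
  define \<phi>\<^sub>1 where "\<phi>\<^sub>1 x = \<psi> (y x)" for x
  have y'y: "y' (y x) = x" and yy': "y (y' p) = p" for x p
    using \<mu>(1) L' unfolding y_def y'_def by simp_all
  have yb: "norm (\<mu> *\<^sub>R L x) \<le> norm x" for x
  proof -
    have "norm (\<mu> *\<^sub>R L x) \<le> \<mu> * (K * norm x)"
      using \<mu>(1) Lb[of x] by simp
    also have "\<dots> \<le> 1 * norm x"
      using mult_right_mono[OF \<mu>'(1), of "norm x"] by (simp add: mult.assoc)
    finally show ?thesis by simp
  qed
  have yY: "y x \<in> Y" if "x \<in> ball 0 1" for x
    using yb[of x] that unfolding y_def Y_def by (simp add: dist_norm)
  have YU: "Y \<subseteq> U" using ball unfolding Y_def .
  have lin: "bounded_linear L" "bounded_linear L'"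
    using L L'(1) linear_conv_bounded_linear by auto
  have ys: "smooth_on V y" if "open V" for V
    unfolding y_def
    by (intro smooth_on_add[OF that] smooth_on_scaleR[OF that] smooth_on_const smooth_on_linear[OF lin(1)])
  have "smooth_on UNIV (\<lambda>p. (1 / \<mu>) *\<^sub>R (p - x\<^sub>0))"
    by (intro smooth_on_scaleR smooth_on_diff smooth_on_const smooth_on_id open_UNIV)
  then have ys': "smooth_on UNIV y'"
    unfolding y'_def by (rule smooth_on_compose[OF open_UNIV _ smooth_on_linear[OF lin(2), of UNIV]]) simp
  have "y ` ball 0 1 = y' -` ball 0 1"
    using y'y yy' by (metis (no_types, lifting) image_eqI subsetI subset_antisym vimageE vimageI2 imageE)
  moreover have "open (y' -` ball 0 1)"
    using smooth_on_continuous[OF ys'] by (intro open_vimage) auto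
  ultimately have yo: "open (y ` ball 0 1)" by simp
  have \<phi>1: "chart_of (sphere 0 1) (ball 0 1) \<phi>\<^sub>1"
    unfolding \<phi>\<^sub>1_def
    by (rule chart_of_reparametrize[OF \<psi> open_ball yo _ ys[OF open_ball] ys' y'y]) (use yY YU in blast)
  have "\<phi>\<^sub>1 0 = \<psi> x\<^sub>0"
    unfolding \<phi>\<^sub>1_def y_def by (simp add: linear_0[OF L])
  have dy: "(y has_derivative (\<lambda>u. \<mu> *\<^sub>R L u)) (at x)" for x
    unfolding y_def using bounded_linear_imp_has_derivative[OF lin(1)]
    by (auto intro!: derivative_eq_intros)
  have pull: "pullback \<phi>\<^sub>1 h x u v = \<mu>\<^sup>2 * (\<Sum>i\<in>Basis. \<Sum>j\<in>Basis. (L u \<bullet> i) * (L v \<bullet> j) * pullback \<psi> h (y x) i j)"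
    if h: "metric_on_sphere h" and x: "x \<in> ball 0 1" for h x u v
  proof -
    have yx: "y x \<in> U" using yY[OF x] YU by blast
    have "(\<phi>\<^sub>1 has_derivative (\<lambda>u. frechet_derivative \<psi> (at (y x)) (\<mu> *\<^sub>R L u))) (at x)"
      unfolding \<phi>\<^sub>1_def
      using has_derivative_compose[OF dy has_derivative_frechet[OF chart_of_differentiable[OF \<psi> yx]]] .
    then have "pullback \<phi>\<^sub>1 h x u v = pullback \<psi> h (y x) (\<mu> *\<^sub>R L u) (\<mu> *\<^sub>R L v)"
      unfolding pullback_def \<phi>\<^sub>1_def by (simp flip: frechet_derivative_at)
    also have "\<dots> = \<mu>\<^sup>2 * (\<Sum>i\<in>Basis. \<Sum>j\<in>Basis. (L u \<bullet> i) * (L v \<bullet> j) * pullback \<psi> h (y x) i j)"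
      unfolding inner_product_on_expand[OF metric_on_sphere_pullback[OF h \<psi> yx], of "\<mu> *\<^sub>R L u"]
      by (simp add: sum_distrib_left power2_eq_square mult_ac)
    finally show ?thesis .
  qed
  \<comment> \<open>\<open>M\<close> dominates both \<open>N * (\<mu> * K) * K\<close>, from first
    derivatives and the Lipschitz bound, and \<open>(N * (\<mu> * K))\<^sup>2 * K\<close>, from
    second derivatives.\<close>
  define M where "M = \<mu> * N\<^sup>2 * K ^ 3"
  have M: "C2_le ?X M (\<lambda>z. f (x\<^sub>0 + \<mu> *\<^sub>R L (fst z)) - f x\<^sub>0)" if f: "C2_le Y K f" for f
  proof (rule C2_le_affine[where Y = Y and \<beta> = "\<mu> * K" and K = K, OF X _ _ f])
    show "bounded_linear (\<lambda>z. \<mu> *\<^sub>R L (fst z))"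
      using bounded_linear_compose[OF lin(1) bounded_linear_fst] by (rule bounded_linear_const_scaleR)
    show "\<bar>\<mu> *\<^sub>R L (fst b) \<bullet> i\<bar> \<le> \<mu> * K" if "b \<in> Basis" "i \<in> Basis" for b :: "(real ^ 'n) \<times> real" and i
    proof -
      have "\<bar>\<mu> *\<^sub>R L (fst b) \<bullet> i\<bar> \<le> norm (\<mu> *\<^sub>R L (fst b))"
        using that(2) by (rule Basis_le_norm)
      also have "\<dots> \<le> \<mu> * (K * 1)"
        using \<mu>(1) K norm_fst_le[of "fst b" "snd b"] that(1) Lb[of "fst b"]
        by (simp add: norm_Basis) (smt (verit, best) mult_left_le)
      finally show ?thesis by simp
    qed
    show "x\<^sub>0 + \<mu> *\<^sub>R L (fst z) \<in> Y" if "z \<in> ?X" for z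
      using yY[of "fst z"] that unfolding y_def model_cylinder_def by auto
    have "N \<le> N\<^sup>2" "K\<^sup>2 \<le> K ^ 3"
      using self_le_power[OF N, of 2] power_increasing[OF _ K, of 2 3] by simp_all
    then have NK': "N * K\<^sup>2 \<le> N\<^sup>2 * K ^ 3"
      using N K by (intro mult_mono) auto
    have "N * (\<mu> * K) * K = \<mu> * (N * K\<^sup>2)"
      by (simp add: power2_eq_square)
    also have "\<dots> \<le> M"
      unfolding M_def using mult_left_mono[OF NK', of \<mu>] \<mu>(1) by (simp add: mult_ac)
    finally have 1: "N * (\<mu> * K) * K \<le> M" .
    then show "real DIM(real ^ 'n) * (\<mu> * K) * K \<le> M"
      unfolding N_def .
    have "(N * (\<mu> * K))\<^sup>2 * K = \<mu>\<^sup>2 * (N\<^sup>2 * K ^ 3)"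
      by (simp add: power_mult_distrib power2_eq_square power3_eq_cube)
    also have "\<dots> \<le> \<mu> * (N\<^sup>2 * K ^ 3)"
      using \<mu>(1) \<mu>'(2) N K by (intro mult_right_mono) (auto simp: power2_eq_square mult_left_le)
    finally show "(real DIM(real ^ 'n) * (\<mu> * K))\<^sup>2 * K \<le> M"
      unfolding N_def[symmetric] M_def by (simp add: mult.assoc)
    show "\<bar>f (x\<^sub>0 + \<mu> *\<^sub>R L (fst z)) - f x\<^sub>0\<bar> \<le> M" if "z \<in> ?X" for z
    proof -
      have z: "fst z \<in> ball 0 1" using that unfolding model_cylinder_def by auto
      have "norm (\<mu> *\<^sub>R L (fst z)) \<le> \<mu> * K"
        using \<mu>(1) K Lb[of "fst z"] z by simp (smt (verit, best) mult_left_le)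
      then have "N * K * norm (\<mu> *\<^sub>R L (fst z)) \<le> N * K * (\<mu> * K)"
        using N K by (intro mult_left_mono) auto
      moreover have "\<bar>f (x\<^sub>0 + \<mu> *\<^sub>R L (fst z)) - f x\<^sub>0\<bar> \<le> N * K * norm (\<mu> *\<^sub>R L (fst z))"
        using C2_le_lipschitz[OF f, of x\<^sub>0 "y (fst z)"] yY[OF z] unfolding y_def N_def by (simp add: Y_def)
      ultimately show ?thesis
        using 1 by (simp add: mult_ac)
    qed
  qed
  have SG: "C2_le Y K (S i j)" "C2_le Y K (G i j)" if "i \<in> Basis" "j \<in> Basis" for i j
    using bounded that YU smooth_on_subset[of U _ Y] unfolding chart_bounded_def C2_le_def S_def G_def by blast+
  \<comment> \<open>The coefficient of the interpolated metric minus its value at the centre,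
    arranged so that each summand has a small factor: a displacement in \<open>x\<close> in the
    first two, of size \<open>M\<close>, and the variation of the cutoff in the third, of order
    \<open>1 / d\<close>.\<close>
  define W where "W i j z = (1 - r (snd z)) * (S i j (x\<^sub>0 + \<mu> *\<^sub>R L (fst z)) - S i j x\<^sub>0)
      + r (snd z) * (G i j (x\<^sub>0 + \<mu> *\<^sub>R L (fst z)) - G i j x\<^sub>0)
      + (r (snd z) - r 0) * (G i j x\<^sub>0 - S i j x\<^sub>0)" for i j z
  define WB where "WB = 4 * 48 * M + 4 * 48 * M + 4 * (48 * (1 + \<xi>) / d) * (2 * K)"
  have sX: "snd z \<in> {- (1 + \<xi>)<..<1 + \<xi>}" if "z \<in> ?X" for z
    using that unfolding model_cylinder_def by auto
  note cut = C2_le_cutoff[OF \<rho> d \<xi>, of t\<^sub>0 a, folded r_def]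
  have W: "C2_le ?X WB (W i j)" if ij: "i \<in> Basis" "j \<in> Basis" for i j
  proof -
    have "x\<^sub>0 \<in> Y" unfolding Y_def by simp
    then have "\<bar>G i j x\<^sub>0\<bar> \<le> K" "\<bar>S i j x\<^sub>0\<bar> \<le> K"
      using C2_leD(2)[OF SG(1)[OF ij]] C2_leD(2)[OF SG(2)[OF ij]] by blast+
    then have "\<bar>G i j x\<^sub>0 - S i j x\<^sub>0\<bar> \<le> 2 * K"
      by linarith
    then show ?thesis
      unfolding W_def[abs_def] WB_def
      by (intro C2_le_add[OF X] C2_le_mult[OF X] C2_le_snd[OF X cut(1) sX] C2_le_snd[OF X cut(2) sX]
          C2_le_snd[OF X cut(3) sX] M SG[OF ij] C2_le_const)
  qed
  define s where "s t = \<mu>\<^sup>2 * (sinh (t + t\<^sub>0))\<^sup>2" for t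
  note fac = C2_le_warping_factor[OF t0' \<xi>, folded \<mu>_def E_def, folded s_def]
  show ?thesis
  proof (intro exI[of _ \<phi>\<^sub>1] conjI \<phi>1 \<open>\<phi>\<^sub>1 0 = \<psi> x\<^sub>0\<close> ballI)
    fix b c :: "(real ^ 'n) \<times> real" assume bc: "b \<in> Basis" "c \<in> Basis"
    define u v where "u = fst b" and "v = fst c"
    \<comment> \<open>The first component of a basis vector of the product is a basis vector or 0,
      so radial and mixed entries are treated together with the spherical ones.\<close>
    have uv: "norm u \<le> 1" "norm v \<le> 1"
      using norm_fst_le[of "fst b" "snd b"] norm_fst_le[of "fst c" "snd c"] bc
      by (simp_all add: u_def v_def norm_Basis)
    have LK: "\<bar>L w \<bullet> i\<bar> \<le> K" if "norm w \<le> 1" "i \<in> Basis" for w i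
    proof -
      have "\<bar>L w \<bullet> i\<bar> \<le> K * norm w"
        using Basis_le_norm[OF that(2), of "L w"] Lb[of w] by linarith
      also have "\<dots> \<le> K" using that(1) K by (simp add: mult_left_le)
      finally show ?thesis .
    qed
    \<comment> \<open>At the centre the form is \<open>u \<bullet> v\<close> by the choice of
      \<open>L\<close>. The deviation from the model thus splits into the variation of the
      interpolated metric, weighted by \<open>s\<close>, and the deviation of \<open>s\<close> from
      \<open>exp (2 * snd z)\<close>.\<close>
    define D where "D z = s (snd z) * (\<Sum>i\<in>Basis. \<Sum>j\<in>Basis. ((L u \<bullet> i) * (L v \<bullet> j)) * W i j z)
        + (u \<bullet> v) * (s (snd z) - exp (2 * snd z))" for z
    have eq: "(sinh (snd z + t\<^sub>0))\<^sup>2 * pullback \<phi>\<^sub>1 (interpolated_metric \<rho> a d g (snd z + t\<^sub>0)) (fst z) u v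
        - exp (2 * snd z) * (u \<bullet> v) = D z" if "z \<in> ?X" for z
    proof -
      have x: "fst z \<in> ball 0 1" using that unfolding model_cylinder_def by auto
      let ?c = "\<lambda>i j. (L u \<bullet> i) * (L v \<bullet> j)"
      have 1: "pullback \<psi> (interpolated_metric \<rho> a d g (snd z + t\<^sub>0)) (y (fst z)) i j
          = S i j (y (fst z)) + r (snd z) * (G i j (y (fst z)) - S i j (y (fst z)))" for i j
        unfolding S_def G_def r_def pullback_def interpolated_metric_def ..
      have "u \<bullet> v = (\<Sum>i\<in>Basis. \<Sum>j\<in>Basis. ?c i j * B i j)"
        using inner_product_on_expand[OF ip, of "L u" "L v"] BL by simp
      moreover have "B i j = S i j x\<^sub>0 + r 0 * (G i j x\<^sub>0 - S i j x\<^sub>0)" for i j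
        unfolding Bexp S_def G_def ..
      ultimately have uv: "u \<bullet> v = (\<Sum>i\<in>Basis. \<Sum>j\<in>Basis. ?c i j * (S i j x\<^sub>0 + r 0 * (G i j x\<^sub>0 - S i j x\<^sub>0)))"
        by simp
      have "W i j z = S i j (y (fst z)) + r (snd z) * (G i j (y (fst z)) - S i j (y (fst z)))
          - (S i j x\<^sub>0 + r 0 * (G i j x\<^sub>0 - S i j x\<^sub>0))" for i j
        unfolding W_def y_def by (simp add: algebra_simps)
      then have 2: "(\<Sum>i\<in>Basis. \<Sum>j\<in>Basis. ?c i j * W i j z)
          = (\<Sum>i\<in>Basis. \<Sum>j\<in>Basis. ?c i j * (S i j (y (fst z)) + r (snd z) * (G i j (y (fst z)) - S i j (y (fst z)))))
            - (u \<bullet> v)"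
        unfolding uv by (simp add: right_diff_distrib sum_subtractf)
      have "(sinh (snd z + t\<^sub>0))\<^sup>2 * pullback \<phi>\<^sub>1 (interpolated_metric \<rho> a d g (snd z + t\<^sub>0)) (fst z) u v
          = s (snd z) * ((\<Sum>i\<in>Basis. \<Sum>j\<in>Basis. ?c i j * W i j z) + (u \<bullet> v))"
        unfolding pull[OF metric_on_sphere_interpolated(1)[OF \<rho> g] x] 1 2 s_def by simp
      then show ?thesis
        unfolding D_def by (simp add: algebra_simps)
    qed
    have "C2_le ?X (4 * K\<^sup>2 * WB) (\<lambda>z. ((L u \<bullet> i) * (L v \<bullet> j)) * W i j z)" if "i \<in> Basis" "j \<in> Basis" for i j
    proof (rule C2_le_cmult[OF X W[OF that]])
      show "\<bar>(L u \<bullet> i) * (L v \<bullet> j)\<bar> \<le> K\<^sup>2"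
        unfolding abs_mult power2_eq_square using LK uv that K by (intro mult_mono) auto
    qed
    then have "C2_le ?X (N * (N * (4 * K\<^sup>2 * WB)))
        (\<lambda>z. \<Sum>i\<in>Basis. \<Sum>j\<in>Basis. ((L u \<bullet> i) * (L v \<bullet> j)) * W i j z)"
      unfolding N_def by (intro C2_le_sum[OF X finite_Basis])
    moreover have "\<bar>u \<bullet> v\<bar> \<le> 1"
      using Cauchy_Schwarz_ineq2[of u v] mult_mono[OF uv] by simp
    ultimately have "C2_le ?X (4 * (8 * E) * (N * (N * (4 * K\<^sup>2 * WB))) + 4 * 1 * (6 * E * exp (- t\<^sub>0))) D"
      unfolding D_def[abs_def]
      by (intro C2_le_add[OF X] C2_le_mult[OF X] C2_le_cmult[OF X] C2_le_snd[OF X fac(1) sX]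
          C2_le_snd[OF X fac(2) sX])
    moreover have "4 * (8 * E) * (N * (N * (4 * K\<^sup>2 * WB))) + 4 * 1 * (6 * E * exp (- t\<^sub>0))
        \<le> C * (exp (- t\<^sub>0) + 1 / d)"
    proof -
      \<comment> \<open>The numerical constants of \<open>C\<close>: \<open>128 = 4 * 8 * 4\<close>
        from the products with \<open>s\<close> and with the entries of \<open>L\<close>,
        \<open>768 = 2 * 4 * 48 * 2\<close> with the last 2 from \<mu>,
        \<open>384 = 4 * 48 * 2\<close>, and \<open>24 = 4 * 6\<close>.\<close>
      define P Q R where "P = 128 * E * N\<^sup>2 * K\<^sup>2" and "Q = 768 * N\<^sup>2 * K ^ 3" and "R = 384 * (1 + \<xi>) * K"
      have nn: "0 \<le> P" "0 \<le> Q" "0 \<le> R" "0 \<le> E"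
        using \<xi> K N unfolding P_def Q_def R_def E_def by auto
      have 1: "4 * (8 * E) * (N * (N * (4 * K\<^sup>2 * WB))) = P * WB"
        by (simp add: P_def power2_eq_square mult_ac)
      have 2: "WB = Q * exp (- t\<^sub>0) + R * (1 / d)"
        by (simp add: WB_def M_def \<mu>_def Q_def R_def mult_ac)
      have "4 * (8 * E) * (N * (N * (4 * K\<^sup>2 * WB))) + 4 * 1 * (6 * E * exp (- t\<^sub>0))
          = P * (Q * exp (- t\<^sub>0) + R * (1 / d)) + 24 * E * exp (- t\<^sub>0)"
        unfolding 1 by (simp add: 2)
      also have "\<dots> \<le> P * ((Q + R) * (exp (- t\<^sub>0) + 1 / d)) + 24 * E * (exp (- t\<^sub>0) + 1 / d)"
      proof (intro add_mono mult_left_mono)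
        have "0 \<le> Q * (1 / d)" "0 \<le> R * exp (- t\<^sub>0)"
          using nn d by auto
        then show "Q * exp (- t\<^sub>0) + R * (1 / d) \<le> (Q + R) * (exp (- t\<^sub>0) + 1 / d)"
          by (simp add: algebra_simps add_divide_distrib)
      qed (use nn d in auto)
      also have "\<dots> = C * (exp (- t\<^sub>0) + 1 / d)"
        unfolding C_def P_def Q_def R_def by (simp add: algebra_simps)
      finally show ?thesis .
    qed
    ultimately have D: "C2_le ?X (C * (exp (- t\<^sub>0) + 1 / d)) D"
      by (rule C2_le_mono)
    show "C2_le ?X (C * (exp (- t\<^sub>0) + 1 / d))
      (\<lambda>z. (sinh (snd z + t\<^sub>0))\<^sup>2 * pullback \<phi>\<^sub>1 (interpolated_metric \<rho> a d g (snd z + t\<^sub>0)) (fst z) (fst b) (fst c)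
        - exp (2 * snd z) * (fst b \<bullet> fst c))"
      by (rule C2_le_cong[OF X _ D]) (rule eq[unfolded u_def v_def])
  qed
qed

theorem corollary4p6:
  fixes \<rho> :: "real \<Rightarrow> real"
    and A :: "((real ^ 'n) set \<times> (real ^ 'n \<Rightarrow> (real ^ 'n) \<times> real)) set"
    and c \<epsilon> \<xi> :: real
  assumes "cutoff \<rho>"
    and "admissible_atlas A"
    and "c > 1"
    and "\<epsilon> > 0"
    and "\<xi> \<ge> 0"
  shows "\<exists>a\<^sub>0 d\<^sub>0 :: real. \<forall>g. metric_on_sphere g \<and> c_bounded A c g \<longrightarrow>
           (\<forall>a>0. \<forall>d>0. a > a\<^sub>0 \<and> d > d\<^sub>0 \<longrightarrow>
              close_to_hyperbolic a \<epsilon> \<xi> (warping_deformation \<rho> a d g))"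
proof -
  note \<rho> = assms(1) and A = assms(2)
  obtain K\<^sub>1 where K1: "K\<^sub>1 \<ge> 1" "\<forall>g. metric_on_sphere g \<and> c_bounded A c g \<longrightarrow> (\<forall>(U, \<psi>)\<in>A. chart_bounded U \<psi> g K\<^sub>1)"
    using c_bounded_imp_chart_bounded[OF assms(3,2)] by blast
  obtain K\<^sub>2 where K2: "K\<^sub>2 \<ge> 1" "\<forall>z\<in>A. chart_bounded (fst z) (snd z) round_metric K\<^sub>2"
    using admissible_atlas_round_chart_bounded[OF A] by blast
  define K where "K = max K\<^sub>1 K\<^sub>2"
  define N where "N = real DIM(real ^ 'n)"
  define E where "E = exp (2 * (1 + \<xi>))"
  define C where "C = 128 * E * N\<^sup>2 * K\<^sup>2 * (768 * N\<^sup>2 * K ^ 3 + 384 * (1 + \<xi>) * K) + 24 * E"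
  \<comment> \<open>Once \<open>exp t\<^sub>0 > H\<close>, the first entry makes the rescaled charts
    admissible and the second pushes \<open>C * exp (- t\<^sub>0)\<close> below
    \<open>\<epsilon> / 4\<close>.\<close>
  define H where "H = max (2 * N * K) (4 * C / \<epsilon>)"
  \<comment> \<open>A point outside the ball of radius \<open>a - 1 - \<xi>\<close> has
    \<open>t\<^sub>0 \<ge> a - 1 - \<xi>\<close>. The first entry therefore yields
    \<open>t\<^sub>0 \<ge> 1 + \<xi>\<close>, so that the charts avoid the origin, and the second
    yields \<open>t\<^sub>0 > ln H\<close>.\<close>
  define a\<^sub>0 where "a\<^sub>0 = max (2 + 2 * \<xi>) (1 + \<xi> + ln H)"
  \<comment> \<open>The entry 1 serves the cutoff estimate, and the other makes
    \<open>C / d < \<epsilon> / 4\<close>; together with the exponential term this stays below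
    \<epsilon>.\<close>
  define d\<^sub>0 where "d\<^sub>0 = max 1 (4 * C / \<epsilon>)"
  have K: "K \<ge> 1" using K1(1) unfolding K_def by simp
  have N: "N \<ge> 1"
    unfolding N_def using DIM_positive[where 'a = "real ^ 'n"] by linarith
  have "C > 0"
    using K N assms(5) unfolding C_def E_def by (intro add_nonneg_pos mult_nonneg_nonneg add_nonneg_nonneg) auto
  have "2 * N * K > 0" using K N by simp
  then have H: "H > 0" unfolding H_def by (simp add: less_max_iff_disj)
  have "close_to_hyperbolic a \<epsilon> \<xi> (warping_deformation \<rho> a d g)"
    if g: "metric_on_sphere g" "c_bounded A c g" and a: "a > a\<^sub>0" and d: "d > d\<^sub>0" for g a d
  proof -
    let ?h = "warping_deformation \<rho> a d g"
    have a': "a > 2 + 2 * \<xi>" "a > 1 + \<xi> + ln H" and d': "d \<ge> 1" "d > 4 * C / \<epsilon>"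
      using a d unfolding a\<^sub>0_def d\<^sub>0_def by auto
    have pos: "a > 0" "d > 0" using a' d' assms(5) by linarith+
    have h: "metric_on_open UNIV ?h"
      using metric_on_open_warping_deformation[OF A \<rho> g(1) pos] .
    have polar: "pullback polar ?h (\<theta>, t) (u, r) (v, s) = (sinh t)\<^sup>2 * interpolated_metric \<rho> a d g t \<theta> u v + r * s"
      if "\<theta> \<in> sphere 0 1" "t > 0" "u \<in> tangent_sphere \<theta>" "v \<in> tangent_sphere \<theta>" for \<theta> t u v r s
      unfolding warping_deformation_def using that by (intro pullback_polar_from_polar) auto
    have inner: "interpolated_metric \<rho> a d g t \<theta> u v = round_metric \<theta> u v" if "t < a" for t \<theta> u v
    proof -
      have "2 * ((t - a) / d) \<le> 0" using that pos by (simp add: divide_le_0_iff)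
      then have "\<rho> (2 * ((t - a) / d)) = 0" using \<rho> unfolding cutoff_def by blast
      then show ?thesis unfolding interpolated_metric_def by simp
    qed
    have chart: "\<exists>(\<phi> :: (real ^ 'n) \<times> real \<Rightarrow> ((real ^ 'n) \<times> real) \<times> real) \<phi>\<^sub>1 t\<^sub>0. chart_of cylinder (model_cylinder \<xi>) \<phi> \<and> polar (\<phi> (0, 0)) = p \<and>
        chart_of (sphere 0 1) (ball 0 1) \<phi>\<^sub>1 \<and> (\<forall>(x, t)\<in>model_cylinder \<xi>. \<phi> (x, t) = (\<phi>\<^sub>1 x, t + t\<^sub>0)) \<and>
        C2_norm (model_cylinder \<xi>) (\<lambda>z u v. pullback \<phi> (pullback polar ?h) z u v - model_metric z u v) < ennreal \<epsilon>"
      if p: "p \<in> - ball 0 (a - 1 - \<xi>) - {0}" for p :: "(real ^ 'n) \<times> real"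
    proof -
      define t\<^sub>0 where "t\<^sub>0 = norm p"
      have p0: "p \<noteq> 0" using p by blast
      have "t\<^sub>0 \<ge> a - 1 - \<xi>" using p unfolding t\<^sub>0_def by auto
      then have t0: "t\<^sub>0 \<ge> 1 + \<xi>" "t\<^sub>0 > ln H" using a' by linarith+
      have "exp t\<^sub>0 > H"
        using t0(2) H by (metis exp_less_cancel_iff exp_ln)
      then have He: "H * exp (- t\<^sub>0) < 1"
        by (simp add: exp_minus field_simps)
      have "\<exists>(U, \<psi>)\<in>A. \<exists>x\<in>U. \<psi> x = radial_proj p \<and> infdist x (- U) \<ge> 1"
        using A norm_radial_proj[OF p0] unfolding admissible_atlas_def by (elim conjE bspec) simp
      then obtain U \<psi> x\<^sub>0 where U: "(U, \<psi>) \<in> A" and x0: "\<psi> x\<^sub>0 = radial_proj p" "infdist x\<^sub>0 (- U) \<ge> 1"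
        by auto
      have ball: "ball x\<^sub>0 1 \<subseteq> U"
      proof
        fix x assume "x \<in> ball x\<^sub>0 1"
        then show "x \<in> U"
          using infdist_le[of x "- U" x\<^sub>0] x0(2) by fastforce
      qed
      have \<psi>: "chart_of (sphere 0 1) U \<psi>"
        using A U unfolding admissible_atlas_def by blast
      have bd: "chart_bounded U \<psi> round_metric K" "chart_bounded U \<psi> g K"
        using chart_bounded_mono[OF _ _ \<psi> metric_on_sphere_round] chart_bounded_mono[OF _ _ \<psi> g(1)] K1(2) K2(2) U g
        unfolding K_def by fastforce+
      have "2 * N * K * exp (- t\<^sub>0) \<le> H * exp (- t\<^sub>0)"
        unfolding H_def by (intro mult_right_mono) auto
      then have t0': "2 * N * K * exp (- t\<^sub>0) \<le> 1"
        using He by linarith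
      obtain \<phi>\<^sub>1 :: "real ^ 'n \<Rightarrow> (real ^ 'n) \<times> real" where \<phi>1: "chart_of (sphere 0 1) (ball 0 1) \<phi>\<^sub>1" "\<phi>\<^sub>1 0 = \<psi> x\<^sub>0"
        and est: "\<forall>b\<in>(Basis :: ((real ^ 'n) \<times> real) set). \<forall>c\<in>(Basis :: ((real ^ 'n) \<times> real) set). C2_le (model_cylinder \<xi>) (C * (exp (- t\<^sub>0) + 1 / d))
          (\<lambda>z. (sinh (snd z + t\<^sub>0))\<^sup>2 * pullback \<phi>\<^sub>1 (interpolated_metric \<rho> a d g (snd z + t\<^sub>0)) (fst z) (fst b) (fst c)
            - exp (2 * snd z) * (fst b \<bullet> fst c))"
        using rescaled_chart_estimate[OF \<rho> \<psi> g(1) bd K ball d'(1) assms(5), folded N_def, OF t0',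
            folded E_def, folded C_def, of a] by (elim exE conjE)
      define \<phi> where "\<phi> z = (\<phi>\<^sub>1 (fst z), snd z + t\<^sub>0)" for z :: "(real ^ 'n) \<times> real"
      have X: "open (model_cylinder \<xi> :: ((real ^ 'n) \<times> real) set)"
        unfolding model_cylinder_def by (intro open_Times) auto
      have "C2_norm (model_cylinder \<xi>) (\<lambda>z u v. pullback \<phi> (pullback polar ?h) z u v - model_metric z u v)
          \<le> ennreal (C * (exp (- t\<^sub>0) + 1 / d))"
      proof (rule C2_norm_leI)
        show "0 \<le> C * (exp (- t\<^sub>0) + 1 / d)"
          using \<open>C > 0\<close> pos by simp
        show "C2_le (model_cylinder \<xi>) (C * (exp (- t\<^sub>0) + 1 / d))
            (\<lambda>z. pullback \<phi> (pullback polar ?h) z b c - model_metric z b c)" if "b \<in> Basis" "c \<in> Basis" for b c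
          by (rule C2_le_cong[OF X _ est[rule_format, OF that]])
            (simp add: \<phi>_def[abs_def] pullback_warping_deformation[OF \<phi>1(1) _ t0(1)] model_metric_def)
      qed
      also have "\<dots> < ennreal \<epsilon>"
      proof (rule ennreal_lessI[OF assms(4)])
        have "4 * C / \<epsilon> * exp (- t\<^sub>0) \<le> H * exp (- t\<^sub>0)"
          unfolding H_def by (intro mult_right_mono) auto
        then have "4 * C / \<epsilon> * exp (- t\<^sub>0) < 1"
          using He by linarith
        then have "C * exp (- t\<^sub>0) < \<epsilon> / 4"
          using assms(4) by (simp add: field_simps)
        moreover have "C * (1 / d) < \<epsilon> / 4"
          using d'(2) assms(4) pos by (simp add: field_simps)
        ultimately show "C * (exp (- t\<^sub>0) + 1 / d) < \<epsilon>"
          using assms(4) unfolding distrib_left by linarith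
      qed
      finally have norm: "C2_norm (model_cylinder \<xi>)
          (\<lambda>z u v. pullback \<phi> (pullback polar ?h) z u v - model_metric z u v) < ennreal \<epsilon>" .
      have "polar (\<phi> (0, 0)) = p"
        using p0 by (simp add: polar_def \<phi>_def \<phi>1(2) x0(1) radial_proj_def t\<^sub>0_def)
      moreover have "chart_of cylinder (model_cylinder \<xi>) \<phi>"
        unfolding \<phi>_def by (rule chart_of_cylinder[OF \<phi>1(1) t0(1)])
      ultimately show ?thesis
        using \<phi>1(1) norm by (intro exI[of _ \<phi>] exI[of _ \<phi>\<^sub>1] exI[of _ t\<^sub>0]) (auto simp: \<phi>_def)
    qed
    show ?thesis
      unfolding close_to_hyperbolic_def radially_close_def
    proof (intro conjI ballI allI)
      show "metric_on_open (- {0}) ?h"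
        using h smooth_on_subset[OF _ subset_UNIV] unfolding metric_on_open_def by blast
      show "\<exists>k. (\<forall>t>0. metric_on_sphere (k t)) \<and>
        (\<forall>\<theta>\<in>sphere 0 1. \<forall>t>0. \<forall>u\<in>tangent_sphere \<theta>. \<forall>v\<in>tangent_sphere \<theta>. \<forall>r s.
           pullback polar ?h (\<theta>, t) (u, r) (v, s) = k t \<theta> u v + r * s)"
        using polar metric_on_sphere_interpolated(2)[OF \<rho> g(1)]
        by (intro exI[of _ "\<lambda>t \<theta> u v. (sinh t)\<^sup>2 * interpolated_metric \<rho> a d g t \<theta> u v"]) simp
    qed (use h polar inner chart in auto)
  qed
  then show ?thesis by blast
qed

end
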